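(* Let $\Omega=\mathbb{R}^d$ or $\mathbb{T}^d$ ($d\ge1$), $0<t_*\le\infty$, $\Gamma=\Omega\times(0,t_* )$. Let $(u^\varepsilon,\varrho^\varepsilon,\mathbf{v}^\varepsilon)$, $0<\varepsilon<\varepsilon_0$, be smooth solutions on $\Gamma$ of the compressible Navier–Stokes system with transport coefficients scaled by $\varepsilon$, satisfying Assumptions 1–3 stated in the context, with strong limits $u,\varrho,\mathbf{v}$ as $\varepsilon\to0$. Then $(u,\varrho,\mathbf{v})$ is a weak (distributional) solution on $\Gamma$ of the compressible Euler system $$\partial_t\varrho+\nabla_x\cdot(\varrho\mathbf{v})=0,\quad \partial_t(\varrho\mathbf{v})+\nabla_x\cdot(\varrho\mathbf{v}\otimes\mathbf{v}+p\mathbf{I})=0,\quad \partial_tE+\nabla_x\cdot((p+E)\mathbf{v})=0,$$ with $E=\frac12\varrho|\mathbf{v}|^2+u$, $p=p(u,\varrho)$. Furthermore, the distributional limit $$p*\Theta:=\lim_{\varepsilon\to0}p^\varepsilon\Theta^\varepsilon\quad\text{in }\mathcal{D}'(\Gamma)$$ necessarily exists, and the following hold in the sense of distributions on $\Gamma$: $$\partial_t\left(\tfrac12\varrho|\mathbf{v}|^2\right)+\nabla_x\cdot\left(\left(p+\tfrac12\varrho|\mathbf{v}|^2\right)\mathbf{v}\right)=p*\Theta-Q,$$ $$\partial_tu+\nabla_x\cdot(u\mathbf{v})=Q-p*\Theta,$$ $$\partial_ts+\nabla_x\cdot(s\mathbf{v})=\Sigma,$$ where $s=s(u,\varrho)$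 and $Q\ge0$, $\Sigma\ge0$ are the limit distributions of Assumption 3.
   Context: Thermodynamics. The entropy density $s=s(u,\varrho)$ is a given concave function of internal energy density $u$ and mass density $\varrho$. Temperature $T(u,\varrho)>0$, chemical potential $\mu(u,\varrho)$ and pressure $p(u,\varrho)$ are determined by $T\,ds=du-\mu\,d\varrho$ and $Ts=u+p-\mu\varrho$. The shear viscosity $\eta(u,\varrho)>0$, bulk viscosity $\zeta(u,\varrho)>0$ and thermal conductivity $\kappa(u,\varrho)>0$ are given functions. Navier–Stokes system with parameter $\varepsilon>0$. Write $h^\varepsilon=h(u^\varepsilon,\varrho^\varepsilon)$ for $h=p,T,\mu,s$, and $\eta^\varepsilon=\varepsilon\,\eta(u^\varepsilon,\varrho^\varepsilon)$, $\zeta^\varepsilon=\varepsilon\,\zeta(u^\varepsilon,\varrho^\varepsilon)$, $\kappa^\varepsilon=\varepsilon\,\kappa(u^\varepsilon,\varrho^\varepsilon)$; $\Theta^\varepsilon=\nabla_x\cdot\mathbf{v}^\varepsilon$, $\mathbf{S}^\varepsilon=\frac12(\nabla_x\mathbf{v}^\varepsilon+(\nabla_x\mathbf{v}^\varepsilon)^\top-\frac2d\Theta^\varepsilon\mathbf{I})$, $\mathbf{T}^\varepsilon=-2\eta^\varepsilon\mathbf{S}^\varepsilon-\zeta^\varepsilon\Theta^\varepsilon\mathbf{I}$, $E^\varepsilon=\frac12\varrho^\varepsilon|\mathbf{v}^\varepsilon|^2+u^\varepsilon$. The system is $$\partial_t\varrho^\varepsilon+\nabla_x\cdot(\varrho^\varepsilon\mathbf{v}^\varepsilon)=0,\quad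 \partial_t(\varrho^\varepsilon\mathbf{v}^\varepsilon)+\nabla_x\cdot(\varrho^\varepsilon\mathbf{v}^\varepsilon\otimes\mathbf{v}^\varepsilon+p^\varepsilon\mathbf{I}+\mathbf{T}^\varepsilon)=0,$$ $$\partial_tE^\varepsilon+\nabla_x\cdot\left((p^\varepsilon+E^\varepsilon)\mathbf{v}^\varepsilon+\mathbf{T}^\varepsilon\cdot\mathbf{v}^\varepsilon-\kappa^\varepsilon\nabla_xT^\varepsilon\right)=0.$$ Assumption 1. For each $\varepsilon$, $(u^\varepsilon,\varrho^\varepsilon,\mathbf{v}^\varepsilon)$ is a smooth solution on $\Gamma$; these are bounded in $L^\infty(\Gamma)$ uniformly for $\varepsilon<\varepsilon_0$; for some $1\le q<\infty$, $u^\varepsilon\to u$, $\varrho^\varepsilon\to\varrho$, $\mathbf{v}^\varepsilon\to\mathbf{v}$ strongly in $L^q_{loc}(\Gamma)$ as $\varepsilon\to 0$ (i.e. in $L^q(O)$ for every open $O$ with compact closure contained in $\Gamma$); and $\varrho^\varepsilon\ge\varrho_0$ for some constant $\varrho_0>0$ and all $\varepsilon<\varepsilon_0$. Assumption 2. Let $\mathcal{R}$, $\mathcal{R}^\varepsilon\subset\mathbb{R}^2$ be the essential ranges of $(u,\varrho)$, $(u^\varepsilon,\varrho^\varepsilon)$ over $\Gamma$. There are a compact $K\subset\mathbb{R}^2$ and an open $U\supset K$ such that the closed convex hull of $\mathcal{R}^\varepsilon\cup\mathcal{R}$ lies in $K$ for all $\varepsilon<\varepsilon_0$, and all functions $h=p,T,\mu,s,\eta,\zeta,\kappa$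 belong to $C^M(U)$ with $M\ge2$. Assumption 3. As $\varepsilon\to0$, in $\mathcal{D}'(\Gamma)$, $$Q^\varepsilon:=2\eta^\varepsilon|\mathbf{S}^\varepsilon|^2+\zeta^\varepsilon(\Theta^\varepsilon)^2\to Q,\qquad \Sigma^\varepsilon:=\frac{Q^\varepsilon}{T^\varepsilon}+\kappa^\varepsilon\left|\frac{\nabla_xT^\varepsilon}{T^\varepsilon}\right|^2\to\Sigma.$$ (The limits are non-negative distributions, hence Radon measures.) *)

theory Defs
  imports "HOL-Analysis.Analysis"
begin

section \<open>Space-time domains\<close>

text \<open>
  \<open>\<Omega>\<close> is \<open>\<real>^d\<close> or the flat torus \<open>\<real>^d/\<int>^d\<close>, where \<open>d = CARD('d)\<close>.  Both are written as
  \<open>\<real>^d/L\<close> with the translation lattice \<open>L = {0}\<close> or \<open>L = \<int>^d\<close>.  A function on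
  \<open>\<Omega> \<times> (0,t\<^sub>*)\<close> is represented by its \<open>L\<close>-periodic lift to \<open>\<real>^d \<times> (0,t\<^sub>*)\<close>, and a
  subset by its \<open>L\<close>-invariant preimage.  Integrals over \<open>\<Omega> \<times> (0,t\<^sub>*)\<close> are taken over a
  fundamental cell of \<open>L\<close>.
\<close>

datatype space_domain = Whole_Space | Torus

type_synonym 'd spacetime = "(real^'d) \<times> real"

definition lattice :: "space_domain \<Rightarrow> (real^'d::finite) set" where
  "lattice \<Omega> = (case \<Omega> of Whole_Space \<Rightarrow> {0} | Torus \<Rightarrow> {k. \<forall>i. k $ i \<in> \<int>})"

definition cell :: "space_domain \<Rightarrow> (real^'d::finite) set" where
  "cell \<Omega> = (case \<Omega> of Whole_Space \<Rightarrow> UNIV | Torus \<Rightarrow> {x. \<forall>i. 0 \<le> x $ i \<and> x $ i < 1})"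

definition cover :: "ereal \<Rightarrow> 'd::finite spacetime set" where
  "cover ts = {(x, t). 0 < t \<and> ereal t < ts}"

definition periodic :: "space_domain \<Rightarrow> ereal \<Rightarrow> ('d::finite spacetime \<Rightarrow> 'b) \<Rightarrow> bool" where
  "periodic \<Omega> ts f \<longleftrightarrow> (\<forall>k\<in>lattice \<Omega>. \<forall>(x, t)\<in>cover ts. f (x + k, t) = f (x, t))"

definition saturate :: "space_domain \<Rightarrow> 'd::finite spacetime set \<Rightarrow> 'd spacetime set" where
  "saturate \<Omega> A = {(x + k, t) | x k t. (x, t) \<in> A \<and> k \<in> lattice \<Omega>}"

text \<open>Preimages of the compact subsets of \<open>\<Omega> \<times> (0,t\<^sub>*)\<close>.\<close>

definition compact_in :: "space_domain \<Rightarrow> ereal \<Rightarrow> 'd::finite spacetime set \<Rightarrow> bool" where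
  "compact_in \<Omega> ts A \<longleftrightarrow> (\<exists>K. compact K \<and> K \<subseteq> cover ts \<and> A = saturate \<Omega> K)"

definition spacetime :: "space_domain \<Rightarrow> ereal \<Rightarrow> 'd::finite spacetime measure" where
  "spacetime \<Omega> ts = lebesgue_on (cover ts \<inter> cell \<Omega> \<times> UNIV)"

definition essential_range :: "'a measure \<Rightarrow> ('a \<Rightarrow> 'b::topological_space) \<Rightarrow> 'b set" where
  "essential_range M f =
     {y. \<forall>V. open V \<and> y \<in> V \<longrightarrow> emeasure M {z \<in> space M. f z \<in> V} > 0}"

section \<open>Differentiability\<close>

primrec C_k_on ::
    "nat \<Rightarrow> ('a::real_normed_vector \<Rightarrow> 'b::real_normed_vector) \<Rightarrow> 'a set \<Rightarrow> bool" where
  "C_k_on 0 f S \<longleftrightarrow> continuous_on S f"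
| "C_k_on (Suc k) f S \<longleftrightarrow> (\<forall>x\<in>S. f differentiable at x) \<and>
     (\<forall>v. C_k_on k (\<lambda>x. frechet_derivative f (at x) v) S)"

definition smooth_on ::
    "('a::real_normed_vector \<Rightarrow> 'b::real_normed_vector) \<Rightarrow> 'a set \<Rightarrow> bool" where
  "smooth_on f S \<longleftrightarrow> (\<forall>k. C_k_on k f S)"

primrec iterated_deriv :: "'a::real_normed_vector list \<Rightarrow> ('a \<Rightarrow> real) \<Rightarrow> 'a \<Rightarrow> real" where
  "iterated_deriv [] f = f"
| "iterated_deriv (v # vs) f = iterated_deriv vs (\<lambda>x. frechet_derivative f (at x) v)"

definition time_deriv :: "('d::finite spacetime \<Rightarrow> real) \<Rightarrow> 'd spacetime \<Rightarrow> real" where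
  "time_deriv f z = frechet_derivative f (at z) (0, 1)"

definition space_deriv :: "'d::finite \<Rightarrow> ('d spacetime \<Rightarrow> real) \<Rightarrow> 'd spacetime \<Rightarrow> real" where
  "space_deriv i f z = frechet_derivative f (at z) (axis i 1, 0)"

definition gradient :: "('d::finite spacetime \<Rightarrow> real) \<Rightarrow> 'd spacetime \<Rightarrow> real^'d" where
  "gradient f z = (\<chi> i. space_deriv i f z)"

definition divergence :: "('d::finite spacetime \<Rightarrow> real^'d) \<Rightarrow> 'd spacetime \<Rightarrow> real" where
  "divergence w z = (\<Sum>i\<in>UNIV. space_deriv i (\<lambda>y. w y $ i) z)"

definition vector_gradient :: "('d::finite spacetime \<Rightarrow> real^'d) \<Rightarrow> 'd spacetime \<Rightarrow> real^'d^'d" where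
  "vector_gradient w z = (\<chi> i j. space_deriv i (\<lambda>y. w y $ j) z)"

definition outer :: "real^'d::finite \<Rightarrow> real^'d \<Rightarrow> real^'d^'d" where
  "outer a b = (\<chi> i j. a $ i * b $ j)"

section \<open>Distributions\<close>

definition test_function :: "space_domain \<Rightarrow> ereal \<Rightarrow> ('d::finite spacetime \<Rightarrow> real) \<Rightarrow> bool" where
  "test_function \<Omega> ts \<phi> \<longleftrightarrow>
     smooth_on \<phi> UNIV \<and> periodic \<Omega> ts \<phi> \<and> compact_in \<Omega> ts (closure {z. \<phi> z \<noteq> 0})"

text \<open>
  Continuity is the usual seminorm estimate on every compact set.  Multi-indices are
  replaced by lists of coordinate directions, so each partial derivative is repeated
  once for every order of differentiation; this only affects the constant.
\<close>

definition distribution ::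
    "space_domain \<Rightarrow> ereal \<Rightarrow> (('d::finite spacetime \<Rightarrow> real) \<Rightarrow> real) \<Rightarrow> bool" where
  "distribution \<Omega> ts \<Lambda> \<longleftrightarrow>
     (\<forall>\<phi> \<psi>. test_function \<Omega> ts \<phi> \<longrightarrow> test_function \<Omega> ts \<psi> \<longrightarrow>
        \<Lambda> (\<lambda>z. \<phi> z + \<psi> z) = \<Lambda> \<phi> + \<Lambda> \<psi>) \<and>
     (\<forall>c \<phi>. test_function \<Omega> ts \<phi> \<longrightarrow> \<Lambda> (\<lambda>z. c * \<phi> z) = c * \<Lambda> \<phi>) \<and>
     (\<forall>A. compact_in \<Omega> ts A \<longrightarrow>
        (\<exists>C N. \<forall>\<phi>. test_function \<Omega> ts \<phi> \<and> {z. \<phi> z \<noteq> 0} \<subseteq> A \<longrightarrow>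
           \<bar>\<Lambda> \<phi>\<bar> \<le> C * (\<Sum>vs | set vs \<subseteq> Basis \<and> length vs \<le> N.
                          SUP z. \<bar>iterated_deriv vs \<phi> z\<bar>)))"

definition nonneg_distribution ::
    "space_domain \<Rightarrow> ereal \<Rightarrow> (('d::finite spacetime \<Rightarrow> real) \<Rightarrow> real) \<Rightarrow> bool" where
  "nonneg_distribution \<Omega> ts \<Lambda> \<longleftrightarrow> distribution \<Omega> ts \<Lambda> \<and>
     (\<forall>\<phi>. test_function \<Omega> ts \<phi> \<longrightarrow> (\<forall>z. 0 \<le> \<phi> z) \<longrightarrow> 0 \<le> \<Lambda> \<phi>)"

definition locally_integrable ::
    "space_domain \<Rightarrow> ereal \<Rightarrow> ('d::finite spacetime \<Rightarrow> 'b::euclidean_space) \<Rightarrow> bool" where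
  "locally_integrable \<Omega> ts f \<longleftrightarrow>
     (\<forall>A. compact_in \<Omega> ts A \<longrightarrow> set_integrable (spacetime \<Omega> ts) A f)"

text \<open>\<open>f \<epsilon> \<rightarrow> \<Lambda>\<close> as \<open>\<epsilon> \<rightarrow> 0+\<close> in the sense of distributions.\<close>

definition converges_distr ::
    "space_domain \<Rightarrow> ereal \<Rightarrow> (real \<Rightarrow> 'd::finite spacetime \<Rightarrow> real) \<Rightarrow>
     (('d spacetime \<Rightarrow> real) \<Rightarrow> real) \<Rightarrow> bool" where
  "converges_distr \<Omega> ts f \<Lambda> \<longleftrightarrow>
     (\<forall>\<^sub>F \<epsilon> in at_right 0. locally_integrable \<Omega> ts (f \<epsilon>)) \<and> distribution \<Omega> ts \<Lambda> \<and>
     (\<forall>\<phi>. test_function \<Omega> ts \<phi> \<longrightarrow>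
        ((\<lambda>\<epsilon>. \<integral>z. f \<epsilon> z * \<phi> z \<partial>spacetime \<Omega> ts) \<longlongrightarrow> \<Lambda> \<phi>) (at_right 0))"

text \<open>The balance law \<open>\<partial>\<^sub>t a + \<nabla>\<^sub>x \<cdot> F = \<Lambda>\<close> in the sense of distributions.\<close>

definition weak_balance ::
    "space_domain \<Rightarrow> ereal \<Rightarrow> ('d::finite spacetime \<Rightarrow> real) \<Rightarrow> ('d spacetime \<Rightarrow> real^'d) \<Rightarrow>
     (('d spacetime \<Rightarrow> real) \<Rightarrow> real) \<Rightarrow> bool" where
  "weak_balance \<Omega> ts a F \<Lambda> \<longleftrightarrow>
     locally_integrable \<Omega> ts a \<and> locally_integrable \<Omega> ts F \<and>
     (\<forall>\<phi>. test_function \<Omega> ts \<phi> \<longrightarrow>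
        - (\<integral>z. a z * time_deriv \<phi> z \<partial>spacetime \<Omega> ts)
        - (\<integral>z. F z \<bullet> gradient \<phi> z \<partial>spacetime \<Omega> ts) = \<Lambda> \<phi>)"

definition converges_Lq_loc ::
    "space_domain \<Rightarrow> ereal \<Rightarrow> real \<Rightarrow> (real \<Rightarrow> 'd::finite spacetime \<Rightarrow> 'b::euclidean_space) \<Rightarrow>
     ('d spacetime \<Rightarrow> 'b) \<Rightarrow> bool" where
  "converges_Lq_loc \<Omega> ts q f g \<longleftrightarrow>
     (\<forall>O'. open O' \<and> saturate \<Omega> O' = O' \<and> compact_in \<Omega> ts (closure O') \<longrightarrow>
        ((\<lambda>\<epsilon>. \<integral>\<^sup>+z\<in>O'. ennreal (norm (f \<epsilon> z - g z) powr q) \<partial>spacetime \<Omega> ts) \<longlongrightarrow> 0)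
          (at_right 0))"

section \<open>Thermodynamics and the fluid equations\<close>

text \<open>All functions take the pair (internal energy density, mass density).\<close>

record fluid =
  entropy :: "real \<times> real \<Rightarrow> real"
  temperature :: "real \<times> real \<Rightarrow> real"
  chem_potential :: "real \<times> real \<Rightarrow> real"
  pressure :: "real \<times> real \<Rightarrow> real"
  shear_viscosity :: "real \<times> real \<Rightarrow> real"
  bulk_viscosity :: "real \<times> real \<Rightarrow> real"
  conductivity :: "real \<times> real \<Rightarrow> real"

text \<open>
  \<open>W\<close> is the set of admissible thermodynamic states.  The third conjunct is
  \<open>T ds = du - \<mu> d\<rho>\<close>, the fourth \<open>T s = u + p - \<mu> \<rho>\<close>.
\<close>

definition thermodynamic :: "(real \<times> real) set \<Rightarrow> fluid \<Rightarrow> bool" where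
  "thermodynamic W th \<longleftrightarrow> open W \<and> concave_on W (entropy th) \<and>
     (\<forall>w\<in>W. \<exists>ds. (entropy th has_derivative ds) (at w) \<and>
        (\<forall>a b. temperature th w * ds (a, b) = a - chem_potential th w * b)) \<and>
     (\<forall>(u, r)\<in>W. temperature th (u, r) * entropy th (u, r) =
        u + pressure th (u, r) - chem_potential th (u, r) * r) \<and>
     (\<forall>w\<in>W. 0 < temperature th w \<and> 0 < shear_viscosity th w \<and>
        0 < bulk_viscosity th w \<and> 0 < conductivity th w)"

definition energy ::
    "('d::finite spacetime \<Rightarrow> real) \<Rightarrow> ('d spacetime \<Rightarrow> real) \<Rightarrow> ('d spacetime \<Rightarrow> real^'d) \<Rightarrow>
     'd spacetime \<Rightarrow> real" where
  "energy u r v z = 1/2 * r z * (norm (v z))\<^sup>2 + u z"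

definition strain :: "('d::finite spacetime \<Rightarrow> real^'d) \<Rightarrow> 'd spacetime \<Rightarrow> real^'d^'d" where
  "strain v z = (1/2) *\<^sub>R (vector_gradient v z + transpose (vector_gradient v z)
                          - mat (2 / real CARD('d) * divergence v z))"

definition viscous_stress ::
    "fluid \<Rightarrow> real \<Rightarrow> ('d::finite spacetime \<Rightarrow> real) \<Rightarrow> ('d spacetime \<Rightarrow> real) \<Rightarrow>
     ('d spacetime \<Rightarrow> real^'d) \<Rightarrow> 'd spacetime \<Rightarrow> real^'d^'d" where
  "viscous_stress th \<epsilon> u r v z =
     - (2 * (\<epsilon> * shear_viscosity th (u z, r z))) *\<^sub>R strain v z
     - mat (\<epsilon> * bulk_viscosity th (u z, r z) * divergence v z)"

definition navier_stokes ::
    "fluid \<Rightarrow> real \<Rightarrow> ereal \<Rightarrow> ('d::finite spacetime \<Rightarrow> real) \<Rightarrow> ('d spacetime \<Rightarrow> real) \<Rightarrow>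
     ('d spacetime \<Rightarrow> real^'d) \<Rightarrow> bool" where
  "navier_stokes th \<epsilon> ts u r v \<longleftrightarrow> (\<forall>z\<in>cover ts.
     time_deriv r z + divergence (\<lambda>y. r y *\<^sub>R v y) z = 0 \<and>
     (\<forall>i. time_deriv (\<lambda>y. r y * v y $ i) z
        + divergence (\<lambda>y. (r y *\<^sub>R outer (v y) (v y) + mat (pressure th (u y, r y))
                            + viscous_stress th \<epsilon> u r v y) $ i) z = 0) \<and>
     time_deriv (energy u r v) z
        + divergence (\<lambda>y. (pressure th (u y, r y) + energy u r v y) *\<^sub>R v y
            + viscous_stress th \<epsilon> u r v y *v v y
            - (\<epsilon> * conductivity th (u y, r y)) *\<^sub>R
                gradient (\<lambda>x. temperature th (u x, r x)) y) z = 0)"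

text \<open>The norm on matrices is the Frobenius norm.\<close>

definition dissipation ::
    "fluid \<Rightarrow> real \<Rightarrow> ('d::finite spacetime \<Rightarrow> real) \<Rightarrow> ('d spacetime \<Rightarrow> real) \<Rightarrow>
     ('d spacetime \<Rightarrow> real^'d) \<Rightarrow> 'd spacetime \<Rightarrow> real" where
  "dissipation th \<epsilon> u r v z =
     2 * (\<epsilon> * shear_viscosity th (u z, r z)) * (norm (strain v z))\<^sup>2
     + \<epsilon> * bulk_viscosity th (u z, r z) * (divergence v z)\<^sup>2"

definition entropy_production ::
    "fluid \<Rightarrow> real \<Rightarrow> ('d::finite spacetime \<Rightarrow> real) \<Rightarrow> ('d spacetime \<Rightarrow> real) \<Rightarrow>
     ('d spacetime \<Rightarrow> real^'d) \<Rightarrow> 'd spacetime \<Rightarrow> real" where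
  "entropy_production th \<epsilon> u r v z =
     dissipation th \<epsilon> u r v z / temperature th (u z, r z)
     + \<epsilon> * conductivity th (u z, r z) *
       (norm (gradient (\<lambda>y. temperature th (u y, r y)) z /\<^sub>R temperature th (u z, r z)))\<^sup>2"

definition weak_euler ::
    "fluid \<Rightarrow> space_domain \<Rightarrow> ereal \<Rightarrow> ('d::finite spacetime \<Rightarrow> real) \<Rightarrow>
     ('d spacetime \<Rightarrow> real) \<Rightarrow> ('d spacetime \<Rightarrow> real^'d) \<Rightarrow> bool" where
  "weak_euler th \<Omega> ts u r v \<longleftrightarrow>
     weak_balance \<Omega> ts r (\<lambda>z. r z *\<^sub>R v z) (\<lambda>\<phi>. 0) \<and>
     (\<forall>i. weak_balance \<Omega> ts (\<lambda>z. r z * v z $ i)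
        (\<lambda>z. (r z *\<^sub>R outer (v z) (v z) + mat (pressure th (u z, r z))) $ i) (\<lambda>\<phi>. 0)) \<and>
     weak_balance \<Omega> ts (energy u r v)
        (\<lambda>z. (pressure th (u z, r z) + energy u r v z) *\<^sub>R v z) (\<lambda>\<phi>. 0)"

end

theory Submission
  imports Defs
begin

text \<open>
  Multiplying the balance laws by a test function puts all derivatives on it, so strong
  convergence passes every convective flux to the limit.  The viscous and heat fluxes \<open>R\<close>
  satisfy \<open>R\<^sup>2 \<le> C \<epsilon> Z\<close> with \<open>Z\<close> the dissipation or the entropy production, whose integrals
  against test functions converge; hence the fluxes are \<open>O(sqrt \<epsilon>)\<close> and vanish.  In the
  internal energy balance every other term then has a limit, which forces \<open>p\<^sup>\<epsilon> \<Theta>\<^sup>\<epsilon>\<close> to converge.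
\<close>

section \<open>Calculus of finitely often differentiable functions\<close>

text \<open>Only C^2 regularity of the state functions is guaranteed on \<open>U\<close>, so stress
  and heat flux, which contain first derivatives of velocity and temperature, are C^1 and can be
  differentiated just once more; hence the bookkeeping of orders in \<open>C_k_on\<close>. Nonlinear
  terms converge for two reasons: bounded families converging in mean may be multiplied, and state
  functions are Lipschitz along segments inside \<open>K\<close>; the convex hull in the range
  hypothesis supplies segments from a state to its limit. That hypothesis concerns essential ranges
  while the balance laws are pointwise, and continuity of the approximations bridges the gap. On the
  torus periodic lifts have unbounded support, so integration by parts rests on translation
  invariance over a half-open cell. The seminorm bound that makes the defect a
  \<open>distribution\<close> is not drawn from a uniform boundedness argument but from its explicit
  formula: \<open>Q\<close> plus weak first derivatives of locally integrable functions.\<close>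

abbreviation D :: "'a::real_normed_vector \<Rightarrow> ('a \<Rightarrow> 'b::real_normed_vector) \<Rightarrow> 'a \<Rightarrow> 'b" where
  "D v f x \<equiv> frechet_derivative f (at x) v"

text \<open>\<open>frechet_derivative\<close> is a choice from the set of all derivatives, and both
  functions have the same set; hence equality holds even where no derivative exists.\<close>

lemma frechet_derivative_cong_open:
  assumes "open S" "x \<in> S" "\<And>y. y \<in> S \<Longrightarrow> f y = g y"
  shows "frechet_derivative f (at x) = frechet_derivative g (at x)"
proof -
  have "(f has_derivative f') (at x) \<longleftrightarrow> (g has_derivative f') (at x)" for f'
    using assms has_derivative_transform_within_open[of f f' x UNIV S g]
      has_derivative_transform_within_open[of g f' x UNIV S f] by auto
  then show ?thesis
    unfolding frechet_derivative_def by simp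
qed

lemma differentiable_cong_open:
  assumes "open S" "x \<in> S" "\<And>y. y \<in> S \<Longrightarrow> f y = g y"
  shows "f differentiable at x \<longleftrightarrow> g differentiable at x"
proof -
  have "(f has_derivative f') (at x) \<longleftrightarrow> (g has_derivative f') (at x)" for f'
    using assms has_derivative_transform_within_open[of f f' x UNIV S g]
      has_derivative_transform_within_open[of g f' x UNIV S f] by auto
  then show ?thesis
    unfolding differentiable_def by simp
qed

lemma frechet_derivative_eqI:
  "(f has_derivative f') (at x) \<Longrightarrow> D v f x = f' v"
  using frechet_derivative_at by metis

lemma has_derivative_frechet:
  "f differentiable at x \<Longrightarrow> (f has_derivative frechet_derivative f (at x)) (at x)"
  using frechet_derivative_works by blast

lemma frechet_derivative_add:
  assumes "f differentiable at x" "g differentiable at x"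
  shows "D v (\<lambda>y. f y + g y) x
    = D v f x + D v g x"
  by (rule frechet_derivative_eqI has_derivative_add has_derivative_frechet assms)+

lemma frechet_derivative_diff:
  assumes "f differentiable at x" "g differentiable at x"
  shows "D v (\<lambda>y. f y - g y) x
    = D v f x - D v g x"
  by (rule frechet_derivative_eqI has_derivative_diff has_derivative_frechet assms)+

lemma frechet_derivative_mult:
  fixes f g :: "'a::real_normed_vector \<Rightarrow> real"
  assumes "f differentiable at x" "g differentiable at x"
  shows "D v (\<lambda>y. f y * g y) x
    = f x * D v g x + D v f x * g x"
  by (rule frechet_derivative_eqI has_derivative_mult has_derivative_frechet assms)+

lemma frechet_derivative_sum:
  assumes "\<And>i. i \<in> I \<Longrightarrow> f i differentiable at x"
  shows "D v (\<lambda>y. \<Sum>i\<in>I. f i y) x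
    = (\<Sum>i\<in>I. D v (f i) x)"
  by (rule frechet_derivative_eqI has_derivative_sum has_derivative_frechet assms | assumption)+

lemma frechet_derivative_inverse:
  fixes f :: "'a::real_normed_vector \<Rightarrow> real"
  assumes "f differentiable at x" "f x \<noteq> 0"
  shows "D v (\<lambda>y. inverse (f y)) x
    = - (inverse (f x) * (D v f x * inverse (f x)))"
  using frechet_derivative_eqI[OF Deriv.has_derivative_inverse[OF assms(2) has_derivative_frechet[OF assms(1)]]]
  by simp

lemma frechet_derivative_linear:
  assumes "bounded_linear g" "f differentiable at x"
  shows "D v (\<lambda>y. g (f y)) x = g (D v f x)"
  by (rule frechet_derivative_eqI bounded_linear.has_derivative has_derivative_frechet assms)+

lemma has_derivative_compose_pair:
  fixes h :: "real \<times> real \<Rightarrow> real" and a b :: "'a::real_normed_vector \<Rightarrow> real"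
  assumes a: "a differentiable at x" and b: "b differentiable at x"
    and h: "h differentiable at (a x, b x)"
  shows "((\<lambda>y. h (a y, b y)) has_derivative
    (\<lambda>v. frechet_derivative h (at (a x, b x))
      (D v a x, D v b x))) (at x)"
proof -
  have "((\<lambda>y. (a y, b y)) has_derivative
     (\<lambda>v. (D v a x, D v b x))) (at x)"
    by (rule has_derivative_Pair has_derivative_frechet a b)+
  from has_derivative_compose[OF this has_derivative_frechet[OF h]] show ?thesis .
qed

lemma frechet_derivative_compose_pair:
  fixes h :: "real \<times> real \<Rightarrow> real" and a b :: "'a::real_normed_vector \<Rightarrow> real"
  assumes a: "a differentiable at x" and b: "b differentiable at x"
    and h: "h differentiable at (a x, b x)"
  shows "D v (\<lambda>y. h (a y, b y)) x
    = D (1, 0) h (a x, b x) * D v a x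
      + D (0, 1) h (a x, b x) * D v b x"
proof -
  let ?L = "frechet_derivative h (at (a x, b x))"
  let ?s = "D v a x" and ?t = "D v b x"
  have L: "linear ?L"
    using h linear_frechet_derivative by blast
  have "(?s, ?t) = ?s *\<^sub>R (1, 0) + ?t *\<^sub>R (0, 1)" by simp
  then have "?L (?s, ?t) = ?L (1, 0) * ?s + ?L (0, 1) * ?t"
    by (simp only: linear_add[OF L] linear_scale[OF L]) (simp add: mult.commute)
  then show ?thesis
    using frechet_derivative_eqI[OF has_derivative_compose_pair[OF assms]] by simp
qed

text \<open>On an open set derivatives depend only on the values there, so the induction passes to
  directional derivatives. The closure rules below use this to replace the derivative of a compound
  function by its formula on \<open>S\<close> alone.\<close>

lemma C_k_on_cong:
  assumes "open S" "\<And>y. y \<in> S \<Longrightarrow> f y = g y"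
  shows "C_k_on k f S \<longleftrightarrow> C_k_on k g S"
  using assms(2)
proof (induction k arbitrary: f g)
  case 0
  then show ?case by (auto intro: continuous_on_cong)
next
  case (Suc k)
  have "C_k_on k (D v f) S
      \<longleftrightarrow> C_k_on k (D v g) S" for v
    by (intro Suc.IH) (use frechet_derivative_cong_open[OF assms(1)] Suc.prems in metis)
  moreover have "f differentiable at x \<longleftrightarrow> g differentiable at x" if "x \<in> S" for x
    by (rule differentiable_cong_open[OF assms(1) that Suc.prems])
  ultimately show ?case by simp
qed

lemma C_k_on_SucD: "C_k_on (Suc k) f S \<Longrightarrow> C_k_on k f S"
proof (induction k arbitrary: f)
  case 0
  then show ?case
    by (auto intro!: continuous_at_imp_continuous_on differentiable_imp_continuous_within)
next
  case (Suc k)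
  then show ?case by (metis C_k_on.simps(2))
qed

lemma C_k_on_mono: "C_k_on m f S \<Longrightarrow> k \<le> m \<Longrightarrow> C_k_on k f S"
proof (induction m)
  case (Suc m)
  then show ?case using C_k_on_SucD by (metis le_Suc_eq)
qed simp

lemma C_k_on_subset: "C_k_on k f S \<Longrightarrow> T \<subseteq> S \<Longrightarrow> C_k_on k f T"
  by (induction k arbitrary: f) (auto intro: continuous_on_subset)

lemma C_k_on_deriv: "C_k_on (Suc k) f S \<Longrightarrow> C_k_on k (D v f) S"
  by simp

lemma C_k_on_differentiable: "C_k_on k f S \<Longrightarrow> 0 < k \<Longrightarrow> x \<in> S \<Longrightarrow> f differentiable at x"
  by (cases k) auto

lemma C_k_on_continuous: "C_k_on k f S \<Longrightarrow> continuous_on S f"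
  using C_k_on_mono[of k f S 0] by simp

lemma C_k_on_const: "C_k_on k (\<lambda>x. c) S"
  by (induction k arbitrary: c) simp_all

lemma C_k_on_add:
  assumes S: "open S"
  shows "C_k_on k f S \<Longrightarrow> C_k_on k g S \<Longrightarrow> C_k_on k (\<lambda>x. f x + g x) S"
proof (induction k arbitrary: f g)
  case 0
  then show ?case by (auto intro: continuous_intros)
next
  case (Suc k)
  have "C_k_on k (\<lambda>x. D v f x + D v g x) S" for v
    by (intro Suc.IH C_k_on_deriv Suc.prems)
  then have "C_k_on k (\<lambda>x. D v (\<lambda>x. f x + g x) x) S" for v
    by (subst C_k_on_cong[OF S frechet_derivative_add]) (use Suc.prems in auto)
  then show ?case using Suc.prems by (auto intro: differentiable_add)
qed

lemma C_k_on_mult: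
  fixes f g :: "'a::real_normed_vector \<Rightarrow> real"
  assumes S: "open S"
  shows "C_k_on k f S \<Longrightarrow> C_k_on k g S \<Longrightarrow> C_k_on k (\<lambda>x. f x * g x) S"
proof (induction k arbitrary: f g)
  case 0
  then show ?case by (auto intro: continuous_intros)
next
  case (Suc k)
  have "C_k_on k (\<lambda>x. f x * D v g x + D v f x * g x) S" for v
    by (intro Suc.IH C_k_on_add[OF S] C_k_on_deriv Suc.prems C_k_on_SucD)
  then have "C_k_on k (\<lambda>x. D v (\<lambda>x. f x * g x) x) S" for v
    by (subst C_k_on_cong[OF S frechet_derivative_mult]) (use Suc.prems in auto)
  then show ?case using Suc.prems by (auto intro: differentiable_mult)
qed

lemma C_k_on_cmult:
  fixes f :: "'a::real_normed_vector \<Rightarrow> real"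
  shows "open S \<Longrightarrow> C_k_on k f S \<Longrightarrow> C_k_on k (\<lambda>x. c * f x) S"
  by (intro C_k_on_mult C_k_on_const)

lemma C_k_on_diff:
  fixes f g :: "'a::real_normed_vector \<Rightarrow> real"
  assumes "open S" "C_k_on k f S" "C_k_on k g S"
  shows "C_k_on k (\<lambda>x. f x - g x) S"
  using C_k_on_add[OF assms(1,2) C_k_on_cmult[OF assms(1,3), of "-1"]] by simp

lemma C_k_on_sum:
  assumes "open S" "\<And>i. i \<in> I \<Longrightarrow> C_k_on k (f i) S"
  shows "C_k_on k (\<lambda>x. \<Sum>i\<in>I. f i x) S"
proof (cases "finite I")
  case True
  then show ?thesis using assms(2)
    by (induction I rule: finite_induct) (auto intro: C_k_on_const C_k_on_add[OF assms(1)])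
qed (simp add: C_k_on_const)

text \<open>The derivative formula contains only \<open>inverse (f x)\<close> and a derivative of
  \<open>f\<close>, so the induction hypothesis one order lower closes the step.\<close>

lemma C_k_on_inverse:
  fixes f :: "'a::real_normed_vector \<Rightarrow> real"
  assumes S: "open S" and nz: "\<And>x. x \<in> S \<Longrightarrow> f x \<noteq> 0"
  shows "C_k_on k f S \<Longrightarrow> C_k_on k (\<lambda>x. inverse (f x)) S"
proof (induction k)
  case 0
  then show ?case using nz by (auto intro: continuous_intros)
next
  case (Suc k)
  have "C_k_on k (\<lambda>x. - 1 * (inverse (f x) * (D v f x * inverse (f x)))) S" for v
    by (intro C_k_on_cmult C_k_on_mult Suc.IH S C_k_on_deriv Suc.prems C_k_on_SucD[OF Suc.prems])
  then have "C_k_on k (\<lambda>x. D v (\<lambda>x. inverse (f x)) x) S" for v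
    by (subst C_k_on_cong[OF S frechet_derivative_inverse]) (use Suc.prems nz in auto)
  then show ?case using Suc.prems nz
    by (auto intro!: differentiable_inverse)
qed

lemma C_k_on_linear:
  assumes S: "open S" and g: "bounded_linear g"
  shows "C_k_on k f S \<Longrightarrow> C_k_on k (\<lambda>x. g (f x)) S"
proof (induction k arbitrary: f)
  case 0
  then show ?case by (auto intro: bounded_linear.continuous_on[OF g])
next
  case (Suc k)
  have "C_k_on k (\<lambda>x. g (D v f x)) S" for v
    by (intro Suc.IH C_k_on_deriv Suc.prems)
  then have "C_k_on k (\<lambda>x. D v (\<lambda>x. g (f x)) x) S" for v
    by (subst C_k_on_cong[OF S frechet_derivative_linear]) (use Suc.prems g in auto)
  moreover have "(\<lambda>x. g (f x)) differentiable at x" if "x \<in> S" for x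
    using Suc.prems that bounded_linear.has_derivative[OF g] unfolding differentiable_def
    by (metis C_k_on.simps(2) has_derivative_frechet)
  ultimately show ?case by simp
qed

text \<open>The chain rule produces partial derivatives of \<open>h\<close> composed with the same
  pair, so the induction generalises over \<open>h\<close> while \<open>a\<close> and
  \<open>b\<close> stay fixed and merely lose one order.\<close>

lemma C_k_on_compose_pair:
  fixes h :: "real \<times> real \<Rightarrow> real" and a b :: "'a::real_normed_vector \<Rightarrow> real"
  assumes S: "open S" and ab: "\<And>x. x \<in> S \<Longrightarrow> (a x, b x) \<in> U"
  shows "C_k_on k h U \<Longrightarrow> C_k_on k a S \<Longrightarrow> C_k_on k b S \<Longrightarrow> C_k_on k (\<lambda>x. h (a x, b x)) S"
proof (induction k arbitrary: h)
  case 0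
  have "continuous_on S (h \<circ> (\<lambda>x. (a x, b x)))"
    using 0 ab by (intro continuous_on_compose continuous_on_Pair)
      (auto intro: continuous_on_subset)
  then show ?case by (simp add: o_def)
next
  case (Suc k)
  have *: "C_k_on k (\<lambda>x. D v h (a x, b x)) S" for v
    by (intro Suc.IH[of "\<lambda>w. D v h w"] C_k_on_deriv Suc.prems
        C_k_on_SucD[OF Suc.prems(2)] C_k_on_SucD[OF Suc.prems(3)])
  have "C_k_on k (\<lambda>x. D (1, 0) h (a x, b x) * D v a x
      + D (0, 1) h (a x, b x) * D v b x) S" for v
    by (intro C_k_on_add C_k_on_mult S * C_k_on_deriv Suc.prems)
  then have "C_k_on k (\<lambda>x. D v (\<lambda>x. h (a x, b x)) x) S" for v
    by (subst C_k_on_cong[OF S frechet_derivative_compose_pair]) (use Suc.prems ab in auto)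
  moreover have "(\<lambda>x. h (a x, b x)) differentiable at x" if "x \<in> S" for x
    using has_derivative_compose_pair[of a x b h] Suc.prems ab that
    unfolding differentiable_def by (metis C_k_on.simps(2) differentiable_def)
  ultimately show ?case by simp
qed

section \<open>Lattices, cells and supports\<close>

lemma zero_in_lattice: "0 \<in> lattice \<Omega>"
  by (cases \<Omega>) (auto simp: lattice_def)

lemma uminus_in_lattice: "k \<in> lattice \<Omega> \<Longrightarrow> - k \<in> lattice \<Omega>"
  by (cases \<Omega>) (auto simp: lattice_def)

lemma axis_in_lattice: "axis i 1 \<in> lattice Torus"
  by (auto simp: lattice_def axis_def)

lemma countable_lattice: "countable (lattice \<Omega> :: (real^'d::finite) set)"
proof (cases \<Omega>)
  case Torus
  have "lattice Torus \<subseteq> range (\<lambda>f::'d \<Rightarrow> int. \<chi> i. real_of_int (f i))"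
  proof
    fix k :: "real^'d" assume "k \<in> lattice Torus"
    then have "k = (\<chi> i. real_of_int \<lfloor>k $ i\<rfloor>)"
      by (simp add: lattice_def vec_eq_iff)
    then show "k \<in> range (\<lambda>f::'d \<Rightarrow> int. \<chi> i. real_of_int (f i))"
      by (intro image_eqI[where x = "\<lambda>i. \<lfloor>k $ i\<rfloor>"]) auto
  qed
  then show ?thesis
    unfolding Torus by (rule countable_subset) (rule countable_image[OF countableI_type])
qed (simp add: lattice_def)

lemma cover_eq: "cover ts = UNIV \<times> {t. 0 < t \<and> ereal t < ts}"
  by (auto simp: cover_def)

lemma open_cover: "open (cover ts)"
proof -
  have "open {t. 0 < t \<and> ereal t < ts}"
    by (intro open_Collect_conj open_Collect_less continuous_intros continuous_on_ereal)
  then show ?thesis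
    unfolding cover_eq by (rule open_Times[OF open_UNIV])
qed

lemma shift_in_cover: "z + (k, 0) \<in> cover ts \<longleftrightarrow> z \<in> cover ts"
  by (cases z) (auto simp: cover_def)

lemma periodic_iff:
  "periodic \<Omega> ts f \<longleftrightarrow> (\<forall>k\<in>lattice \<Omega>. \<forall>z\<in>cover ts. f (z + (k, 0)) = f z)"
  unfolding periodic_def by force

lemma periodicD: "periodic \<Omega> ts f \<Longrightarrow> k \<in> lattice \<Omega> \<Longrightarrow> z \<in> cover ts \<Longrightarrow> f (z + (k, 0)) = f z"
  unfolding periodic_iff by blast

lemma saturate_iff:
  "z \<in> saturate \<Omega> A \<longleftrightarrow> (\<exists>y\<in>A. \<exists>k\<in>lattice \<Omega>. z = y + (k, 0))"
  unfolding saturate_def by force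

lemma saturate_Whole_Space: "saturate Whole_Space A = A"
  by (auto simp: saturate_iff lattice_def simp flip: zero_prod_def)

lemma compact_in_subset_cover: "compact_in \<Omega> ts A \<Longrightarrow> A \<subseteq> cover ts"
  unfolding compact_in_def by (metis saturate_iff shift_in_cover subset_iff)

text \<open>On the torus a saturated set contains all lattice translates, so only its time
  coordinate is bounded; on the whole space the lattice is trivial and position is bounded as
  well.\<close>

lemma compact_in_bounded:
  fixes A :: "'d::finite spacetime set"
  assumes "compact_in \<Omega> ts A"
  obtains R where "0 \<le> R" "\<And>x t. (x, t) \<in> A \<Longrightarrow> \<bar>t\<bar> \<le> R"
    "\<And>x t. \<Omega> = Whole_Space \<Longrightarrow> (x, t) \<in> A \<Longrightarrow> norm x \<le> R"
proof -
  obtain K where K: "compact K" "A = saturate \<Omega> K"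
    using assms unfolding compact_in_def by blast
  obtain R where R: "\<And>y. y \<in> K \<Longrightarrow> norm y \<le> R"
    using K(1) compact_imp_bounded bounded_iff by metis
  show ?thesis
  proof (rule that[of "max 0 R"])
    fix x :: "real^'d" and t assume "(x, t) \<in> A"
    then obtain y k where "(y, t) \<in> K" "x = y + k" "k \<in> lattice \<Omega>"
      unfolding K by (auto simp: saturate_def)
    moreover have "\<bar>t\<bar> \<le> norm (y, t)" "norm y \<le> norm (y, t)"
      using norm_snd_le[of t y] norm_fst_le[of y t] by auto
    ultimately show "\<bar>t\<bar> \<le> max 0 R" "\<Omega> = Whole_Space \<Longrightarrow> norm x \<le> max 0 R"
      using R[of "(y, t)"] by (auto simp: lattice_def)
  qed simp
qed

text \<open>The lattice is countable, so the saturation is a countable union of translates of a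
  compact set.\<close>

lemma compact_in_borel: "compact_in \<Omega> ts A \<Longrightarrow> A \<in> sets borel"
proof -
  assume "compact_in \<Omega> ts A"
  then obtain K where K: "compact K" "A = saturate \<Omega> K"
    unfolding compact_in_def by blast
  have "A = (\<Union>k\<in>lattice \<Omega>. (+) (k, 0) ` K)"
    unfolding K set_eq_iff saturate_iff UN_iff image_iff by (metis add.commute)
  also have "\<dots> \<in> sets borel"
    using K(1) countable_lattice
    by (intro sets.countable_UN') (auto intro!: borel_compact compact_translation)
  finally show ?thesis .
qed

text \<open>Invariance of \<open>B\<close> moves each of its points back to a representative in
  \<open>K\<close>, so the compact set \<open>K \<inter> B\<close> generates
  \<open>B\<close>.\<close>

lemma compact_in_closed_subset:
  assumes A: "compact_in \<Omega> ts A" and B: "closed B" "B \<subseteq> A"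
    and inv: "\<And>z k. z \<in> B \<Longrightarrow> k \<in> lattice \<Omega> \<Longrightarrow> z + (k, 0) \<in> B"
  shows "compact_in \<Omega> ts B"
proof -
  obtain K where K: "compact K" "K \<subseteq> cover ts" "A = saturate \<Omega> K"
    using A unfolding compact_in_def by blast
  have "B = saturate \<Omega> (K \<inter> B)"
  proof (intro set_eqI iffI)
    fix z assume z: "z \<in> B"
    then obtain y k where yk: "y \<in> K" "k \<in> lattice \<Omega>" "z = y + (k, 0)"
      using B(2) unfolding K(3) by (meson saturate_iff subsetD)
    have "z + (- k, 0) \<in> B"
      by (rule inv[OF z uminus_in_lattice[OF yk(2)]])
    moreover have "z + (- k, 0) = y"
      unfolding yk by (simp add: prod_eq_iff)
    ultimately show "z \<in> saturate \<Omega> (K \<inter> B)"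
      using yk unfolding saturate_iff by (metis IntI)
  qed (use inv in \<open>auto simp: saturate_iff\<close>)
  then show ?thesis
    unfolding compact_in_def using K B by (intro exI[of _ "K \<inter> B"]) auto
qed

lemma periodic_bounded:
  assumes f: "continuous_on (cover ts) f" "periodic \<Omega> ts f" and A: "compact_in \<Omega> ts A"
  obtains B where "0 \<le> B" "\<And>z. z \<in> A \<Longrightarrow> norm (f z) \<le> B"
proof -
  obtain K where K: "compact K" "K \<subseteq> cover ts" "A = saturate \<Omega> K"
    using A unfolding compact_in_def by blast
  have "bounded (f ` K)"
    using f(1) K compact_continuous_image continuous_on_subset compact_imp_bounded by metis
  then obtain B where B: "\<And>z. z \<in> K \<Longrightarrow> norm (f z) \<le> B"
    unfolding bounded_iff by auto
  show ?thesis
  proof (rule that[of "max 0 B"])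
    fix z assume "z \<in> A"
    then obtain y k where "y \<in> K" "k \<in> lattice \<Omega>" "z = y + (k, 0)"
      unfolding K saturate_iff by blast
    then show "norm (f z) \<le> max 0 B"
      using periodicD[OF f(2)] K(2) B[of y] by (auto simp: subset_eq)
  qed simp
qed

section \<open>Measurability and local finiteness of the space-time measure\<close>

lemma cell_borel: "cell \<Omega> \<in> sets borel"
proof (cases \<Omega>)
  case Torus
  have *: "cell Torus = (\<Inter>i. {x. 0 \<le> x $ i} \<inter> {x. x $ i < 1})"
    by (auto simp: cell_def)
  have "closed {x :: real^'a. 0 \<le> x $ i}" "open {x :: real^'a. x $ i < 1}" for i
    by (auto intro!: closed_Collect_le open_Collect_less continuous_intros)
  then show ?thesis
    unfolding Torus * by (intro sets.countable_INT') auto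
qed (simp add: cell_def)

lemma cell_times_borel: "cell \<Omega> \<times> (UNIV :: real set) \<in> sets borel"
  using cell_borel[of \<Omega>] by (intro borel_Times) auto

abbreviation spacetime_cell :: "space_domain \<Rightarrow> ereal \<Rightarrow> 'd::finite spacetime set" where
  "spacetime_cell \<Omega> ts \<equiv> cover ts \<inter> cell \<Omega> \<times> UNIV"

lemma spacetime_cell_borel: "spacetime_cell \<Omega> ts \<in> sets borel"
  using open_cover cell_times_borel by (metis borel_open sets.Int)

lemma spacetime_cell_lebesgue: "spacetime_cell \<Omega> ts \<in> sets lebesgue"
  using spacetime_cell_borel by (metis sets_completionI_sets sets_lborel)

lemma space_spacetime: "space (spacetime \<Omega> ts) = spacetime_cell \<Omega> ts"
  by (simp add: spacetime_def)

lemma continuous_measurable_spacetime: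
  "continuous_on (cover ts) f \<Longrightarrow> f \<in> borel_measurable (spacetime \<Omega> ts)"
  for f :: "'d::finite spacetime \<Rightarrow> 'b::euclidean_space"
  unfolding spacetime_def
  by (rule continuous_imp_measurable_on_sets_lebesgue[OF _ spacetime_cell_lebesgue])
    (auto intro: continuous_on_subset)

lemma cell_bounded:
  fixes x :: "real^'d::finite"
  assumes "x \<in> cell Torus"
  shows "norm x \<le> real CARD('d)"
proof -
  have "norm x \<le> (\<Sum>i\<in>UNIV. \<bar>x $ i\<bar>)"
    by (rule norm_le_l1_cart)
  also have "\<dots> \<le> (\<Sum>i\<in>(UNIV::'d set). 1)"
    using assms by (intro sum_mono) (auto simp: cell_def abs_le_iff less_imp_le intro: order_trans[of _ 0])
  finally show ?thesis by simp
qed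

text \<open>Time and, on the whole space, position are bounded by \<open>R\<close>; on the torus
  position is bounded by the cell itself, whose points have norm at most the dimension.\<close>

lemma compact_in_cell_bounded:
  fixes A :: "'d::finite spacetime set"
  assumes "compact_in \<Omega> ts A"
  obtains R where "A \<inter> cell \<Omega> \<times> UNIV \<subseteq> cball 0 R"
proof -
  obtain R where R: "0 \<le> R" "\<And>x t. (x, t) \<in> A \<Longrightarrow> \<bar>t\<bar> \<le> R"
    "\<And>x t. \<Omega> = Whole_Space \<Longrightarrow> (x, t) \<in> A \<Longrightarrow> norm x \<le> R"
    using compact_in_bounded[OF assms] by metis
  show ?thesis
  proof (rule that[of "2 * R + real CARD('d)"])
    show "A \<inter> cell \<Omega> \<times> UNIV \<subseteq> cball 0 (2 * R + real CARD('d))"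
    proof safe
      fix x :: "real^'d" and t :: real assume xt: "(x, t) \<in> A" "x \<in> cell \<Omega>"
      have "norm (x, t) \<le> norm x + \<bar>t\<bar>"
        using norm_Pair_le[of x t] by simp
      moreover have "norm x \<le> R + real CARD('d)"
        using R(1) R(3)[of x t] xt cell_bounded[of x] by (cases \<Omega>) auto
      ultimately show "(x, t) \<in> cball 0 (2 * R + real CARD('d))"
        using R(2)[OF xt(1)] by simp
    qed
  qed
qed

lemma compact_in_measurable:
  fixes A :: "'d::finite spacetime set"
  assumes "compact_in \<Omega> ts A"
  shows "A \<inter> cell \<Omega> \<times> UNIV \<in> sets (spacetime \<Omega> ts)"
    and "emeasure (spacetime \<Omega> ts) (A \<inter> cell \<Omega> \<times> UNIV) < \<infinity>"
proof -
  have A: "A \<subseteq> cover ts"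
    by (rule compact_in_subset_cover[OF assms])
  have *: "A \<inter> cell \<Omega> \<times> UNIV \<in> sets borel"
    using compact_in_borel[OF assms] cell_times_borel by auto
  then show "A \<inter> cell \<Omega> \<times> UNIV \<in> sets (spacetime \<Omega> ts)"
    unfolding spacetime_def using A spacetime_cell_lebesgue[of ts \<Omega>]
    by (subst sets_restrict_space_iff) (auto simp: sets_completionI_sets)
  obtain R where R: "A \<inter> cell \<Omega> \<times> UNIV \<subseteq> cball 0 R"
    using compact_in_cell_bounded[OF assms] .
  have "emeasure (spacetime \<Omega> ts) (A \<inter> cell \<Omega> \<times> UNIV) = emeasure lborel (A \<inter> cell \<Omega> \<times> UNIV)"
    unfolding spacetime_def using A spacetime_cell_lebesgue[of ts \<Omega>] *
    by (subst emeasure_restrict_space) (auto simp: sets_completionI_sets)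
  also have "\<dots> \<le> emeasure lborel (cball (0 :: 'd spacetime) R)"
    by (rule emeasure_mono[OF R]) simp
  also have "\<dots> < \<infinity>"
    using emeasure_bounded_finite[of "cball (0 :: 'd spacetime) R"] by simp
  finally show "emeasure (spacetime \<Omega> ts) (A \<inter> cell \<Omega> \<times> UNIV) < \<infinity>" .
qed

lemma set_integrable_bounded:
  fixes f :: "'d::finite spacetime \<Rightarrow> 'b::euclidean_space"
  assumes A: "compact_in \<Omega> ts A" and f: "f \<in> borel_measurable (spacetime \<Omega> ts)"
    and B: "AE z in spacetime \<Omega> ts. z \<in> A \<longrightarrow> norm (f z) \<le> B"
  shows "set_integrable (spacetime \<Omega> ts) A f"
proof -
  let ?M = "spacetime \<Omega> ts" and ?A = "A \<inter> cell \<Omega> \<times> UNIV"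
  have "set_integrable ?M ?A f"
    unfolding set_integrable_def
    using compact_in_measurable[OF A] f B
    by (intro integrableI_bounded_set[where A = ?A and B = B])
      (auto split: split_indicator)
  moreover have "indicat_real ?A z *\<^sub>R f z = indicat_real A z *\<^sub>R f z" if "z \<in> space ?M" for z
    using that by (auto simp: space_spacetime split: split_indicator)
  ultimately show ?thesis
    unfolding set_integrable_def by (simp cong: Bochner_Integration.integrable_cong)
qed

lemma locally_integrable_continuous:
  fixes f :: "'d::finite spacetime \<Rightarrow> 'b::euclidean_space"
  assumes "continuous_on (cover ts) f" "periodic \<Omega> ts f"
  shows "locally_integrable \<Omega> ts f"
  unfolding locally_integrable_def
proof (intro allI impI)
  fix A :: "'d spacetime set" assume A: "compact_in \<Omega> ts A"
  obtain B where "\<And>z. z \<in> A \<Longrightarrow> norm (f z) \<le> B"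
    using periodic_bounded[OF assms A] by metis
  then show "set_integrable (spacetime \<Omega> ts) A f"
    by (intro set_integrable_bounded[where B = B] A continuous_measurable_spacetime assms(1) AE_I2 impI)
qed

section \<open>Derivatives of periodic functions\<close>

lemma frechet_derivative_shift:
  "frechet_derivative (\<lambda>y. f (y + c)) (at z) = frechet_derivative f (at (z + c))"
proof -
  have "((\<lambda>y. f (y + c)) has_derivative f') (at z) \<longleftrightarrow> (f has_derivative f') (at (z + c))" for f'
  proof
    assume L: "((\<lambda>y. f (y + c)) has_derivative f') (at z)"
    have "((\<lambda>y. y - c) has_derivative (\<lambda>v. v)) (at (z + c))"
      by (auto intro!: derivative_eq_intros)
    from has_derivative_compose[OF this, of "\<lambda>y. f (y + c)" f'] L
    show "(f has_derivative f') (at (z + c))" by simp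
  next
    assume R: "(f has_derivative f') (at (z + c))"
    have "((\<lambda>y. y + c) has_derivative (\<lambda>v. v)) (at z)"
      by (auto intro!: derivative_eq_intros)
    from has_derivative_compose[OF this R]
    show "((\<lambda>y. f (y + c)) has_derivative f') (at z)" .
  qed
  then show ?thesis
    unfolding frechet_derivative_def by simp
qed

text \<open>\<open>periodic\<close> constrains values on \<open>cover ts\<close> only. That set is
  open, so equality with the shifted function there already determines the derivative.\<close>

lemma periodic_frechet_derivative:
  fixes f :: "'d::finite spacetime \<Rightarrow> 'b::real_normed_vector"
  assumes "periodic \<Omega> ts f"
  shows "periodic \<Omega> ts (D e f)"
  unfolding periodic_iff
proof (intro ballI)
  fix k :: "real^'d" and z :: "'d spacetime"
  assume k: "k \<in> lattice \<Omega>" and z: "z \<in> cover ts"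
  have "frechet_derivative f (at (z + (k, 0))) = frechet_derivative (\<lambda>y. f (y + (k, 0))) (at z)"
    by (rule frechet_derivative_shift[symmetric])
  also have "\<dots> = frechet_derivative f (at z)"
    by (rule frechet_derivative_cong_open[OF open_cover z periodicD[OF assms k]])
  finally show "D e f (z + (k, 0)) = D e f z"
    by simp
qed

section \<open>Test functions\<close>

lemma vanishes_off_support: "z \<notin> closure {z. f z \<noteq> 0} \<Longrightarrow> f z = 0"
  using closure_subset[of "{z. f z \<noteq> 0}"] by auto

lemma frechet_derivative_off_support:
  assumes "z \<notin> closure {z. f z \<noteq> 0}"
  shows "D e f z = 0" and "f differentiable at z"
proof -
  have o: "open (- closure {z. f z \<noteq> 0})" by auto
  have z: "z \<in> - closure {z. f z \<noteq> 0}" using assms by simp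
  have eq: "f y = (\<lambda>_. 0) y" if "y \<in> - closure {z. f z \<noteq> 0}" for y
    using vanishes_off_support that by auto
  have "frechet_derivative f (at z) = frechet_derivative (\<lambda>_. 0) (at z)"
    by (rule frechet_derivative_cong_open[OF o z eq])
  then show "D e f z = 0" by simp
  show "f differentiable at z"
    using differentiable_cong_open[OF o z eq] by simp
qed

lemma closure_support_translate:
  fixes f :: "'d::finite spacetime \<Rightarrow> real"
  assumes "\<And>z. f (z + (k, 0)) = f z" "z \<in> closure {z. f z \<noteq> 0}"
  shows "z + (k, 0) \<in> closure {z. f z \<noteq> 0}"
proof -
  have "(+) (k, 0) ` {z. f z \<noteq> 0} \<subseteq> {z. f z \<noteq> 0}"
    using assms(1) by (auto simp: add.commute)
  from closure_mono[OF this] have "(+) (k, 0) ` closure {z. f z \<noteq> 0} \<subseteq> closure {z. f z \<noteq> 0}"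
    by (simp add: closure_translation)
  then show ?thesis
    using assms(2) by (auto simp: add.commute)
qed

text \<open>Outside \<open>cover ts\<close>, where \<open>periodic\<close> says nothing, the
  function vanishes, and lattice shifts preserve this set.\<close>

lemma periodic_everywhere:
  fixes f :: "'d::finite spacetime \<Rightarrow> real"
  assumes "periodic \<Omega> ts f" "\<And>z. z \<notin> cover ts \<Longrightarrow> f z = 0" "k \<in> lattice \<Omega>"
  shows "f (z + (k, 0)) = f z"
  using assms periodicD[of \<Omega> ts f k z] shift_in_cover[of z k ts] by metis

lemma test_functionD:
  assumes "test_function \<Omega> ts \<phi>"
  shows "smooth_on \<phi> UNIV" "periodic \<Omega> ts \<phi>" "compact_in \<Omega> ts (closure {z. \<phi> z \<noteq> 0})"
    and "z \<notin> cover ts \<Longrightarrow> \<phi> z = 0"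
  using assms compact_in_subset_cover[of \<Omega> ts "closure {z. \<phi> z \<noteq> 0}"]
    vanishes_off_support[of z \<phi>]
  unfolding test_function_def by auto

lemma test_function_C_k: "test_function \<Omega> ts \<phi> \<Longrightarrow> C_k_on k \<phi> S"
  using test_functionD(1) unfolding smooth_on_def by (metis C_k_on_subset subset_UNIV)

text \<open>A common criterion for new test functions: the closed support of \<open>\<psi>\<close>
  is a closed invariant subset of that of \<open>\<phi>\<close>, so it inherits compactness modulo
  the lattice.\<close>

lemma test_function_supported:
  assumes \<phi>: "test_function \<Omega> ts \<phi>" and \<psi>: "smooth_on \<psi> UNIV" "periodic \<Omega> ts \<psi>"
    and sub: "\<And>z. z \<notin> closure {z. \<phi> z \<noteq> 0} \<Longrightarrow> \<psi> z = 0"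
  shows "test_function \<Omega> ts \<psi>"
proof -
  let ?A = "closure {z. \<phi> z \<noteq> 0}"
  have A: "compact_in \<Omega> ts ?A" by (rule test_functionD[OF \<phi>])
  have "{z. \<psi> z \<noteq> 0} \<subseteq> ?A" using sub by auto
  then have sub2: "closure {z. \<psi> z \<noteq> 0} \<subseteq> ?A" by (simp add: closure_minimal)
  have "\<psi> z = 0" if "z \<notin> cover ts" for z
    using sub[of z] that compact_in_subset_cover[OF A] by auto
  note per = periodic_everywhere[OF \<psi>(2) this]
  have "compact_in \<Omega> ts (closure {z. \<psi> z \<noteq> 0})"
    by (rule compact_in_closed_subset[OF A closed_closure sub2])
      (rule closure_support_translate, use per in auto)
  then show ?thesis using \<psi> unfolding test_function_def by blast
qed

lemma test_function_deriv:
  assumes \<phi>: "test_function \<Omega> ts \<phi>"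
  shows "test_function \<Omega> ts (D e \<phi>)"
proof (rule test_function_supported[OF \<phi>])
  show "smooth_on (D e \<phi>) UNIV"
    using test_functionD(1)[OF \<phi>] unfolding smooth_on_def by (metis C_k_on.simps(2))
qed (rule periodic_frechet_derivative[OF test_functionD(2)[OF \<phi>]],
    rule frechet_derivative_off_support(1))

lemma test_function_mult:
  assumes \<phi>: "test_function \<Omega> ts \<phi>" and \<psi>: "test_function \<Omega> ts \<psi>"
  shows "test_function \<Omega> ts (\<lambda>z. \<phi> z * \<psi> z)"
proof (rule test_function_supported[OF \<phi>])
  show "smooth_on (\<lambda>z. \<phi> z * \<psi> z) UNIV"
    unfolding smooth_on_def by (intro allI C_k_on_mult open_UNIV test_function_C_k[OF \<phi>] test_function_C_k[OF \<psi>])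
  show "periodic \<Omega> ts (\<lambda>z. \<phi> z * \<psi> z)"
    using test_functionD(2)[OF \<phi>] test_functionD(2)[OF \<psi>] by (simp add: periodic_iff)
qed (metis mult_zero_left vanishes_off_support)

lemma test_function_continuous: "test_function \<Omega> ts \<phi> \<Longrightarrow> continuous_on S \<phi>"
  by (rule C_k_on_continuous[OF test_function_C_k])

lemma test_function_bounded:
  assumes "test_function \<Omega> ts \<phi>"
  obtains B where "0 \<le> B" "\<And>z. \<bar>\<phi> z\<bar> \<le> B"
proof -
  obtain B where B: "0 \<le> B" "\<And>z. z \<in> closure {z. \<phi> z \<noteq> 0} \<Longrightarrow> norm (\<phi> z) \<le> B"
    using periodic_bounded[OF test_function_continuous[OF assms] test_functionD(2,3)[OF assms]]
    by metis
  show ?thesis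
  proof (rule that[OF B(1)])
    show "\<bar>\<phi> z\<bar> \<le> B" for z
      using B vanishes_off_support[of z \<phi>] by (cases "z \<in> closure {z. \<phi> z \<noteq> 0}") auto
  qed
qed

lemma C_1_on_continuous_deriv:
  "C_k_on 1 f S \<Longrightarrow> continuous_on S (D e f)"
  using C_k_on_continuous[OF C_k_on_deriv[of 0]] by simp

section \<open>Integration by parts on a fundamental cell\<close>

lemma integral_lborel_shift:
  fixes f :: "'a::euclidean_space \<Rightarrow> real"
  assumes [measurable]: "f \<in> borel_measurable borel"
  shows "(\<integral>z. f (z + c) \<partial>lborel) = (\<integral>z. f z \<partial>lborel)"
proof -
  have "(\<integral>z. f z \<partial>lborel) = (\<integral>z. f z \<partial>distr lborel borel ((+) c))"
    by (simp add: lborel_distr_plus)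
  also have "\<dots> = (\<integral>z. f (c + z) \<partial>lborel)"
    by (rule integral_distr) auto
  finally show ?thesis by (simp add: add.commute)
qed

lemma integrable_lborel_shift:
  fixes f :: "'a::euclidean_space \<Rightarrow> real"
  assumes [measurable]: "f \<in> borel_measurable borel" and f: "integrable lborel f"
  shows "integrable lborel (\<lambda>z. f (z + c))"
proof -
  have "integrable (distr lborel borel ((+) c)) f"
    using f by (simp add: lborel_distr_plus)
  then show ?thesis
    by (subst (asm) integrable_distr_eq) (auto simp: add.commute)
qed

abbreviation coordinate_directions :: "'d::finite spacetime set" where
  "coordinate_directions \<equiv> insert (0, 1) (range (\<lambda>i. (axis i 1, 0)))"

abbreviation cylinder :: "space_domain \<Rightarrow> 'd::finite spacetime set" where
  "cylinder \<Omega> \<equiv> cell \<Omega> \<times> UNIV"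

text \<open>Only a spatial direction on the torus moves the cell; shifts in time, and all shifts on
  the whole space, leave the cylinder invariant.\<close>

lemma coordinate_direction_cases:
  fixes e :: "'d::finite spacetime"
  assumes "e \<in> coordinate_directions"
  obtains "\<And>h z. indicat_real (cylinder \<Omega>) (z - h *\<^sub>R e) = indicat_real (cylinder \<Omega>) z"
  | i where "\<Omega> = Torus" "e = (axis i 1, 0)"
proof (cases "\<Omega> = Whole_Space \<or> e = (0, 1)")
  case True
  then have "indicat_real (cylinder \<Omega>) (z - h *\<^sub>R e) = indicat_real (cylinder \<Omega>) z" for h and z :: "'d spacetime"
    by (auto simp: cell_def indicator_def mem_Times_iff)
  then show ?thesis using that(1) by blast
next
  case False
  then show ?thesis using assms that(2) by (cases \<Omega>) auto
qed

text \<open>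
  A shift by \<open>h\<close> in direction \<open>i\<close> moves the slab \<open>x $ i < h\<close> of the cell \<open>[0,1)^d\<close> to the
  opposite side, which a lattice translation undoes.
\<close>

lemma integral_cylinder_shift:
  fixes f :: "'d::finite spacetime \<Rightarrow> real"
  assumes e: "e \<in> coordinate_directions" and h: "0 \<le> h" "h \<le> 1"
    and [measurable]: "f \<in> borel_measurable borel"
    and per: "\<And>z k. k \<in> lattice \<Omega> \<Longrightarrow> f (z + (k, 0)) = f z"
    and int: "integrable lborel (\<lambda>z. indicator (cylinder \<Omega>) z * f z)"
  shows "(\<integral>z. indicator (cylinder \<Omega>) z * f (z + h *\<^sub>R e) \<partial>lborel)
    = (\<integral>z. indicator (cylinder \<Omega>) z * f z \<partial>lborel)"
proof -
  have [measurable]: "cylinder \<Omega> \<in> sets (borel :: 'd spacetime measure)"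
    by (rule cell_times_borel)
  have shift: "(\<integral>z. indicator (cylinder \<Omega>) z * f (z + h *\<^sub>R e) \<partial>lborel)
      = (\<integral>z. indicator (cylinder \<Omega>) (z - h *\<^sub>R e) * f z \<partial>lborel)"
    by (subst integral_lborel_shift[of _ "h *\<^sub>R e", symmetric]) auto
  show ?thesis
  proof (rule coordinate_direction_cases[OF e, of \<Omega>])
    fix i :: 'd assume T: "\<Omega> = Torus" and ei: "e = (axis i 1, 0)"
    define B where "B = {z \<in> cylinder \<Omega>. fst z $ i < h}"
    have "open {z :: 'd spacetime. fst z $ i < h}"
      by (intro open_Collect_less continuous_intros)
    then have "{z :: 'd spacetime. fst z $ i < h} \<in> sets borel" by simp
    moreover have "B = cylinder \<Omega> \<inter> {z :: 'd spacetime. fst z $ i < h}"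
      by (auto simp: B_def)
    ultimately have B[measurable]: "B \<in> sets borel" by simp
    \<comment> \<open>The shifted cell loses the slab \<open>B\<close> and gains its translate by
      \<open>e\<close>. If all other coordinates lie in [0,1), the four memberships are interval
      conditions on coordinate \<open>i\<close>; otherwise every indicator is zero.\<close>
    have split: "indicat_real (cylinder \<Omega>) (z - h *\<^sub>R e)
        = indicator (cylinder \<Omega>) z + indicator B (z - e) - indicator B z" for z
    proof (cases "\<forall>j. j \<noteq> i \<longrightarrow> 0 \<le> fst z $ j \<and> fst z $ j < 1")
      case True
      have all: "(\<forall>j. P j) \<longleftrightarrow> P i \<and> (\<forall>j. j \<noteq> i \<longrightarrow> P j)" for P by metis
      have 1: "z - h *\<^sub>R e \<in> cylinder \<Omega> \<longleftrightarrow> h \<le> fst z $ i \<and> fst z $ i < 1 + h"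
        unfolding T cell_def ei mem_Times_iff
        by (simp, subst all) (use True in \<open>auto simp: axis_def\<close>)
      have 2: "z - e \<in> B \<longleftrightarrow> 1 \<le> fst z $ i \<and> fst z $ i < 2 \<and> fst z $ i < 1 + h"
        unfolding B_def T cell_def ei mem_Times_iff mem_Collect_eq
        by (simp, subst all) (use True in \<open>auto simp: axis_def\<close>)
      have 3: "z \<in> B \<longleftrightarrow> 0 \<le> fst z $ i \<and> fst z $ i < 1 \<and> fst z $ i < h"
        unfolding B_def T cell_def mem_Times_iff mem_Collect_eq
        by (simp, subst all) (use True in auto)
      have 4: "z \<in> cylinder \<Omega> \<longleftrightarrow> 0 \<le> fst z $ i \<and> fst z $ i < 1"
        unfolding T cell_def mem_Times_iff
        by (simp, subst all) (use True in auto)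
      show ?thesis
        unfolding indicator_def 1 2 3 4 using h by auto
    next
      case False
      then obtain j where j: "j \<noteq> i" "\<not> (0 \<le> fst z $ j \<and> fst z $ j < 1)" by blast
      then have "z \<notin> cylinder \<Omega>" "z - h *\<^sub>R e \<notin> cylinder \<Omega>" "z - e \<notin> cylinder \<Omega>"
        unfolding T cell_def ei mem_Times_iff by (auto simp: axis_def intro!: exI[of _ j])
      then show ?thesis by (auto simp: B_def indicator_def)
    qed
    have fe: "f (z + e) = f z" for z
      unfolding ei by (rule per) (simp add: T axis_in_lattice)
    have intB: "integrable lborel (\<lambda>z. indicator B z * f z)"
    proof -
      have "integrable lborel (\<lambda>z. indicat_real B z *\<^sub>R (indicator (cylinder \<Omega>) z * f z))"
        by (rule integrable_mult_indicator[OF _ int]) simp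
      moreover have "indicat_real B z *\<^sub>R (indicator (cylinder \<Omega>) z * f z) = indicator B z * f z" for z
        by (auto simp: B_def indicator_def)
      ultimately show ?thesis by (simp only:)
    qed
    have fe': "f (z - e) = f z" for z
      using fe[of "z - e"] by simp
    have intB': "integrable lborel (\<lambda>z. indicator B (z - e) * f z)"
      using integrable_lborel_shift[OF _ intB, of "- e"] by (simp add: fe')
    have eqB: "(\<integral>z. indicator B (z - e) * f z \<partial>lborel) = (\<integral>z. indicator B z * f z \<partial>lborel)"
      using integral_lborel_shift[of "\<lambda>z. indicator B z * f z" "- e"] by (simp add: fe')
    have "(\<integral>z. indicator (cylinder \<Omega>) (z - h *\<^sub>R e) * f z \<partial>lborel)
        = (\<integral>z. indicator (cylinder \<Omega>) z * f z + indicator B (z - e) * f z - indicator B z * f z \<partial>lborel)"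
      unfolding split by (simp add: algebra_simps)
    also have "\<dots> = (\<integral>z. indicator (cylinder \<Omega>) z * f z \<partial>lborel)"
      using int intB intB' eqB by simp
    finally show ?thesis using shift by simp
  qed (use shift in simp)
qed

text \<open>One radius serves all shifts with \<open>h\<close> at most one, so that a single ball
  dominates every difference quotient.\<close>

lemma compact_in_cylinder_neighbourhood:
  fixes A :: "'d::finite spacetime set"
  assumes "compact_in \<Omega> ts A"
  obtains R where "\<And>z h e. \<lbrakk>z \<in> cylinder \<Omega>; z + h *\<^sub>R e \<in> A; 0 \<le> h; h \<le> 1;
    e \<in> coordinate_directions\<rbrakk> \<Longrightarrow> norm z \<le> R"
proof -
  obtain R where R: "0 \<le> R" "\<And>x t. (x, t) \<in> A \<Longrightarrow> \<bar>t\<bar> \<le> R"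
    "\<And>x t. \<Omega> = Whole_Space \<Longrightarrow> (x, t) \<in> A \<Longrightarrow> norm x \<le> R"
    using compact_in_bounded[OF assms] by metis
  show ?thesis
  \<comment> \<open>One \<open>R + 1\<close> is for time and one for space, each allowing for the
    shift; the dimension bounds the norm on the torus cell.\<close>
  proof (rule that[of "(R + 1) + (R + 1) + real CARD('d)"])
    fix z h and e :: "'d spacetime"
    assume z: "z \<in> cylinder \<Omega>" and zA: "z + h *\<^sub>R e \<in> A" and h: "0 \<le> h" "h \<le> 1"
      and e: "e \<in> coordinate_directions"
    obtain x t where zxt: "z = (x, t)" by (cases z)
    obtain a b where eab: "e = (a, b)" by (cases e)
    have ab: "norm a \<le> 1" "\<bar>b\<bar> \<le> 1"
      using e eab by (auto simp: norm_axis_1)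
    have A: "(x + h *\<^sub>R a, t + h * b) \<in> A"
      using zA by (simp add: zxt eab)
    have ha: "norm (h *\<^sub>R a) \<le> 1" "\<bar>h * b\<bar> \<le> 1"
      using h ab by (auto simp: abs_mult intro: mult_le_one)
    have "\<bar>t\<bar> \<le> R + 1"
      using R(2)[OF A] ha(2) by linarith
    moreover have "norm x \<le> (R + 1) + real CARD('d)"
    proof (cases \<Omega>)
      case Whole_Space
      have "norm x \<le> norm (x + h *\<^sub>R a) + norm (h *\<^sub>R a)"
        using norm_triangle_ineq4[of "x + h *\<^sub>R a" "h *\<^sub>R a"] by simp
      then show ?thesis using R(3)[OF Whole_Space A] ha(1) by linarith
    next
      case Torus
      then show ?thesis using z zxt cell_bounded[of x] R(1) by simp
    qed
    moreover have "norm z \<le> norm x + \<bar>t\<bar>"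
      unfolding zxt using norm_Pair_le[of x t] by simp
    ultimately show "norm z \<le> (R + 1) + (R + 1) + real CARD('d)" by linarith
  qed
qed

lemma directional_derivative_line:
  fixes f :: "'a::real_normed_vector \<Rightarrow> real"
  assumes "f differentiable at (z + s *\<^sub>R e)"
  shows "((\<lambda>s. f (z + s *\<^sub>R e)) has_field_derivative D e f (z + s *\<^sub>R e)) (at s)"
proof -
  have "((\<lambda>s. z + s *\<^sub>R e) has_derivative (\<lambda>s. s *\<^sub>R e)) (at s)"
    by (auto intro!: derivative_eq_intros)
  from has_derivative_compose[OF this has_derivative_frechet[OF assms]]
  have "((\<lambda>s. f (z + s *\<^sub>R e)) has_derivative (\<lambda>s'. D (s' *\<^sub>R e) f (z + s *\<^sub>R e))) (at s)" .
  moreover have "D (s' *\<^sub>R e) f (z + s *\<^sub>R e)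
      = D e f (z + s *\<^sub>R e) * s'" for s'
    using linear_scale[OF linear_frechet_derivative[OF assms]] by (simp add: mult.commute)
  ultimately show ?thesis
    by (simp add: has_field_derivative_def)
qed

text \<open>The integral of a shifted function does not depend on the shift, so all difference
  quotients integrate to zero over the cylinder, and dominated convergence transfers this to the
  derivative. No iterated integrals or boundary terms appear.\<close>

lemma integral_cylinder_deriv:
  fixes f :: "'d::finite spacetime \<Rightarrow> real"
  assumes e: "e \<in> coordinate_directions" and C1: "C_k_on 1 f UNIV" and per: "periodic \<Omega> ts f"
    and A: "compact_in \<Omega> ts A" "closed A" and supp: "\<And>z. z \<notin> A \<Longrightarrow> f z = 0"
  shows "(\<integral>z. indicator (cylinder \<Omega>) z * D e f z \<partial>lborel) = 0"
proof -
  let ?C = "indicat_real (cylinder \<Omega> :: 'd spacetime set)"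
  let ?D = "\<lambda>z. D e f z"
  have meas_C[measurable]: "cylinder \<Omega> \<in> sets (borel :: 'd spacetime measure)"
    by (rule cell_times_borel)
  have cont_f: "continuous_on UNIV f" and cont_D: "continuous_on UNIV ?D"
    by (rule C_k_on_continuous[OF C1], rule C_1_on_continuous_deriv[OF C1])
  have meas_f[measurable]: "f \<in> borel_measurable borel" and meas_D[measurable]: "?D \<in> borel_measurable borel"
    using cont_f cont_D by (auto intro: borel_measurable_continuous_onI)
  have "{z. f z \<noteq> 0} \<subseteq> A" using supp by auto
  then have clA: "closure {z. f z \<noteq> 0} \<subseteq> A" using A(2) by (simp add: closure_minimal)
  have D0: "?D z = 0" if "z \<notin> A" for z
    by (rule frechet_derivative_off_support(1)) (use that clA in blast)
  obtain Bf where Bf: "0 \<le> Bf" "\<And>z. z \<in> A \<Longrightarrow> norm (f z) \<le> Bf"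
    using periodic_bounded[OF continuous_on_subset[OF cont_f] per A(1)] by auto
  obtain BD where BD: "0 \<le> BD" "\<And>z. z \<in> A \<Longrightarrow> norm (?D z) \<le> BD"
    using periodic_bounded[OF continuous_on_subset[OF cont_D] periodic_frechet_derivative[OF per] A(1)] by auto
  have boundf: "\<bar>f z\<bar> \<le> Bf" for z using Bf supp[of z] by (cases "z \<in> A") auto
  have boundD: "\<bar>?D z\<bar> \<le> BD" for z using BD D0[of z] by (cases "z \<in> A") auto
  obtain R where R: "\<And>z h. \<lbrakk>z \<in> cylinder \<Omega>; z + h *\<^sub>R e \<in> A; 0 \<le> h; h \<le> 1\<rbrakk> \<Longrightarrow> norm z \<le> R"
    using compact_in_cylinder_neighbourhood[OF A(1)] e by metis
  have R0: "norm z \<le> R" if "z \<in> cylinder \<Omega>" "z \<in> A" for z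
    using R[of z 0] that by simp
  have int_ball: "integrable lborel (\<lambda>z. B * indicator (cball (0::'d spacetime) R) z)" for B :: real
    using emeasure_bounded_finite[of "cball (0::'d spacetime) R"]
    by (intro integrable_mult_right integrable_real_indicator) auto
  have int: "integrable lborel (\<lambda>z. ?C z * f (z + h *\<^sub>R e))" if h: "0 \<le> h" "h \<le> 1" for h
  proof (rule Bochner_Integration.integrable_bound[OF int_ball[of Bf]])
    show "AE z in lborel. norm (?C z * f (z + h *\<^sub>R e)) \<le> norm (Bf * indicator (cball 0 R) z)"
    proof (rule AE_I2)
      fix z
      show "norm (?C z * f (z + h *\<^sub>R e)) \<le> norm (Bf * indicator (cball 0 R) z)"
        using R[of z h] supp[of "z + h *\<^sub>R e"] h boundf[of "z + h *\<^sub>R e"] Bf(1)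
        by (cases "z + h *\<^sub>R e \<in> A") (auto split: split_indicator)
    qed
  qed measurable
  have per': "f (z + (k, 0)) = f z" if "k \<in> lattice \<Omega>" for z k
    using compact_in_subset_cover[OF A(1)] supp
    by (intro periodic_everywhere[OF per _ that]) blast
  \<comment> \<open>These steps lie in (0,1], the range in which the shift identity and the radius
    \<open>R\<close> are valid.\<close>
  define h where "h n = 1 / real (Suc n)" for n
  have h: "0 < h n" "h n \<le> 1" for n by (auto simp: h_def)
  have h_lim: "h \<longlonglongrightarrow> 0"
    unfolding h_def[abs_def] using LIMSEQ_inverse_real_of_nat by (simp add: inverse_eq_divide)
  define q where "q n z = ?C z * ((f (z + h n *\<^sub>R e) - f z) / h n)" for n z
  have q0: "(\<integral>z. q n z \<partial>lborel) = 0" for n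
  proof -
    have "(\<integral>z. q n z \<partial>lborel) = (\<integral>z. (?C z * f (z + h n *\<^sub>R e) - ?C z * f z) / h n \<partial>lborel)"
      by (simp add: q_def right_diff_distrib)
    also have "\<dots> = ((\<integral>z. ?C z * f (z + h n *\<^sub>R e) \<partial>lborel) - (\<integral>z. ?C z * f z \<partial>lborel)) / h n"
      using int[of "h n"] int[of 0] h[of n] by simp
    also have "\<dots> = 0"
      using integral_cylinder_shift[OF e, of "h n" f \<Omega>] h[of n] per' int[of 0] by simp
    finally show ?thesis .
  qed
  have line: "((\<lambda>s. f (z + s *\<^sub>R e)) has_field_derivative ?D (z + s *\<^sub>R e)) (at s)" for z s
    by (rule directional_derivative_line) (use C_k_on_differentiable[OF C1] in simp)
  have lim: "(\<lambda>n. q n z) \<longlonglongrightarrow> ?C z * ?D z" for z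
  proof -
    have "((\<lambda>s. (f (z + s *\<^sub>R e) - f z) / s) \<longlongrightarrow> ?D z) (at 0)"
      using line[of z 0] by (simp add: DERIV_def)
    moreover have "filterlim h (at 0) sequentially"
      using h(1) h_lim by (auto simp: filterlim_at less_imp_neq[symmetric])
    ultimately show ?thesis
      unfolding q_def by (intro tendsto_mult_left) (rule filterlim_compose)
  qed
  \<comment> \<open>By the mean value theorem the quotient is a derivative at an intermediate point:
    at most \<open>BD\<close> there, and zero off \<open>A\<close>. The ball of radius
    \<open>R\<close> contains every point of the cylinder that such a shift takes into
    \<open>A\<close>.\<close>
  have bound: "norm (q n z) \<le> BD * indicator (cball 0 R) z" for n z
  proof -
    have "\<exists>s. 0 < s \<and> s < h n \<and> f (z + h n *\<^sub>R e) - f (z + 0 *\<^sub>R e) = (h n - 0) * ?D (z + s *\<^sub>R e)"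
      by (rule MVT2[OF h(1)]) (rule line)
    then obtain s where s: "0 < s" "s < h n" "(f (z + h n *\<^sub>R e) - f z) / h n = ?D (z + s *\<^sub>R e)"
      using h(1)[of n] by auto
    show ?thesis
      unfolding q_def s(3)
      using R[of z s] s h(2)[of n] boundD[of "z + s *\<^sub>R e"] BD(1) D0[of "z + s *\<^sub>R e"]
      by (cases "z + s *\<^sub>R e \<in> A") (auto split: split_indicator)
  qed
  have "(\<lambda>n. \<integral>z. q n z \<partial>lborel) \<longlonglongrightarrow> (\<integral>z. ?C z * ?D z \<partial>lborel)"
  proof (rule integral_dominated_convergence[OF _ _ int_ball[of BD]])
    show "q n \<in> borel_measurable lborel" for n unfolding q_def by measurable
  qed (use lim bound in auto)
  then show ?thesis
    unfolding q0 by (rule LIMSEQ_unique[OF _ tendsto_const])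
qed

lemma C_k_on_Un:
  "open S \<Longrightarrow> open T \<Longrightarrow> C_k_on k f S \<Longrightarrow> C_k_on k f T \<Longrightarrow> C_k_on k f (S \<union> T)"
  by (induction k arbitrary: f) (auto intro: continuous_on_open_Un)

text \<open>\<open>f\<close> is controlled on \<open>cover ts\<close> only. The product is regular
  there and zero off the closed support of \<open>\<phi>\<close>, and these two open sets exhaust
  the space.\<close>

lemma C_k_on_zero_extension:
  fixes f :: "'d::finite spacetime \<Rightarrow> real"
  assumes f: "C_k_on k f (cover ts)" and \<phi>: "test_function \<Omega> ts \<phi>"
  shows "C_k_on k (\<lambda>z. f z * \<phi> z) UNIV"
proof -
  let ?A = "closure {z. \<phi> z \<noteq> 0}"
  have "C_k_on k (\<lambda>z. f z * \<phi> z) (- ?A) \<longleftrightarrow> C_k_on k (\<lambda>z. 0 :: real) (- ?A)"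
    by (rule C_k_on_cong) (use closed_closure in blast, metis ComplD mult_zero_right vanishes_off_support)
  then have "C_k_on k (\<lambda>z. f z * \<phi> z) (- ?A)"
    by (simp add: C_k_on_const)
  moreover have "C_k_on k (\<lambda>z. f z * \<phi> z) (cover ts)"
    by (rule C_k_on_mult[OF open_cover f test_function_C_k[OF \<phi>]])
  moreover have "cover ts \<union> - ?A = UNIV"
    using compact_in_subset_cover[OF test_functionD(3)[OF \<phi>]] by blast
  ultimately show ?thesis
    using C_k_on_Un[OF open_cover, of "- ?A" k "\<lambda>z. f z * \<phi> z" ts] by (metis closed_closure open_Compl)
qed

lemma integral_spacetime_lborel:
  fixes f :: "'d::finite spacetime \<Rightarrow> real"
  assumes [measurable]: "f \<in> borel_measurable borel" and 0: "\<And>z. z \<notin> cover ts \<Longrightarrow> f z = 0"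
  shows "(\<integral>z. f z \<partial>spacetime \<Omega> ts) = (\<integral>z. indicator (cylinder \<Omega>) z * f z \<partial>lborel)"
proof -
  have [measurable]: "cylinder \<Omega> \<in> sets (borel :: 'd spacetime measure)"
    by (rule cell_times_borel)
  have "(\<integral>z. f z \<partial>spacetime \<Omega> ts) = (\<integral>z. indicator (spacetime_cell \<Omega> ts) z *\<^sub>R f z \<partial>lebesgue)"
    unfolding spacetime_def using spacetime_cell_lebesgue by (intro integral_restrict_space) simp
  also have "\<dots> = (\<integral>z. indicator (cylinder \<Omega>) z * f z \<partial>lebesgue)"
    using 0 by (intro Bochner_Integration.integral_cong refl) (auto simp: indicator_def)
  also have "\<dots> = (\<integral>z. indicator (cylinder \<Omega>) z * f z \<partial>lborel)"
    by (rule integral_completion) measurable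
  finally show ?thesis .
qed

lemma integrable_test_function:
  fixes f :: "'d::finite spacetime \<Rightarrow> real"
  assumes f: "locally_integrable \<Omega> ts f" and \<psi>: "test_function \<Omega> ts \<psi>"
  shows "integrable (spacetime \<Omega> ts) (\<lambda>z. f z * \<psi> z)"
proof -
  let ?A = "closure {z. \<psi> z \<noteq> 0}"
  obtain B where B: "0 \<le> B" "\<And>z. \<bar>\<psi> z\<bar> \<le> B"
    using test_function_bounded[OF \<psi>] by metis
  have int: "integrable (spacetime \<Omega> ts) (\<lambda>z. indicator ?A z * f z)"
    using f test_functionD(3)[OF \<psi>] unfolding locally_integrable_def set_integrable_def by simp
  have eq: "f z * \<psi> z = (indicator ?A z * f z) * \<psi> z" for z
    using vanishes_off_support[of z \<psi>] by (cases "z \<in> ?A") auto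
  have [measurable]: "\<psi> \<in> borel_measurable (spacetime \<Omega> ts)"
    by (rule continuous_measurable_spacetime[OF test_function_continuous[OF \<psi>]])
  show ?thesis
    unfolding eq
  proof (rule Bochner_Integration.integrable_bound)
    show "integrable (spacetime \<Omega> ts) (\<lambda>z. B * (indicator ?A z * f z))" using int by simp
    show "AE z in spacetime \<Omega> ts. norm (indicator ?A z * f z * \<psi> z) \<le> norm (B * (indicator ?A z * f z))"
    proof (rule AE_I2)
      fix z
      have "\<bar>indicator ?A z * f z\<bar> * \<bar>\<psi> z\<bar> \<le> \<bar>indicator ?A z * f z\<bar> * B"
        by (rule mult_left_mono[OF B(2)]) simp
      then show "norm (indicator ?A z * f z * \<psi> z) \<le> norm (B * (indicator ?A z * f z))"
        using B(1) by (simp add: abs_mult mult.commute)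
    qed
  qed (use int in measurable)
qed

text \<open>The derivative of the zero extension of \<open>f\<close> times \<open>\<phi>\<close>
  integrates to zero over the cell; the product rule splits it into the two sides.\<close>

lemma integral_by_parts:
  fixes f :: "'d::finite spacetime \<Rightarrow> real"
  assumes e: "e \<in> coordinate_directions" and f: "C_k_on 1 f (cover ts)" "periodic \<Omega> ts f"
    and \<phi>: "test_function \<Omega> ts \<phi>"
  shows "(\<integral>z. f z * D e \<phi> z \<partial>spacetime \<Omega> ts)
    = - (\<integral>z. D e f z * \<phi> z \<partial>spacetime \<Omega> ts)"
proof -
  let ?M = "spacetime \<Omega> ts" and ?A = "closure {z. \<phi> z \<noteq> 0}"
  let ?g = "\<lambda>z. f z * \<phi> z"
  note A = test_functionD(3)[OF \<phi>]
  have C1: "C_k_on 1 ?g UNIV" by (rule C_k_on_zero_extension[OF f(1) \<phi>])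
  have per: "periodic \<Omega> ts ?g"
    using f(2) test_functionD(2)[OF \<phi>] by (simp add: periodic_iff)
  have g0: "?g z = 0" if "z \<notin> ?A" for z
    using vanishes_off_support[OF that] by simp
  have clg: "closure {z. ?g z \<noteq> 0} \<subseteq> ?A"
    by (rule closure_mono) auto
  have "continuous_on UNIV (\<lambda>z. D e ?g z)"
    by (rule C_1_on_continuous_deriv[OF C1])
  then have "(\<integral>z. D e ?g z \<partial>?M)
      = (\<integral>z. indicator (cylinder \<Omega>) z * D e ?g z \<partial>lborel)"
    by (intro integral_spacetime_lborel borel_measurable_continuous_onI frechet_derivative_off_support(1))
      (use clg compact_in_subset_cover[OF A] in blast)+
  also have "\<dots> = 0"
    by (rule integral_cylinder_deriv[OF e C1 per A closed_closure g0])
  finally have "0 = (\<integral>z. D e ?g z \<partial>?M)" ..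
  also have "\<dots> = (\<integral>z. f z * D e \<phi> z + D e f z * \<phi> z \<partial>?M)"
    using C_k_on_differentiable[OF f(1)] C_k_on_differentiable[OF test_function_C_k[OF \<phi>, of 1 UNIV]]
    by (intro Bochner_Integration.integral_cong refl frechet_derivative_mult)
      (auto simp: space_spacetime)
  also have "\<dots> = (\<integral>z. f z * D e \<phi> z \<partial>?M) + (\<integral>z. D e f z * \<phi> z \<partial>?M)"
  proof (rule Bochner_Integration.integral_add)
    show "integrable ?M (\<lambda>z. f z * D e \<phi> z)"
      by (intro integrable_test_function locally_integrable_continuous C_k_on_continuous[OF f(1)] f(2)
          test_function_deriv \<phi>)
    have "continuous_on (cover ts) (D e f)"
      by (rule C_1_on_continuous_deriv[OF f(1)])
    then show "integrable ?M (\<lambda>z. D e f z * \<phi> z)"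
      by (intro integrable_test_function locally_integrable_continuous periodic_frechet_derivative f(2) \<phi>)
  qed
  finally show ?thesis by simp
qed

section \<open>Bounded convergence in mean\<close>

text \<open>The common bound makes the notion stable under products, which mean convergence alone is
  not. On a finite measure it also makes \<open>\<bar>f e z - g z\<bar>\<close> integrable, so the
  last clause does not concern the default value 0 of the Bochner integral.\<close>

definition bounded_L1_limit ::
    "'a measure \<Rightarrow> (real \<Rightarrow> 'a \<Rightarrow> real) \<Rightarrow> ('a \<Rightarrow> real) \<Rightarrow> bool" where
  "bounded_L1_limit N f g \<longleftrightarrow> g \<in> borel_measurable N \<and>
     (\<exists>B. (AE z in N. \<bar>g z\<bar> \<le> B) \<and>
       (\<forall>\<^sub>F e in at_right 0. f e \<in> borel_measurable N \<and> (AE z in N. \<bar>f e z\<bar> \<le> B))) \<and>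
     ((\<lambda>e. \<integral>z. \<bar>f e z - g z\<bar> \<partial>N) \<longlongrightarrow> 0) (at_right 0)"

lemma bounded_L1_limitE:
  assumes "bounded_L1_limit N f g"
  obtains B where "0 \<le> B" "AE z in N. \<bar>g z\<bar> \<le> B" "g \<in> borel_measurable N"
    "\<forall>\<^sub>F e in at_right 0. f e \<in> borel_measurable N \<and> (AE z in N. \<bar>f e z\<bar> \<le> B)"
    "((\<lambda>e. \<integral>z. \<bar>f e z - g z\<bar> \<partial>N) \<longlongrightarrow> 0) (at_right 0)"
proof -
  obtain B where B: "AE z in N. \<bar>g z\<bar> \<le> B"
    "\<forall>\<^sub>F e in at_right 0. f e \<in> borel_measurable N \<and> (AE z in N. \<bar>f e z\<bar> \<le> B)"
    using assms unfolding bounded_L1_limit_def by blast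
  have "AE z in N. \<bar>g z\<bar> \<le> max 0 B"
    using B(1) by eventually_elim auto
  moreover have "\<forall>\<^sub>F e in at_right 0. f e \<in> borel_measurable N \<and> (AE z in N. \<bar>f e z\<bar> \<le> max 0 B)"
    using B(2)
  proof eventually_elim
    case (elim e)
    then have "AE z in N. \<bar>f e z\<bar> \<le> B" by blast
    then have "AE z in N. \<bar>f e z\<bar> \<le> max 0 B" by eventually_elim auto
    then show ?case using elim by blast
  qed
  ultimately show ?thesis
    using that[of "max 0 B"] assms unfolding bounded_L1_limit_def by simp
qed

context finite_measure
begin

lemma integrable_AE_bounded:
  fixes g :: "'a \<Rightarrow> real"
  shows "g \<in> borel_measurable M \<Longrightarrow> AE z in M. \<bar>g z\<bar> \<le> B \<Longrightarrow> integrable M g"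
  by (rule integrable_const_bound[where B = B]) auto

lemma bounded_L1_limit_integrable:
  assumes "bounded_L1_limit M f g"
  shows "integrable M g" "\<forall>\<^sub>F e in at_right 0. integrable M (f e)"
    and "\<forall>\<^sub>F e in at_right 0. integrable M (\<lambda>z. \<bar>f e z - g z\<bar>)"
proof -
  obtain B where B: "AE z in M. \<bar>g z\<bar> \<le> B" "g \<in> borel_measurable M"
    "\<forall>\<^sub>F e in at_right 0. f e \<in> borel_measurable M \<and> (AE z in M. \<bar>f e z\<bar> \<le> B)"
    by (rule bounded_L1_limitE[OF assms])
  show g: "integrable M g" by (rule integrable_AE_bounded[OF B(2,1)])
  show f: "\<forall>\<^sub>F e in at_right 0. integrable M (f e)"
    using B(3) by eventually_elim (auto intro: integrable_AE_bounded)
  show "\<forall>\<^sub>F e in at_right 0. integrable M (\<lambda>z. \<bar>f e z - g z\<bar>)"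
    using f by eventually_elim (intro integrable_abs Bochner_Integration.integrable_diff g)
qed

lemma bounded_L1_limit_dominated:
  assumes g: "g \<in> borel_measurable M" "AE z in M. \<bar>g z\<bar> \<le> B"
    and f: "\<forall>\<^sub>F e in at_right 0. f e \<in> borel_measurable M \<and> (AE z in M. \<bar>f e z\<bar> \<le> B)"
    and r: "\<forall>\<^sub>F e in at_right 0. integrable M (r e)" "((\<lambda>e. \<integral>z. r e z \<partial>M) \<longlongrightarrow> 0) (at_right 0)"
    and le: "\<forall>\<^sub>F e in at_right 0. AE z in M. \<bar>f e z - g z\<bar> \<le> r e z"
  shows "bounded_L1_limit M f g"
proof -
  have "((\<lambda>e. \<integral>z. \<bar>f e z - g z\<bar> \<partial>M) \<longlongrightarrow> 0) (at_right 0)"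
  proof (rule tendsto_sandwich[OF _ _ tendsto_const r(2)])
    show "\<forall>\<^sub>F e in at_right 0. 0 \<le> (\<integral>z. \<bar>f e z - g z\<bar> \<partial>M)" by simp
    show "\<forall>\<^sub>F e in at_right 0. (\<integral>z. \<bar>f e z - g z\<bar> \<partial>M) \<le> (\<integral>z. r e z \<partial>M)"
      using f r(1) le
    proof eventually_elim
      case (elim e)
      have "integrable M (f e)" "integrable M g"
        using integrable_AE_bounded[of "f e" B] integrable_AE_bounded[OF g] elim(1) by simp_all
      then show ?case
        using elim(2,3) by (intro integral_mono_AE) auto
    qed
  qed
  then show ?thesis
    unfolding bounded_L1_limit_def using g f by blast
qed

lemma bounded_L1_limit_const: "bounded_L1_limit M (\<lambda>e z. c) (\<lambda>z. c)"
  unfolding bounded_L1_limit_def by auto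

text \<open>Addition and multiplication are both bounded and Lipschitz on bounded squares, and the
  common bounds confine the arguments to such a square.\<close>

lemma bounded_L1_limit_binary:
  fixes F :: "real \<Rightarrow> real \<Rightarrow> real"
  assumes 1: "bounded_L1_limit M f g" and 2: "bounded_L1_limit M f' g'"
    and F: "\<And>h h'. h \<in> borel_measurable M \<Longrightarrow> h' \<in> borel_measurable M \<Longrightarrow>
      (\<lambda>z. F (h z) (h' z)) \<in> borel_measurable M"
    and lip: "\<And>B. \<exists>C L. \<forall>x y x' y'. \<bar>x\<bar> \<le> B \<and> \<bar>y\<bar> \<le> B \<and> \<bar>x'\<bar> \<le> B \<and> \<bar>y'\<bar> \<le> B \<longrightarrow>
      \<bar>F x y\<bar> \<le> C \<and> \<bar>F x y - F x' y'\<bar> \<le> L * (\<bar>x - x'\<bar> + \<bar>y - y'\<bar>)"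
  shows "bounded_L1_limit M (\<lambda>e z. F (f e z) (f' e z)) (\<lambda>z. F (g z) (g' z))"
proof -
  obtain B1 where B1: "0 \<le> B1" "AE z in M. \<bar>g z\<bar> \<le> B1" "g \<in> borel_measurable M"
    "\<forall>\<^sub>F e in at_right 0. f e \<in> borel_measurable M \<and> (AE z in M. \<bar>f e z\<bar> \<le> B1)"
    "((\<lambda>e. \<integral>z. \<bar>f e z - g z\<bar> \<partial>M) \<longlongrightarrow> 0) (at_right 0)"
    by (rule bounded_L1_limitE[OF 1])
  obtain B2 where B2: "0 \<le> B2" "AE z in M. \<bar>g' z\<bar> \<le> B2" "g' \<in> borel_measurable M"
    "\<forall>\<^sub>F e in at_right 0. f' e \<in> borel_measurable M \<and> (AE z in M. \<bar>f' e z\<bar> \<le> B2)"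
    "((\<lambda>e. \<integral>z. \<bar>f' e z - g' z\<bar> \<partial>M) \<longlongrightarrow> 0) (at_right 0)"
    by (rule bounded_L1_limitE[OF 2])
  obtain C L where CL: "\<And>x y x' y'. \<lbrakk>\<bar>x\<bar> \<le> max B1 B2; \<bar>y\<bar> \<le> max B1 B2; \<bar>x'\<bar> \<le> max B1 B2; \<bar>y'\<bar> \<le> max B1 B2\<rbrakk> \<Longrightarrow>
      \<bar>F x y\<bar> \<le> C \<and> \<bar>F x y - F x' y'\<bar> \<le> L * (\<bar>x - x'\<bar> + \<bar>y - y'\<bar>)"
    using lip[of "max B1 B2"] by blast
  have g: "AE z in M. \<bar>g z\<bar> \<le> max B1 B2 \<and> \<bar>g' z\<bar> \<le> max B1 B2"
    using B1(2) B2(2) by eventually_elim auto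
  have f: "\<forall>\<^sub>F e in at_right 0. f e \<in> borel_measurable M \<and> f' e \<in> borel_measurable M \<and>
      (AE z in M. \<bar>f e z\<bar> \<le> max B1 B2 \<and> \<bar>f' e z\<bar> \<le> max B1 B2)"
    using B1(4) B2(4)
  proof eventually_elim
    case (elim e)
    then have "AE z in M. \<bar>f e z\<bar> \<le> B1" "AE z in M. \<bar>f' e z\<bar> \<le> B2" by blast+
    then have "AE z in M. \<bar>f e z\<bar> \<le> max B1 B2 \<and> \<bar>f' e z\<bar> \<le> max B1 B2"
      by eventually_elim auto
    then show ?case using elim by blast
  qed
  note i = bounded_L1_limit_integrable(3)[OF 1] bounded_L1_limit_integrable(3)[OF 2]
  show ?thesis
  proof (rule bounded_L1_limit_dominated)
    show "(\<lambda>z. F (g z) (g' z)) \<in> borel_measurable M" by (rule F[OF B1(3) B2(3)])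
    show "AE z in M. \<bar>F (g z) (g' z)\<bar> \<le> C"
      using g by eventually_elim (use CL in blast)
    show "\<forall>\<^sub>F e in at_right 0. (\<lambda>z. F (f e z) (f' e z)) \<in> borel_measurable M \<and>
        (AE z in M. \<bar>F (f e z) (f' e z)\<bar> \<le> C)"
      using f
    proof eventually_elim
      case (elim e)
      then have "AE z in M. \<bar>f e z\<bar> \<le> max B1 B2 \<and> \<bar>f' e z\<bar> \<le> max B1 B2" by blast
      then have "AE z in M. \<bar>F (f e z) (f' e z)\<bar> \<le> C"
        by eventually_elim (use CL in blast)
      then show ?case using F elim by blast
    qed
    show "\<forall>\<^sub>F e in at_right 0. integrable M (\<lambda>z. L * (\<bar>f e z - g z\<bar> + \<bar>f' e z - g' z\<bar>))"
      using i by eventually_elim auto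
    have "((\<lambda>e. L * ((\<integral>z. \<bar>f e z - g z\<bar> \<partial>M) + (\<integral>z. \<bar>f' e z - g' z\<bar> \<partial>M))) \<longlongrightarrow> 0) (at_right 0)"
      using tendsto_mult_left[OF tendsto_add[OF B1(5) B2(5)], of L] by simp
    then show "((\<lambda>e. \<integral>z. L * (\<bar>f e z - g z\<bar> + \<bar>f' e z - g' z\<bar>) \<partial>M) \<longlongrightarrow> 0) (at_right 0)"
      by (rule Lim_transform_eventually) (use i in \<open>eventually_elim, simp\<close>)
    show "\<forall>\<^sub>F e in at_right 0. AE z in M. \<bar>F (f e z) (f' e z) - F (g z) (g' z)\<bar>
        \<le> L * (\<bar>f e z - g z\<bar> + \<bar>f' e z - g' z\<bar>)"
      using f
    proof eventually_elim
      case (elim e)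
      then have "AE z in M. \<bar>f e z\<bar> \<le> max B1 B2 \<and> \<bar>f' e z\<bar> \<le> max B1 B2" by blast
      then show ?case using g by eventually_elim (use CL in blast)
    qed
  qed
qed

lemma bounded_L1_limit_add:
  assumes "bounded_L1_limit M f g" "bounded_L1_limit M f' g'"
  shows "bounded_L1_limit M (\<lambda>e z. f e z + f' e z) (\<lambda>z. g z + g' z)"
proof (rule bounded_L1_limit_binary[OF assms])
  fix B :: real
  have "\<bar>x + y\<bar> \<le> B + B \<and> \<bar>x + y - (x' + y')\<bar> \<le> 1 * (\<bar>x - x'\<bar> + \<bar>y - y'\<bar>)"
    if "\<bar>x\<bar> \<le> B" "\<bar>y\<bar> \<le> B" for x y x' y'
    using that abs_triangle_ineq[of x y] abs_diff_triangle_ineq[of x y x' y'] by simp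
  then show "\<exists>C L. \<forall>x y x' y'. \<bar>x\<bar> \<le> B \<and> \<bar>y\<bar> \<le> B \<and> \<bar>x'\<bar> \<le> B \<and> \<bar>y'\<bar> \<le> B \<longrightarrow>
      \<bar>x + y\<bar> \<le> C \<and> \<bar>x + y - (x' + y')\<bar> \<le> L * (\<bar>x - x'\<bar> + \<bar>y - y'\<bar>)" by blast
qed (rule borel_measurable_add)

lemma bounded_L1_limit_mult:
  assumes "bounded_L1_limit M f g" "bounded_L1_limit M f' g'"
  shows "bounded_L1_limit M (\<lambda>e z. f e z * f' e z) (\<lambda>z. g z * g' z)"
proof (rule bounded_L1_limit_binary[OF assms])
  fix B :: real
  have "\<bar>x * y\<bar> \<le> B * B \<and> \<bar>x * y - x' * y'\<bar> \<le> B * (\<bar>x - x'\<bar> + \<bar>y - y'\<bar>)"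
    if "\<bar>x\<bar> \<le> B" "\<bar>y\<bar> \<le> B" "\<bar>x'\<bar> \<le> B" for x y x' y'
  proof
    show "\<bar>x * y\<bar> \<le> B * B"
      unfolding abs_mult using that by (intro mult_mono) auto
    have "x * y - x' * y' = y * (x - x') + x' * (y - y')" by (simp add: algebra_simps)
    then have "\<bar>x * y - x' * y'\<bar> \<le> \<bar>y\<bar> * \<bar>x - x'\<bar> + \<bar>x'\<bar> * \<bar>y - y'\<bar>"
      by (metis abs_mult abs_triangle_ineq)
    also have "\<dots> \<le> B * \<bar>x - x'\<bar> + B * \<bar>y - y'\<bar>"
      using that by (intro add_mono mult_right_mono) auto
    finally show "\<bar>x * y - x' * y'\<bar> \<le> B * (\<bar>x - x'\<bar> + \<bar>y - y'\<bar>)" by (simp add: distrib_left)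
  qed
  then show "\<exists>C L. \<forall>x y x' y'. \<bar>x\<bar> \<le> B \<and> \<bar>y\<bar> \<le> B \<and> \<bar>x'\<bar> \<le> B \<and> \<bar>y'\<bar> \<le> B \<longrightarrow>
      \<bar>x * y\<bar> \<le> C \<and> \<bar>x * y - x' * y'\<bar> \<le> L * (\<bar>x - x'\<bar> + \<bar>y - y'\<bar>)" by blast
qed (rule borel_measurable_times)

lemma bounded_L1_limit_sum:
  assumes "\<And>i. i \<in> I \<Longrightarrow> bounded_L1_limit M (f i) (g i)"
  shows "bounded_L1_limit M (\<lambda>e z. \<Sum>i\<in>I. f i e z) (\<lambda>z. \<Sum>i\<in>I. g i z)"
proof (cases "finite I")
  case True
  then show ?thesis using assms
    by (induction I rule: finite_induct) (auto intro: bounded_L1_limit_const bounded_L1_limit_add)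
qed (simp add: bounded_L1_limit_const)

lemma bounded_L1_limit_integral:
  assumes f: "bounded_L1_limit M f g" and \<psi>: "\<psi> \<in> borel_measurable M" "\<And>z. \<bar>\<psi> z\<bar> \<le> B"
  shows "((\<lambda>e. \<integral>z. f e z * \<psi> z \<partial>M) \<longlongrightarrow> (\<integral>z. g z * \<psi> z \<partial>M)) (at_right 0)"
proof -
  have B: "0 \<le> B" using \<psi>(2) abs_ge_zero order_trans by blast
  have int\<psi>: "integrable M (\<lambda>z. h z * \<psi> z)" if "integrable M h" for h
  proof (rule Bochner_Integration.integrable_bound[where f = "\<lambda>z. B * h z"])
    show "AE z in M. norm (h z * \<psi> z) \<le> norm (B * h z)"
      using \<psi>(2) B by (intro AE_I2) (simp add: abs_mult mult.commute mult_right_mono)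
  qed (use that \<psi>(1) in auto)
  have lim: "((\<lambda>e. B * (\<integral>z. \<bar>f e z - g z\<bar> \<partial>M)) \<longlongrightarrow> 0) (at_right 0)"
    using f tendsto_mult_left[of "\<lambda>e. \<integral>z. \<bar>f e z - g z\<bar> \<partial>M" 0 _ B]
    unfolding bounded_L1_limit_def by simp
  have "((\<lambda>e. (\<integral>z. f e z * \<psi> z \<partial>M) - (\<integral>z. g z * \<psi> z \<partial>M)) \<longlongrightarrow> 0) (at_right 0)"
  proof (rule tendsto_0_le[OF lim, of _ 1])
    show "\<forall>\<^sub>F e in at_right 0. norm ((\<integral>z. f e z * \<psi> z \<partial>M) - (\<integral>z. g z * \<psi> z \<partial>M))
        \<le> norm (B * (\<integral>z. \<bar>f e z - g z\<bar> \<partial>M)) * 1"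
      using bounded_L1_limit_integrable(2,3)[OF f]
    proof eventually_elim
      case (elim e)
      note g = bounded_L1_limit_integrable(1)[OF f]
      have "(\<integral>z. f e z * \<psi> z \<partial>M) - (\<integral>z. g z * \<psi> z \<partial>M) = (\<integral>z. (f e z - g z) * \<psi> z \<partial>M)"
        using int\<psi>[OF elim(1)] int\<psi>[OF g] by (simp add: left_diff_distrib)
      also have "norm \<dots> \<le> (\<integral>z. norm ((f e z - g z) * \<psi> z) \<partial>M)"
        by (rule integral_norm_bound)
      also have "\<dots> \<le> (\<integral>z. B * \<bar>f e z - g z\<bar> \<partial>M)"
      proof (intro integral_mono integrable_norm int\<psi>)
        show "norm ((f e z - g z) * \<psi> z) \<le> B * \<bar>f e z - g z\<bar>" for z
          using mult_right_mono[OF \<psi>(2), of "\<bar>f e z - g z\<bar>" z] by (simp add: abs_mult mult.commute)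
      qed (use elim g in auto)
      finally show ?case using B by simp
    qed
  qed
  then show ?thesis by (simp add: LIM_zero_iff)
qed

text \<open>On a finite measure a function is split at a small threshold: the part below contributes
  little mass, the part above is controlled by its q-th power. Only the approximations are known to
  be bounded; the limit inherits their bound.\<close>

lemma Lq_imp_bounded_L1_limit:
  fixes f :: "real \<Rightarrow> 'a \<Rightarrow> real"
  assumes q: "1 \<le> q" and g[measurable]: "g \<in> borel_measurable M"
    and f: "\<forall>\<^sub>F e in at_right 0. f e \<in> borel_measurable M \<and> (AE z in M. \<bar>f e z\<bar> \<le> B)"
    and lim: "((\<lambda>e. \<integral>\<^sup>+z. ennreal (\<bar>f e z - g z\<bar> powr q) \<partial>M) \<longlongrightarrow> 0) (at_right 0)"
  shows "bounded_L1_limit M f g"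
proof -
  \<comment> \<open>Above \<open>d\<close> the exponent \<open>1 - q\<close> is nonpositive, so
    \<open>x powr (1 - q)\<close> is at most \<open>d powr (1 - q)\<close>. This takes the place of
    the Hoelder inequality.\<close>
  have power_bound: "x \<le> d + d powr (1 - q) * x powr q" if "0 \<le> x" "0 < d" for x d :: real
  proof (cases "x \<le> d")
    case False
    have "x = x powr (1 - q) * x powr q"
      using that False by (simp flip: powr_add)
    also have "\<dots> \<le> d powr (1 - q) * x powr q"
      using that False q by (intro mult_right_mono powr_mono2') auto
    finally show ?thesis using that by simp
  qed (use that in \<open>simp add: add_increasing2\<close>)
  have small: "\<forall>\<^sub>F e in at_right 0. f e \<in> borel_measurable M \<and> (AE z in M. \<bar>f e z\<bar> \<le> B)
      \<and> (\<integral>\<^sup>+z. ennreal \<bar>f e z - g z\<bar> \<partial>M) \<le> ennreal c" if c: "0 < c" for c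
  proof -
    define m where "m = measure M (space M)"
    have m: "0 \<le> m" by (simp add: m_def)
    \<comment> \<open>The constant \<open>d\<close> contributes at most \<open>c / 2\<close> over
      the total mass \<open>m\<close>; adding one keeps the denominator positive when
      \<open>m\<close> is zero. The bound \<open>b\<close> below is chosen to spend the other
      half.\<close>
    define d where "d = c / (2 * (m + 1))"
    have d: "0 < d" using c m by (simp add: d_def)
    define b where "b = c / 2 / d powr (1 - q)"
    have b: "0 < b" using c d by (simp add: b_def)
    have dm: "d * m \<le> c / 2"
      using c m unfolding d_def by (simp add: field_simps)
    have "\<forall>\<^sub>F e in at_right 0. (\<integral>\<^sup>+z. ennreal (\<bar>f e z - g z\<bar> powr q) \<partial>M) < ennreal b"
      using order_tendstoD(2)[OF lim, of "ennreal b"] b by simp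
    then show ?thesis using f
    proof eventually_elim
      case (elim e)
      have [measurable]: "f e \<in> borel_measurable M" using elim by blast
      have "(\<integral>\<^sup>+z. ennreal \<bar>f e z - g z\<bar> \<partial>M)
          \<le> (\<integral>\<^sup>+z. ennreal d + ennreal (d powr (1 - q)) * ennreal (\<bar>f e z - g z\<bar> powr q) \<partial>M)"
      proof (rule nn_integral_mono)
        fix z
        show "ennreal \<bar>f e z - g z\<bar> \<le> ennreal d + ennreal (d powr (1 - q)) * ennreal (\<bar>f e z - g z\<bar> powr q)"
          using power_bound[of "\<bar>f e z - g z\<bar>" d] d
          by (simp flip: ennreal_mult ennreal_plus)
      qed
      also have "\<dots> = ennreal d * emeasure M (space M)
          + ennreal (d powr (1 - q)) * (\<integral>\<^sup>+z. ennreal (\<bar>f e z - g z\<bar> powr q) \<partial>M)"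
        by (subst nn_integral_add) (auto simp: nn_integral_cmult)
      also have "\<dots> \<le> ennreal d * ennreal m + ennreal (d powr (1 - q)) * ennreal b"
        using elim(1) by (intro add_mono mult_left_mono) (auto simp: m_def emeasure_eq_measure)
      also have "\<dots> = ennreal (d * m + d powr (1 - q) * b)"
        using d m b by (simp flip: ennreal_mult ennreal_plus)
      also have "\<dots> \<le> ennreal c"
        using dm d by (intro ennreal_leI) (simp add: b_def)
      finally show ?case using elim by blast
    qed
  qed
  \<comment> \<open>\<open>ennreal\<close> truncates \<open>\<bar>g z\<bar> - B\<close> at zero, and
    the result is dominated by \<open>\<bar>f e z - g z\<bar>\<close>, whose integral can be made
    arbitrarily small.\<close>
  have gB: "AE z in M. \<bar>g z\<bar> \<le> B"
  proof -
    have "(\<integral>\<^sup>+z. ennreal (\<bar>g z\<bar> - B) \<partial>M) \<le> 0 + ennreal c" if c: "0 < c" for c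
    proof -
      obtain e where e: "AE z in M. \<bar>f e z\<bar> \<le> B" "(\<integral>\<^sup>+z. ennreal \<bar>f e z - g z\<bar> \<partial>M) \<le> ennreal c"
        using eventually_happens'[OF _ small[OF c]] by auto
      have "(\<integral>\<^sup>+z. ennreal (\<bar>g z\<bar> - B) \<partial>M) \<le> (\<integral>\<^sup>+z. ennreal \<bar>f e z - g z\<bar> \<partial>M)"
      proof (rule nn_integral_mono_AE)
        show "AE z in M. ennreal (\<bar>g z\<bar> - B) \<le> ennreal \<bar>f e z - g z\<bar>"
          using e(1) by eventually_elim (auto intro!: ennreal_leI)
      qed
      then show ?thesis using e(2) by simp
    qed
    then have "(\<integral>\<^sup>+z. ennreal (\<bar>g z\<bar> - B) \<partial>M) \<le> 0"
      by (rule ennreal_le_epsilon)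
    then have "(\<integral>\<^sup>+z. ennreal (\<bar>g z\<bar> - B) \<partial>M) = 0" by simp
    moreover have "(\<lambda>z. ennreal (\<bar>g z\<bar> - B)) \<in> borel_measurable M" by measurable
    ultimately have "AE z in M. ennreal (\<bar>g z\<bar> - B) = 0"
      using nn_integral_0_iff_AE[of "\<lambda>z. ennreal (\<bar>g z\<bar> - B)" M] by (simp only: simp_thms)
    then show ?thesis by eventually_elim (simp add: ennreal_eq_0_iff)
  qed
  have "((\<lambda>e. \<integral>z. \<bar>f e z - g z\<bar> \<partial>M) \<longlongrightarrow> 0) (at_right 0)"
  proof (rule tendstoI)
    fix c :: real assume c: "0 < c"
    then have "0 < c / 2" by simp
    from small[OF this] show "\<forall>\<^sub>F e in at_right 0. dist (\<integral>z. \<bar>f e z - g z\<bar> \<partial>M) 0 < c"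
    proof eventually_elim
      case (elim e)
      have [measurable]: "f e \<in> borel_measurable M" using elim by blast
      have "(\<integral>z. \<bar>f e z - g z\<bar> \<partial>M) = enn2real (\<integral>\<^sup>+z. ennreal \<bar>f e z - g z\<bar> \<partial>M)"
        by (rule integral_eq_nn_integral) auto
      also have "\<dots> \<le> c / 2"
        using elim c by (intro enn2real_leI) auto
      finally show ?case using c by simp
    qed
  qed
  then show ?thesis
    unfolding bounded_L1_limit_def using g gB f by blast
qed

end

section \<open>Balance laws of smooth Navier--Stokes flows\<close>

lemma C_2_on_deriv: "C_k_on 2 f S \<Longrightarrow> C_k_on 1 (D e f) S"
  by (rule C_k_on_deriv) (simp add: numeral_2_eq_2)

lemma C_2_on_imp_C_1: "C_k_on 2 f S \<Longrightarrow> C_k_on 1 f S"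
  by (rule C_k_on_mono) auto

lemma norm_matrix_square:
  fixes S :: "real^'n::finite^'m::finite"
  shows "(norm S)\<^sup>2 = (\<Sum>i\<in>UNIV. \<Sum>j\<in>UNIV. (S $ i $ j)\<^sup>2)"
  by (simp add: norm_vec_def L2_set_def real_sqrt_pow2 sum_nonneg)

lemma norm_vector_square: "(norm x)\<^sup>2 = (\<Sum>i\<in>UNIV. (x $ i)\<^sup>2)" for x :: "real^'n::finite"
  by (simp add: norm_vec_def L2_set_def real_sqrt_pow2 sum_nonneg)

text \<open>\<open>S\<close> is symmetric and trace free, and the symmetric part of \<open>G\<close>
  is \<open>S\<close> plus a multiple of the identity, which is orthogonal to \<open>S\<close>. With
  \<open>G\<close> the velocity gradient and \<open>a\<close>, \<open>b\<close> the scaled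
  viscosities, the right-hand side is minus the dissipation.\<close>

lemma stress_contraction:
  fixes G :: "'d::finite \<Rightarrow> 'd \<Rightarrow> real"
  defines "\<theta> \<equiv> \<Sum>i\<in>UNIV. G i i"
  defines "S \<equiv> \<lambda>i j. (G i j + G j i - (if i = j then 2 / real CARD('d) * \<theta> else 0)) / 2"
  shows "(\<Sum>i\<in>UNIV. \<Sum>j\<in>UNIV. (- (2 * a) * S i j - (if i = j then b * \<theta> else 0)) * G i j)
    = - (2 * a * (\<Sum>i\<in>UNIV. \<Sum>j\<in>UNIV. (S i j)\<^sup>2) + b * \<theta>\<^sup>2)"
proof -
  have sym: "S i j = S j i" for i j by (auto simp: S_def)
  have "S i i = G i i - \<theta> / real CARD('d)" for i
    by (simp add: S_def field_simps)
  then have tr: "(\<Sum>i\<in>UNIV. S i i) = 0"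
    by (simp add: sum_subtractf flip: \<theta>_def)
  have diag: "(\<Sum>i\<in>UNIV. \<Sum>j\<in>UNIV. (if i = j then c else 0) * H i j) = c * (\<Sum>i\<in>UNIV. H i i)"
    for c and H :: "'d \<Rightarrow> 'd \<Rightarrow> real"
    by (simp add: if_distrib[of "\<lambda>x. x * _"] sum_distrib_left cong: if_cong)
  have G: "(G i j + G j i) / 2 = S i j + (if i = j then \<theta> / real CARD('d) else 0)" for i j
    by (auto simp: S_def field_simps)
  \<comment> \<open>Relabelling the indices and symmetry of \<open>S\<close> allow \<open>G\<close>
    to be replaced by its symmetric part.\<close>
  have "(\<Sum>i\<in>UNIV. \<Sum>j\<in>UNIV. S i j * G j i) = (\<Sum>i\<in>UNIV. \<Sum>j\<in>UNIV. S i j * G i j)"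
    by (subst sum.swap) (simp add: sym)
  then have "(\<Sum>i\<in>UNIV. \<Sum>j\<in>UNIV. S i j * G i j)
      = (\<Sum>i\<in>UNIV. \<Sum>j\<in>UNIV. S i j * ((G i j + G j i) / 2))"
    by (simp add: algebra_simps sum.distrib add_divide_distrib flip: sum_divide_distrib)
  also have "\<dots> = (\<Sum>i\<in>UNIV. \<Sum>j\<in>UNIV. (S i j)\<^sup>2)
      + (\<Sum>i\<in>UNIV. \<Sum>j\<in>UNIV. (if i = j then \<theta> / real CARD('d) else 0) * S i j)"
    unfolding G by (simp add: algebra_simps sum.distrib power2_eq_square)
  also have "\<dots> = (\<Sum>i\<in>UNIV. \<Sum>j\<in>UNIV. (S i j)\<^sup>2)"
    unfolding diag tr by simp
  finally have SG: "(\<Sum>i\<in>UNIV. \<Sum>j\<in>UNIV. S i j * G i j) = (\<Sum>i\<in>UNIV. \<Sum>j\<in>UNIV. (S i j)\<^sup>2)" .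
  have "(\<Sum>i\<in>UNIV. \<Sum>j\<in>UNIV. (- (2 * a) * S i j - (if i = j then b * \<theta> else 0)) * G i j)
      = - (2 * a) * (\<Sum>i\<in>UNIV. \<Sum>j\<in>UNIV. S i j * G i j)
        - (\<Sum>i\<in>UNIV. \<Sum>j\<in>UNIV. (if i = j then b * \<theta> else 0) * G i j)"
    by (simp add: left_diff_distrib sum_subtractf sum_distrib_left mult.assoc sum_negf)
  then show ?thesis
    unfolding diag SG by (simp add: power2_eq_square flip: \<theta>_def)
qed

abbreviation dt :: "('d::finite spacetime \<Rightarrow> real) \<Rightarrow> 'd spacetime \<Rightarrow> real" where
  "dt f z \<equiv> D (0, 1) f z"

abbreviation dx :: "'d::finite \<Rightarrow> ('d spacetime \<Rightarrow> real) \<Rightarrow> 'd spacetime \<Rightarrow> real" where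
  "dx i f z \<equiv> D (axis i 1, 0) f z"

text \<open>Order two for the states, the velocity and the state functions makes stress and heat
  flux C^1, so that their divergences have a classical meaning.\<close>

locale navier_stokes_flow =
  fixes th :: fluid and W U :: "(real \<times> real) set" and \<epsilon> :: real and ts :: ereal
    and u r :: "'d::finite spacetime \<Rightarrow> real" and v :: "'d spacetime \<Rightarrow> real^'d"
  assumes thermo: "thermodynamic W th" and UW: "U \<subseteq> W"
    and states: "\<And>z. z \<in> cover ts \<Longrightarrow> (u z, r z) \<in> U"
    and C2_th: "\<And>h. h \<in> {pressure th, temperature th, chem_potential th, entropy th,
        shear_viscosity th, bulk_viscosity th, conductivity th} \<Longrightarrow> C_k_on 2 h U"
    and C2_u: "C_k_on 2 u (cover ts)" and C2_r: "C_k_on 2 r (cover ts)" and C2_v: "C_k_on 2 v (cover ts)"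
    and ns: "navier_stokes th \<epsilon> ts u r v"
begin

definition p where "p z = pressure th (u z, r z)"
definition Th where "Th z = temperature th (u z, r z)"
definition s where "s z = entropy th (u z, r z)"
definition \<eta> where "\<eta> z = shear_viscosity th (u z, r z)"
definition \<zeta> where "\<zeta> z = bulk_viscosity th (u z, r z)"
definition \<kappa> where "\<kappa> z = conductivity th (u z, r z)"
definition strn where "strn i j z = strain v z $ i $ j"
definition stress where "stress i j z = viscous_stress th \<epsilon> u r v z $ i $ j"
definition heat where "heat i z = \<epsilon> * \<kappa> z * dx i Th z"

lemma C2_compose:
  assumes "h \<in> {pressure th, temperature th, chem_potential th, entropy th,
        shear_viscosity th, bulk_viscosity th, conductivity th}"
  shows "C_k_on 2 (\<lambda>z. h (u z, r z)) (cover ts)"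
  by (rule C_k_on_compose_pair[OF open_cover states C2_th[OF assms] C2_u C2_r])

lemma C2_fields:
  "C_k_on 2 p (cover ts)" "C_k_on 2 Th (cover ts)" "C_k_on 2 s (cover ts)"
  "C_k_on 2 \<eta> (cover ts)" "C_k_on 2 \<zeta> (cover ts)" "C_k_on 2 \<kappa> (cover ts)"
  unfolding p_def Th_def s_def \<eta>_def \<zeta>_def \<kappa>_def by (rule C2_compose, simp)+

lemma C2_component: "C_k_on 2 (\<lambda>z. v z $ i) (cover ts)"
  by (rule C_k_on_linear[OF open_cover bounded_linear_vec_nth C2_v])

lemmas C1_fields = C2_fields[THEN C_2_on_imp_C_1] C2_u[THEN C_2_on_imp_C_1]
  C2_r[THEN C_2_on_imp_C_1] C2_component[THEN C_2_on_imp_C_1]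

lemma divergence_eq: "divergence v z = (\<Sum>i\<in>UNIV. dx i (\<lambda>y. v y $ i) z)"
  by (simp add: divergence_def space_deriv_def)

lemma C1_divergence: "C_k_on 1 (divergence v) (cover ts)"
  unfolding divergence_eq[abs_def]
  by (intro C_k_on_sum open_cover C_2_on_deriv C2_component)

lemma strn_eq: "strn i j z = (dx i (\<lambda>y. v y $ j) z + dx j (\<lambda>y. v y $ i) z
    - (if i = j then 2 / real CARD('d) * divergence v z else 0)) / 2"
  by (simp add: strn_def strain_def vector_gradient_def space_deriv_def transpose_def mat_def)

lemma stress_eq: "stress i j z = - (2 * (\<epsilon> * \<eta> z)) * strn i j z
    - (if i = j then \<epsilon> * \<zeta> z * divergence v z else 0)"
  by (simp add: stress_def viscous_stress_def strn_def \<eta>_def \<zeta>_def mat_def)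

lemma stress_sym: "stress i j = stress j i"
  by (rule ext) (simp add: stress_eq strn_eq add.commute)

lemma C1_strn: "C_k_on 1 (strn i j) (cover ts)"
proof -
  have "strn i j = (\<lambda>z. 1/2 * ((dx i (\<lambda>y. v y $ j) z + dx j (\<lambda>y. v y $ i) z)
      - (if i = j then 2 / real CARD('d) else 0) * divergence v z))"
    by (rule ext) (simp add: strn_eq)
  moreover have "C_k_on 1 (\<lambda>z. 1/2 * ((dx i (\<lambda>y. v y $ j) z + dx j (\<lambda>y. v y $ i) z)
      - (if i = j then 2 / real CARD('d) else 0) * divergence v z)) (cover ts)"
    by (intro C_k_on_cmult C_k_on_diff C_k_on_add open_cover C_2_on_deriv C2_component C1_divergence)
  ultimately show ?thesis by (simp only:)
qed

lemma C1_stress: "C_k_on 1 (stress i j) (cover ts)"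
proof -
  have "stress i j = (\<lambda>z. - (2 * \<epsilon>) * (\<eta> z * strn i j z) - (if i = j then \<epsilon> else 0) * (\<zeta> z * divergence v z))"
    by (rule ext) (simp add: stress_eq)
  moreover have "C_k_on 1 (\<lambda>z. - (2 * \<epsilon>) * (\<eta> z * strn i j z) - (if i = j then \<epsilon> else 0) * (\<zeta> z * divergence v z)) (cover ts)"
    by (intro C_k_on_cmult C_k_on_diff C_k_on_mult open_cover C1_strn C1_divergence C1_fields)
  ultimately show ?thesis by (simp only:)
qed

lemma C1_heat: "C_k_on 1 (heat i) (cover ts)"
  unfolding heat_def[abs_def] mult.assoc
  by (intro C_k_on_cmult C_k_on_mult open_cover C_2_on_deriv C2_fields C1_fields)

lemma temperature_pos: "z \<in> cover ts \<Longrightarrow> 0 < Th z"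
  using thermo states[of z] UW unfolding thermodynamic_def Th_def by blast

lemma dissipation_eq: "dissipation th \<epsilon> u r v z
    = - (\<Sum>i\<in>UNIV. \<Sum>j\<in>UNIV. stress i j z * dx i (\<lambda>y. v y $ j) z)"
  using stress_contraction[of "\<epsilon> * \<eta> z" "\<lambda>i j. dx i (\<lambda>y. v y $ j) z" "\<epsilon> * \<zeta> z"]
  unfolding stress_eq strn_eq dissipation_def norm_matrix_square strn_def[symmetric] divergence_eq[symmetric]
  by (simp add: \<eta>_def \<zeta>_def)

text \<open>Written with the heat flux, the conduction term has the shape that arises from
  differentiating the inverse temperature in the entropy flux.\<close>

lemma entropy_production_eq:
  assumes "z \<in> cover ts"
  shows "entropy_production th \<epsilon> u r v z
    = dissipation th \<epsilon> u r v z / Th z + (\<Sum>i\<in>UNIV. heat i z * dx i Th z) / (Th z)\<^sup>2"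
proof -
  have "(norm (gradient (\<lambda>y. temperature th (u y, r y)) z /\<^sub>R temperature th (u z, r z)))\<^sup>2
      = (\<Sum>i\<in>UNIV. (dx i Th z)\<^sup>2) / (Th z)\<^sup>2"
    by (simp add: norm_vector_square gradient_def space_deriv_def Th_def[symmetric] Th_def[abs_def, symmetric]
        power_mult_distrib sum_distrib_left[symmetric] power_inverse divide_inverse mult.commute)
  then show ?thesis
    unfolding entropy_production_def
    by (simp add: heat_def Th_def[symmetric] \<kappa>_def sum_distrib_left power2_eq_square mult.assoc)
qed

section \<open>From the conservation laws to the kinetic, internal and entropy balances\<close>

context
  fixes z :: "'d spacetime" assumes z: "z \<in> cover ts"
begin

lemma differentiable_fields:
  "u differentiable at z" "r differentiable at z" "(\<lambda>y. v y $ i) differentiable at z"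
  "p differentiable at z" "Th differentiable at z" "s differentiable at z"
  "stress i j differentiable at z" "heat i differentiable at z"
  by (rule C_k_on_differentiable[OF _ _ z], rule C1_fields C1_stress C1_heat, simp)+

lemma mass_balance: "dt r z + (\<Sum>i\<in>UNIV. dx i (\<lambda>y. r y * v y $ i) z) = 0"
  using ns z unfolding navier_stokes_def by (auto simp: time_deriv_def divergence_def space_deriv_def)

lemma momentum_balance:
  "dt (\<lambda>y. r y * v y $ i) z + (\<Sum>j\<in>UNIV. dx j (\<lambda>y. (r y * (v y $ i * v y $ j) + (if i = j then p y else 0))
     + stress i j y) z) = 0"
  using ns z unfolding navier_stokes_def p_def stress_def
  by (auto simp: time_deriv_def divergence_def space_deriv_def outer_def mat_def)

lemma energy_balance:
  "dt (energy u r v) z + (\<Sum>i\<in>UNIV. dx i (\<lambda>y. (p y + energy u r v y) * v y $ i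
     + ((\<Sum>j\<in>UNIV. stress i j y * v y $ j) - heat i y)) z) = 0"
  using ns z unfolding navier_stokes_def
  by (auto simp: time_deriv_def divergence_def space_deriv_def stress_def p_def heat_def gradient_def
      matrix_vector_mult_def \<kappa>_def Th_def[abs_def] add_diff_eq)

text \<open>Grouping the convective flux as \<open>v $ i\<close> times the mass flux produces
  \<open>v $ i\<close> times the mass balance, which vanishes; what remains is the density times the
  material derivative.\<close>

lemma momentum_convective:
  "r z * (dt (\<lambda>y. v y $ i) z + (\<Sum>j\<in>UNIV. v z $ j * dx j (\<lambda>y. v y $ i) z))
    = - dx i p z - (\<Sum>j\<in>UNIV. dx j (stress i j) z)"
proof -
  note [simp] = differentiable_fields
  have 1: "dx j (\<lambda>y. (r y * (v y $ i * v y $ j) + (if i = j then p y else 0)) + stress i j y) z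
      = (v z $ i * dx j (\<lambda>y. r y * v y $ j) z + r z * (v z $ j * dx j (\<lambda>y. v y $ i) z))
        + (if i = j then dx j p z else 0) + dx j (stress i j) z" for j
  proof -
    have "dx j (\<lambda>y. (r y * (v y $ i * v y $ j) + (if i = j then p y else 0)) + stress i j y) z
        = dx j (\<lambda>y. v y $ i * (r y * v y $ j)) z + dx j (\<lambda>y. if i = j then p y else 0) z + dx j (stress i j) z"
      by (cases "i = j") (simp_all add: frechet_derivative_add mult.left_commute)
    also have "dx j (\<lambda>y. v y $ i * (r y * v y $ j)) z
        = v z $ i * dx j (\<lambda>y. r y * v y $ j) z + r z * (v z $ j * dx j (\<lambda>y. v y $ i) z)"
      by (subst frechet_derivative_mult) simp_all
    finally show ?thesis by (cases "i = j") simp_all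
  qed
  have "0 = dt (\<lambda>y. r y * v y $ i) z + (\<Sum>j\<in>UNIV. v z $ i * dx j (\<lambda>y. r y * v y $ j) z
      + r z * (v z $ j * dx j (\<lambda>y. v y $ i) z) + (if i = j then dx j p z else 0) + dx j (stress i j) z)"
    using momentum_balance[of i] unfolding 1 by simp
  also have "\<dots> = r z * dt (\<lambda>y. v y $ i) z + v z $ i * (dt r z + (\<Sum>j\<in>UNIV. dx j (\<lambda>y. r y * v y $ j) z))
      + r z * (\<Sum>j\<in>UNIV. v z $ j * dx j (\<lambda>y. v y $ i) z) + dx i p z + (\<Sum>j\<in>UNIV. dx j (stress i j) z)"
    by (subst frechet_derivative_mult) (simp_all add: sum.distrib sum_distrib_left algebra_simps)
  also have "\<dots> = r z * (dt (\<lambda>y. v y $ i) z + (\<Sum>j\<in>UNIV. v z $ j * dx j (\<lambda>y. v y $ i) z))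
      + dx i p z + (\<Sum>j\<in>UNIV. dx j (stress i j) z)"
    unfolding mass_balance by (simp add: algebra_simps)
  finally show ?thesis by simp
qed

text \<open>The convective momentum equation is contracted with the velocity. The product rule puts
  pressure and stress under a divergence and leaves the pressure work and, by
  \<open>dissipation_eq\<close>, the viscous dissipation.\<close>

lemma kinetic_balance:
  "dt (\<lambda>y. 1/2 * r y * (norm (v y))\<^sup>2) z
    + (\<Sum>j\<in>UNIV. dx j (\<lambda>y. (p y + 1/2 * r y * (norm (v y))\<^sup>2) * v y $ j
        + (\<Sum>i\<in>UNIV. stress j i y * v y $ i)) z)
    = p z * divergence v z - dissipation th \<epsilon> u r v z"
proof -
  note [simp] = differentiable_fields
  \<comment> \<open>\<open>k\<close> is the kinetic energy per unit mass; with the energy written as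
    \<open>k\<close> times the density, the mass balance absorbs all derivatives of the
    density.\<close>
  define k where "k y = 1/2 * (\<Sum>i\<in>UNIV. v y $ i * v y $ i)" for y
  have k: "1/2 * r y * (norm (v y))\<^sup>2 = k y * r y" for y
    unfolding k_def norm_vector_square by (simp add: power2_eq_square)
  have k_diff: "k differentiable at z"
    unfolding k_def[abs_def] by simp
  have dk: "D e k z = (\<Sum>i\<in>UNIV. v z $ i * D e (\<lambda>y. v y $ i) z)" for e
  proof -
    have "D e k z = 1/2 * D e (\<lambda>y. \<Sum>i\<in>UNIV. v y $ i * v y $ i) z"
      unfolding k_def[abs_def] by (subst frechet_derivative_mult) simp_all
    also have "D e (\<lambda>y. \<Sum>i\<in>UNIV. v y $ i * v y $ i) z
        = (\<Sum>i\<in>UNIV. 2 * (v z $ i * D e (\<lambda>y. v y $ i) z))"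
      by (subst frechet_derivative_sum) (simp_all add: frechet_derivative_mult)
    finally show ?thesis by (simp add: sum_distrib_left)
  qed
  have flux: "dx j (\<lambda>y. (p y + 1/2 * r y * (norm (v y))\<^sup>2) * v y $ j + (\<Sum>i\<in>UNIV. stress j i y * v y $ i)) z
      = (p z * dx j (\<lambda>y. v y $ j) z + v z $ j * dx j p z)
        + (k z * dx j (\<lambda>y. r y * v y $ j) z + r z * (v z $ j * dx j k z))
        + (\<Sum>i\<in>UNIV. stress j i z * dx j (\<lambda>y. v y $ i) z + v z $ i * dx j (stress j i) z)" for j
  proof -
    have "(\<lambda>y. (p y + 1/2 * r y * (norm (v y))\<^sup>2) * v y $ j + (\<Sum>i\<in>UNIV. stress j i y * v y $ i))
        = (\<lambda>y. (p y * v y $ j + k y * (r y * v y $ j)) + (\<Sum>i\<in>UNIV. stress j i y * v y $ i))"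
      unfolding k by (simp add: algebra_simps)
    then have "dx j (\<lambda>y. (p y + 1/2 * r y * (norm (v y))\<^sup>2) * v y $ j + (\<Sum>i\<in>UNIV. stress j i y * v y $ i)) z
        = (dx j (\<lambda>y. p y * v y $ j) z + dx j (\<lambda>y. k y * (r y * v y $ j)) z)
          + (\<Sum>i\<in>UNIV. dx j (\<lambda>y. stress j i y * v y $ i) z)"
      using k_diff by (simp add: frechet_derivative_add frechet_derivative_sum)
    also have "dx j (\<lambda>y. k y * (r y * v y $ j)) z
        = k z * dx j (\<lambda>y. r y * v y $ j) z + r z * (v z $ j * dx j k z)"
      using k_diff by (subst frechet_derivative_mult) simp_all
    finally show ?thesis
      by (simp add: frechet_derivative_mult algebra_simps)
  qed
  have conv: "(\<Sum>j\<in>UNIV. v z $ j * dx j k z) = (\<Sum>i\<in>UNIV. v z $ i * (\<Sum>j\<in>UNIV. v z $ j * dx j (\<lambda>y. v y $ i) z))"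
    unfolding dk sum_distrib_left by (subst sum.swap) (simp add: mult.left_commute)
  \<comment> \<open>The energy flux is differentiated along the first index of the stress, the
    momentum flux along the second; symmetry of the stress reconciles them.\<close>
  have stress_swap: "(\<Sum>j\<in>UNIV. \<Sum>i\<in>UNIV. v z $ i * dx j (stress j i) z)
      = (\<Sum>i\<in>UNIV. v z $ i * (\<Sum>j\<in>UNIV. dx j (stress i j) z))"
    unfolding sum_distrib_left by (subst sum.swap) (simp add: stress_sym[of _ "_ :: 'd"])
  have dtk: "dt (\<lambda>y. 1/2 * r y * (norm (v y))\<^sup>2) z = k z * dt r z + r z * dt k z"
    unfolding k using k_diff by (subst frechet_derivative_mult) simp_all
  have "dt (\<lambda>y. 1/2 * r y * (norm (v y))\<^sup>2) z
    + (\<Sum>j\<in>UNIV. dx j (\<lambda>y. (p y + 1/2 * r y * (norm (v y))\<^sup>2) * v y $ j + (\<Sum>i\<in>UNIV. stress j i y * v y $ i)) z)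
    = k z * (dt r z + (\<Sum>j\<in>UNIV. dx j (\<lambda>y. r y * v y $ j) z))
      + r z * (dt k z + (\<Sum>j\<in>UNIV. v z $ j * dx j k z))
      + p z * divergence v z + (\<Sum>j\<in>UNIV. v z $ j * dx j p z)
      + (\<Sum>j\<in>UNIV. \<Sum>i\<in>UNIV. stress j i z * dx j (\<lambda>y. v y $ i) z)
      + (\<Sum>j\<in>UNIV. \<Sum>i\<in>UNIV. v z $ i * dx j (stress j i) z)"
    unfolding flux dtk divergence_eq
    by (simp add: sum.distrib distrib_left flip: sum_distrib_left)
  also have "\<dots> = (\<Sum>i\<in>UNIV. v z $ i * (r z * (dt (\<lambda>y. v y $ i) z + (\<Sum>j\<in>UNIV. v z $ j * dx j (\<lambda>y. v y $ i) z))
         + dx i p z + (\<Sum>j\<in>UNIV. dx j (stress i j) z)))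
      + p z * divergence v z - dissipation th \<epsilon> u r v z"
    unfolding mass_balance conv stress_swap dissipation_eq unfolding dk
    by (simp add: distrib_left sum.distrib sum_distrib_left mult.left_commute)
  also have "\<dots> = p z * divergence v z - dissipation th \<epsilon> u r v z"
    unfolding momentum_convective by simp
  finally show ?thesis .
qed

text \<open>Total minus kinetic energy: the pressure flux and the stress work cancel, and only
  advection and heat conduction remain under the divergence.\<close>

lemma internal_balance:
  "dt u z + (\<Sum>i\<in>UNIV. dx i (\<lambda>y. u y * v y $ i + - heat i y) z)
    = dissipation th \<epsilon> u r v z - p z * divergence v z"
proof -
  note [simp] = differentiable_fields
  let ?k = "\<lambda>y. 1/2 * r y * (norm (v y))\<^sup>2"
  let ?F = "\<lambda>i y. (p y + ?k y) * v y $ i + (\<Sum>j\<in>UNIV. stress i j y * v y $ j)"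
  have k: "?k differentiable at z"
    by (simp add: norm_vector_square)
  have E: "energy u r v = (\<lambda>y. ?k y + u y)"
    by (rule ext) (simp add: energy_def)
  have flux: "(\<lambda>y. (p y + energy u r v y) * v y $ i + ((\<Sum>j\<in>UNIV. stress i j y * v y $ j) - heat i y))
      = (\<lambda>y. ?F i y + (u y * v y $ i + - heat i y))" for i
    by (rule ext) (simp add: E algebra_simps)
  have "dx i (\<lambda>y. ?F i y + (u y * v y $ i + - heat i y)) z
      = dx i (?F i) z + dx i (\<lambda>y. u y * v y $ i + - heat i y) z" for i
    by (rule frechet_derivative_add) (use k in simp_all)
  moreover have "dt (energy u r v) z = dt ?k z + dt u z"
    unfolding E by (rule frechet_derivative_add[OF k]) simp
  ultimately have "dt ?k z + (\<Sum>i\<in>UNIV. dx i (?F i) z)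
      + (dt u z + (\<Sum>i\<in>UNIV. dx i (\<lambda>y. u y * v y $ i + - heat i y) z)) = 0"
    using energy_balance unfolding flux by (simp add: sum.distrib)
  then show ?thesis
    unfolding kinetic_balance by simp
qed

text \<open>After multiplication by the temperature, the relation
  \<open>T ds = du - \<mu> dr\<close> turns the law into the internal energy balance minus
  \<open>\<mu>\<close> times the mass balance. The leftover multiples of the velocity divergence
  cancel by \<open>T s = u + p - \<mu> r\<close>.\<close>

lemma entropy_balance:
  "dt s z + (\<Sum>i\<in>UNIV. dx i (\<lambda>y. s y * v y $ i + - (heat i y * inverse (Th y))) z)
    = entropy_production th \<epsilon> u r v z"
proof -
  note [simp] = differentiable_fields
  let ?\<mu> = "chem_potential th (u z, r z)" and ?Q = "dissipation th \<epsilon> u r v z"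
  have zW: "(u z, r z) \<in> W" using states[OF z] UW by blast
  have Th: "Th z \<noteq> 0" using temperature_pos[OF z] by simp
  have "\<exists>ds. (entropy th has_derivative ds) (at (u z, r z)) \<and>
      (\<forall>a b. temperature th (u z, r z) * ds (a, b) = a - ?\<mu> * b)"
    using thermo zW unfolding thermodynamic_def by blast
  then obtain ds where ds: "(entropy th has_derivative ds) (at (u z, r z))"
    "\<And>a b. temperature th (u z, r z) * ds (a, b) = a - ?\<mu> * b"
    by blast
  have gibbs: "Th z * s z = u z + p z - ?\<mu> * r z"
    using thermo zW unfolding thermodynamic_def Th_def s_def p_def by blast
  have Ds: "Th z * D e s z
      = D e u z - ?\<mu> * D e r z" for e
  proof -
    have "entropy th differentiable at (u z, r z)" using ds(1) differentiableI by blast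
    then have "D e s z = frechet_derivative (entropy th) (at (u z, r z))
        (D e u z, D e r z)"
      unfolding s_def[abs_def] by (intro frechet_derivative_eqI[OF has_derivative_compose_pair]) simp_all
    then have "D e s z = ds (D e u z, D e r z)"
      using frechet_derivative_eqI[OF ds(1)] by simp
    then show ?thesis using ds(2) by (simp add: Th_def)
  qed
  \<comment> \<open>The last term comes from differentiating the inverse temperature; it becomes the
    conductive part of the entropy production.\<close>
  have flux: "Th z * dx i (\<lambda>y. s y * v y $ i + - (heat i y * inverse (Th y))) z
      = Th z * s z * dx i (\<lambda>y. v y $ i) z + v z $ i * (dx i u z - ?\<mu> * dx i r z)
        - dx i (heat i) z + heat i z * dx i Th z / Th z" for i
  proof -
    have inv: "(\<lambda>y. inverse (Th y)) differentiable at z"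
      using Th by (intro differentiable_inverse) simp_all
    have "dx i (\<lambda>y. s y * v y $ i - heat i y * inverse (Th y)) z
        = (s z * dx i (\<lambda>y. v y $ i) z + dx i s z * v z $ i)
          - (heat i z * dx i (\<lambda>y. inverse (Th y)) z + dx i (heat i) z * inverse (Th z))"
      using inv by (simp add: frechet_derivative_diff frechet_derivative_mult)
    also have "dx i (\<lambda>y. inverse (Th y)) z = - (inverse (Th z) * (dx i Th z * inverse (Th z)))"
      by (rule frechet_derivative_inverse) (use Th in simp_all)
    finally have "Th z * dx i (\<lambda>y. s y * v y $ i + - (heat i y * inverse (Th y))) z
        = Th z * s z * dx i (\<lambda>y. v y $ i) z + v z $ i * (Th z * dx i s z)
          - dx i (heat i) z + heat i z * dx i Th z / Th z"
      using Th by (simp add: field_simps)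
    then show ?thesis unfolding Ds .
  qed
  have internal: "dt u z + (\<Sum>i\<in>UNIV. v z $ i * dx i u z) + u z * divergence v z - (\<Sum>i\<in>UNIV. dx i (heat i) z)
      = ?Q - p z * divergence v z"
  proof -
    have "dx i (\<lambda>y. u y * v y $ i + - heat i y) z
        = u z * dx i (\<lambda>y. v y $ i) z + v z $ i * dx i u z - dx i (heat i) z" for i
      by (simp add: frechet_derivative_diff frechet_derivative_mult mult.commute)
    then show ?thesis
      using internal_balance by (simp add: divergence_eq sum.distrib sum_subtractf flip: sum_distrib_left)
  qed
  have mass: "dt r z + (\<Sum>i\<in>UNIV. v z $ i * dx i r z) + r z * divergence v z = 0"
  proof -
    have "dx i (\<lambda>y. r y * v y $ i) z = r z * dx i (\<lambda>y. v y $ i) z + v z $ i * dx i r z" for i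
      by (simp add: frechet_derivative_mult mult.commute)
    then show ?thesis
      using mass_balance by (simp add: divergence_eq sum.distrib flip: sum_distrib_left)
  qed
  have "Th z * (dt s z + (\<Sum>i\<in>UNIV. dx i (\<lambda>y. s y * v y $ i + - (heat i y * inverse (Th y))) z))
      = (dt u z - ?\<mu> * dt r z) + (\<Sum>i\<in>UNIV. Th z * s z * dx i (\<lambda>y. v y $ i) z
          + v z $ i * (dx i u z - ?\<mu> * dx i r z) - dx i (heat i) z + heat i z * dx i Th z / Th z)"
    unfolding distrib_left sum_distrib_left flux Ds ..
  also have "\<dots> = (dt u z + (\<Sum>i\<in>UNIV. v z $ i * dx i u z) - (\<Sum>i\<in>UNIV. dx i (heat i) z))
      - ?\<mu> * (dt r z + (\<Sum>i\<in>UNIV. v z $ i * dx i r z))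
      + Th z * s z * divergence v z + (\<Sum>i\<in>UNIV. heat i z * dx i Th z) / Th z"
    by (simp add: divergence_eq sum.distrib sum_subtractf sum_distrib_left sum_divide_distrib algebra_simps)
  also have "\<dots> = (?Q - p z * divergence v z - u z * divergence v z)
      - ?\<mu> * (- (r z * divergence v z)) + Th z * s z * divergence v z
      + (\<Sum>i\<in>UNIV. heat i z * dx i Th z) / Th z"
  proof -
    have "dt u z + (\<Sum>i\<in>UNIV. v z $ i * dx i u z) - (\<Sum>i\<in>UNIV. dx i (heat i) z)
        = ?Q - p z * divergence v z - u z * divergence v z"
      using internal by linarith
    moreover have "dt r z + (\<Sum>i\<in>UNIV. v z $ i * dx i r z) = - (r z * divergence v z)"
      using mass by linarith
    ultimately show ?thesis by simp
  qed
  \<comment> \<open>The coefficient of the divergence is \<open>- p - u + \<mu> r + T s\<close>,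
    which is zero by \<open>gibbs\<close>.\<close>
  also have "\<dots> = ?Q + (\<Sum>i\<in>UNIV. heat i z * dx i Th z) / Th z"
    unfolding gibbs by (simp add: algebra_simps)
  also have "\<dots> = Th z * entropy_production th \<epsilon> u r v z"
    unfolding entropy_production_eq[OF z] using Th by (simp add: field_simps power2_eq_square)
  finally show ?thesis using Th by simp
qed

end

end

section \<open>Local convergence and weak limits\<close>

lemma compact_in_empty: "compact_in \<Omega> ts {}"
  unfolding compact_in_def by (intro exI[of _ "{}"]) (auto simp: saturate_iff)

text \<open>Every point of the slab is an integer translate of a point over the closed unit cube, so
  on the torus a full spatial slab over a compact time interval is compact.\<close>

lemma compact_in_slab:
  fixes a b :: real
  assumes "0 < a" "ereal b < ts"
  shows "compact_in Torus ts (UNIV \<times> {a..b} :: 'd::finite spacetime set)"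
  unfolding compact_in_def
proof (intro exI conjI)
  let ?K = "cbox 0 (\<chi> i. 1) \<times> {a..b} :: 'd spacetime set"
  show "compact ?K" by (intro compact_Times compact_cbox) simp
  show "?K \<subseteq> cover ts"
    using assms by (auto simp: cover_def) (meson ereal_less_eq(3) le_less_trans)
  show "UNIV \<times> {a..b} = saturate Torus ?K"
  proof (intro set_eqI iffI)
    fix z :: "'d spacetime" assume z: "z \<in> UNIV \<times> {a..b}"
    let ?k = "(\<chi> i. of_int \<lfloor>fst z $ i\<rfloor>) :: real^'d"
    have "(fst z - ?k, snd z) \<in> ?K"
      using z by (auto simp: mem_box_cart) linarith
    moreover have "?k \<in> lattice Torus" by (simp add: lattice_def)
    moreover have "z = (fst z - ?k, snd z) + (?k, 0)" by (simp add: prod_eq_iff)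
    ultimately show "z \<in> saturate Torus ?K" unfolding saturate_iff by blast
  qed (auto simp: saturate_iff)
qed

text \<open>Strong convergence is stated on open sets with compact closure, so compact sets have to
  be enclosed in such sets. A time window with closure inside the open time interval is combined
  with all of space on the torus and with a ball otherwise.\<close>

lemma compact_in_neighbourhood:
  fixes A :: "'d::finite spacetime set"
  assumes "compact_in \<Omega> ts A"
  obtains O' where "open O'" "saturate \<Omega> O' = O'" "compact_in \<Omega> ts (closure O')" "A \<subseteq> O'"
proof (cases "A = {}")
  case True
  then show ?thesis
    by (intro that[of "{}"]) (simp_all add: compact_in_empty saturate_def)
next
  case False
  obtain K where K: "compact K" "K \<subseteq> cover ts" "A = saturate \<Omega> K"
    using assms unfolding compact_in_def by blast
  have "compact (snd ` K)" "snd ` K \<noteq> {}"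
    using K False by (auto intro!: compact_continuous_image continuous_intros simp: saturate_iff)
  then obtain a0 b0 where ab0: "a0 \<in> snd ` K" "\<And>t. t \<in> snd ` K \<Longrightarrow> a0 \<le> t"
    "b0 \<in> snd ` K" "\<And>t. t \<in> snd ` K \<Longrightarrow> t \<le> b0"
    using compact_attains_inf[of "snd ` K"] compact_attains_sup[of "snd ` K"] by blast
  have a0: "0 < a0" using ab0(1) K(2) by (auto simp: cover_def)
  have "ereal b0 < ts" using ab0(3) K(2) by (auto simp: cover_def)
  \<comment> \<open>\<open>ts\<close> may be infinite, so the upper end comes from density of the
    order and not from a midpoint.\<close>
  then obtain b where b: "b0 < b" "ereal b < ts"
    using ereal_dense2[of "ereal b0" ts] by auto
  have ab: "a0 / 2 < b" using a0 b ab0(2)[OF ab0(3)] by simp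
  have time: "a0 / 2 < t \<and> t < b" if "(x, t) \<in> A" for x t
  proof -
    have "t \<in> snd ` K" using that K(3) by (force simp: saturate_def)
    then show ?thesis using ab0(2,4)[of t] a0 b(1) by simp
  qed
  have cl: "closure (X \<times> {a0 / 2<..<b}) = closure X \<times> {a0 / 2..b}" for X :: "(real^'d) set"
    using ab by (simp add: closure_Times)
  show ?thesis
  proof (cases \<Omega>)
    case Torus
    show ?thesis
    proof (rule that[of "UNIV \<times> {a0 / 2<..<b}"])
      show "compact_in \<Omega> ts (closure (UNIV \<times> {a0 / 2<..<b} :: 'd spacetime set))"
        unfolding cl Torus using a0 b(2) by (simp add: compact_in_slab)
      show "saturate \<Omega> (UNIV \<times> {a0 / 2<..<b}) = (UNIV \<times> {a0 / 2<..<b} :: 'd spacetime set)"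
      proof (intro set_eqI iffI)
        fix z :: "'d spacetime" assume "z \<in> UNIV \<times> {a0 / 2<..<b}"
        then show "z \<in> saturate \<Omega> (UNIV \<times> {a0 / 2<..<b})"
          unfolding saturate_iff using zero_in_lattice[of \<Omega>]
          by (intro bexI[of _ z] bexI[of _ 0]) (auto simp: prod_eq_iff)
      qed (auto simp: saturate_iff)
    qed (use time in \<open>auto intro!: open_Times\<close>)
  next
    case Whole_Space
    obtain R where R: "\<And>z. z \<in> K \<Longrightarrow> norm z \<le> R"
      using compact_imp_bounded[OF K(1)] bounded_iff by metis
    have AK: "A = K" using K(3) Whole_Space by (simp add: saturate_Whole_Space)
    have x: "norm x < max R 0 + 1" if "(x, t) \<in> A" for x t
      using R[of "(x, t)"] norm_fst_le[of x t] that AK by fastforce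
    show ?thesis
    proof (rule that[of "ball 0 (max R 0 + 1) \<times> {a0 / 2<..<b}"])
      show "compact_in \<Omega> ts (closure (ball (0 :: real^'d) (max R 0 + 1) \<times> {a0 / 2<..<b}))"
        unfolding compact_in_def Whole_Space
      proof (intro exI conjI)
        show "closure (ball 0 (max R 0 + 1) \<times> {a0 / 2<..<b}) \<subseteq> (cover ts :: 'd spacetime set)"
          unfolding cl using a0 b(2) by (auto simp: cover_def) (meson ereal_less_eq(3) le_less_trans)
        show "compact (closure (ball 0 (max R 0 + 1) \<times> {a0 / 2<..<b}) :: 'd spacetime set)"
          unfolding cl by (auto intro!: compact_Times)
      qed (simp add: saturate_Whole_Space)
    qed (use time x in \<open>auto intro!: open_Times simp: Whole_Space saturate_Whole_Space\<close>)
  qed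
qed

section \<open>Mean convergence on compact space-time sets\<close>

abbreviation local_measure :: "space_domain \<Rightarrow> ereal \<Rightarrow> 'd::finite spacetime set \<Rightarrow> 'd spacetime measure" where
  "local_measure \<Omega> ts A \<equiv> restrict_space (spacetime \<Omega> ts) A"

lemma compact_in_sets_spacetime:
  fixes A :: "'d::finite spacetime set"
  assumes "compact_in \<Omega> ts A"
  shows "A \<inter> space (spacetime \<Omega> ts) \<in> sets (spacetime \<Omega> ts)"
    and "A \<inter> space (spacetime \<Omega> ts) = A \<inter> cylinder \<Omega>"
proof -
  show "A \<inter> space (spacetime \<Omega> ts) = A \<inter> cylinder \<Omega>"
    using compact_in_subset_cover[OF assms] by (auto simp: space_spacetime)
  then show "A \<inter> space (spacetime \<Omega> ts) \<in> sets (spacetime \<Omega> ts)"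
    using compact_in_measurable(1)[OF assms] by simp
qed

lemma finite_local_measure:
  assumes "compact_in \<Omega> ts A"
  shows "finite_measure (local_measure \<Omega> ts A)"
proof (rule finite_measureI)
  have "emeasure (local_measure \<Omega> ts A) (A \<inter> space (spacetime \<Omega> ts))
      = emeasure (spacetime \<Omega> ts) (A \<inter> space (spacetime \<Omega> ts))"
    by (rule emeasure_restrict_space) (use compact_in_sets_spacetime[OF assms] in auto)
  then show "emeasure (local_measure \<Omega> ts A) (space (local_measure \<Omega> ts A)) \<noteq> \<infinity>"
    using compact_in_measurable(2)[OF assms] compact_in_sets_spacetime(2)[OF assms]
    by (simp add: space_restrict_space Int_commute)
qed

lemma AE_local_measure:
  assumes "compact_in \<Omega> ts A" "AE z in spacetime \<Omega> ts. P z"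
  shows "AE z in local_measure \<Omega> ts A. P z"
  using assms(2) by (subst AE_restrict_space_iff[OF compact_in_sets_spacetime(1)[OF assms(1)]]) auto

lemma integral_local_measure:
  fixes f \<psi> :: "'d::finite spacetime \<Rightarrow> real"
  assumes "compact_in \<Omega> ts A" "\<And>z. z \<notin> A \<Longrightarrow> \<psi> z = 0"
  shows "(\<integral>z. f z * \<psi> z \<partial>spacetime \<Omega> ts) = (\<integral>z. f z * \<psi> z \<partial>local_measure \<Omega> ts A)"
proof -
  have "(\<integral>z. f z * \<psi> z \<partial>local_measure \<Omega> ts A) = (\<integral>z. indicator A z *\<^sub>R (f z * \<psi> z) \<partial>spacetime \<Omega> ts)"
    by (rule integral_restrict_space[OF compact_in_sets_spacetime(1)[OF assms(1)]])
  also have "\<dots> = (\<integral>z. f z * \<psi> z \<partial>spacetime \<Omega> ts)"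
    using assms(2) by (intro Bochner_Integration.integral_cong refl) (auto simp: indicator_def)
  finally show ?thesis by simp
qed

text \<open>The bound inside \<open>bounded_L1_limit\<close> may depend on the compact set.
  Stability under sums and products is what lets fluxes polynomial in the converging fields pass to
  the limit.\<close>

definition local_limit ::
    "space_domain \<Rightarrow> ereal \<Rightarrow> (real \<Rightarrow> 'd::finite spacetime \<Rightarrow> real) \<Rightarrow> ('d spacetime \<Rightarrow> real) \<Rightarrow> bool" where
  "local_limit \<Omega> ts f g \<longleftrightarrow> (\<forall>A. compact_in \<Omega> ts A \<longrightarrow> bounded_L1_limit (local_measure \<Omega> ts A) f g)"

lemma local_limit_const: "local_limit \<Omega> ts (\<lambda>e z. c) (\<lambda>z. c)"
  unfolding local_limit_def
  by (intro allI impI finite_measure.bounded_L1_limit_const finite_local_measure)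

lemma local_limit_add:
  "local_limit \<Omega> ts f g \<Longrightarrow> local_limit \<Omega> ts f' g' \<Longrightarrow>
    local_limit \<Omega> ts (\<lambda>e z. f e z + f' e z) (\<lambda>z. g z + g' z)"
  unfolding local_limit_def by (blast intro: finite_measure.bounded_L1_limit_add finite_local_measure)

lemma local_limit_mult:
  "local_limit \<Omega> ts f g \<Longrightarrow> local_limit \<Omega> ts f' g' \<Longrightarrow>
    local_limit \<Omega> ts (\<lambda>e z. f e z * f' e z) (\<lambda>z. g z * g' z)"
  unfolding local_limit_def by (blast intro: finite_measure.bounded_L1_limit_mult finite_local_measure)

lemma local_limit_sum:
  "(\<And>i. i \<in> I \<Longrightarrow> local_limit \<Omega> ts (f i) (g i)) \<Longrightarrow>
    local_limit \<Omega> ts (\<lambda>e z. \<Sum>i\<in>I. f i e z) (\<lambda>z. \<Sum>i\<in>I. g i z)"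
  unfolding local_limit_def by (intro allI impI finite_measure.bounded_L1_limit_sum finite_local_measure) blast+

lemma local_limit_locally_integrable:
  assumes "local_limit \<Omega> ts f g"
  shows "locally_integrable \<Omega> ts g"
  unfolding locally_integrable_def
proof (intro allI impI)
  fix A :: "'a spacetime set" assume A: "compact_in \<Omega> ts A"
  then have "bounded_L1_limit (local_measure \<Omega> ts A) f g"
    using assms unfolding local_limit_def by blast
  from finite_measure.bounded_L1_limit_integrable(1)[OF finite_local_measure[OF A] this]
  show "set_integrable (spacetime \<Omega> ts) A g"
    unfolding set_integrable_def
    by (simp add: integrable_restrict_space[OF compact_in_sets_spacetime(1)[OF A]])
qed

lemma local_limit_test_function:
  assumes f: "local_limit \<Omega> ts f g" and \<psi>: "test_function \<Omega> ts \<psi>"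
  shows "((\<lambda>e. \<integral>z. f e z * \<psi> z \<partial>spacetime \<Omega> ts) \<longlongrightarrow> (\<integral>z. g z * \<psi> z \<partial>spacetime \<Omega> ts)) (at_right 0)"
proof -
  let ?A = "closure {z. \<psi> z \<noteq> 0}"
  note A = test_functionD(3)[OF \<psi>]
  obtain B where B: "\<And>z. \<bar>\<psi> z\<bar> \<le> B" using test_function_bounded[OF \<psi>] by metis
  have meas: "\<psi> \<in> borel_measurable (local_measure \<Omega> ts ?A)"
    by (rule measurable_restrict_space1)
      (rule continuous_measurable_spacetime[OF test_function_continuous[OF \<psi>]])
  have bl: "bounded_L1_limit (local_measure \<Omega> ts ?A) f g"
    using f A unfolding local_limit_def by blast
  have eq: "(\<integral>z. h z * \<psi> z \<partial>spacetime \<Omega> ts) = (\<integral>z. h z * \<psi> z \<partial>local_measure \<Omega> ts ?A)" for h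
    by (rule integral_local_measure[OF A vanishes_off_support])
  show ?thesis
    unfolding eq
    by (rule finite_measure.bounded_L1_limit_integral[OF finite_local_measure[OF A] bl meas B])
qed

text \<open>Serves to pass from the velocity to its components, whose differences are dominated by
  the norm of the vector difference.\<close>

lemma converges_Lq_loc_norm_le:
  assumes conv: "converges_Lq_loc \<Omega> ts q f g" and q: "1 \<le> q"
    and le: "\<And>e z. norm (f' e z - g' z) \<le> norm (f e z - g z)"
  shows "converges_Lq_loc \<Omega> ts q f' g'"
  unfolding converges_Lq_loc_def
proof (intro allI impI)
  fix O' :: "'a spacetime set"
  assume "open O' \<and> saturate \<Omega> O' = O' \<and> compact_in \<Omega> ts (closure O')"
  then have "((\<lambda>e. \<integral>\<^sup>+z\<in>O'. ennreal (norm (f e z - g z) powr q) \<partial>spacetime \<Omega> ts) \<longlongrightarrow> 0) (at_right 0)"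
    using conv unfolding converges_Lq_loc_def by blast
  then show "((\<lambda>e. \<integral>\<^sup>+z\<in>O'. ennreal (norm (f' e z - g' z) powr q) \<partial>spacetime \<Omega> ts) \<longlongrightarrow> 0) (at_right 0)"
    by (rule tendsto_sandwich[OF always_eventually always_eventually tendsto_const, rotated 2])
      (use le q in \<open>auto intro!: nn_integral_mono mult_right_mono ennreal_leI powr_mono2\<close>)
qed

text \<open>The integral over a compact set is at most that over an enclosing admissible open set,
  and the restricted measure is finite, so convergence in the q-th power gives convergence in
  mean.\<close>

lemma converges_Lq_loc_local_limit:
  fixes f :: "real \<Rightarrow> 'd::finite spacetime \<Rightarrow> real"
  assumes q: "1 \<le> q" and conv: "converges_Lq_loc \<Omega> ts q f g"
    and g: "g \<in> borel_measurable (spacetime \<Omega> ts)"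
    and f: "\<forall>\<^sub>F e in at_right 0. f e \<in> borel_measurable (spacetime \<Omega> ts) \<and> (AE z in spacetime \<Omega> ts. \<bar>f e z\<bar> \<le> B)"
  shows "local_limit \<Omega> ts f g"
  unfolding local_limit_def
proof (intro allI impI)
  fix A :: "'d spacetime set" assume A: "compact_in \<Omega> ts A"
  obtain O' where O': "open O'" "saturate \<Omega> O' = O'" "compact_in \<Omega> ts (closure O')" "A \<subseteq> O'"
    using compact_in_neighbourhood[OF A] .
  have lim: "((\<lambda>e. \<integral>\<^sup>+z\<in>O'. ennreal (norm (f e z - g z) powr q) \<partial>spacetime \<Omega> ts) \<longlongrightarrow> 0) (at_right 0)"
    using conv O' unfolding converges_Lq_loc_def by blast
  have "(\<integral>\<^sup>+z. ennreal (\<bar>f e z - g z\<bar> powr q) \<partial>local_measure \<Omega> ts A)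
      \<le> (\<integral>\<^sup>+z\<in>O'. ennreal (norm (f e z - g z) powr q) \<partial>spacetime \<Omega> ts)" for e
    using O'(4) by (subst nn_integral_restrict_space[OF compact_in_sets_spacetime(1)[OF A]])
      (auto intro!: nn_integral_mono split: split_indicator)
  then have "((\<lambda>e. \<integral>\<^sup>+z. ennreal (\<bar>f e z - g z\<bar> powr q) \<partial>local_measure \<Omega> ts A) \<longlongrightarrow> 0) (at_right 0)"
    by (intro tendsto_sandwich[OF always_eventually always_eventually tendsto_const lim]) auto
  moreover have "\<forall>\<^sub>F e in at_right 0. f e \<in> borel_measurable (local_measure \<Omega> ts A)
      \<and> (AE z in local_measure \<Omega> ts A. \<bar>f e z\<bar> \<le> B)"
    using f by eventually_elim (use A in \<open>auto intro: measurable_restrict_space1 AE_local_measure\<close>)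
  ultimately show "bounded_L1_limit (local_measure \<Omega> ts A) f g"
    by (intro finite_measure.Lq_imp_bounded_L1_limit[OF finite_local_measure[OF A] q]
        measurable_restrict_space1 g)
qed

definition distr_null ::
    "space_domain \<Rightarrow> ereal \<Rightarrow> (real \<Rightarrow> 'd::finite spacetime \<Rightarrow> real) \<Rightarrow> bool" where
  "distr_null \<Omega> ts R \<longleftrightarrow> (\<forall>\<psi>. test_function \<Omega> ts \<psi> \<longrightarrow>
     ((\<lambda>e. \<integral>z. R e z * \<psi> z \<partial>spacetime \<Omega> ts) \<longlongrightarrow> 0) (at_right 0))"

text \<open>
  The Cauchy--Schwarz argument for the viscous terms, in the pointwise form
  \<open>2 \<bar>R \<psi>\<bar> \<le> sqrt e + R\<^sup>2 \<psi>\<^sup>2 / sqrt e\<close>; as \<open>\<psi>\<^sup>2\<close> is again a test function, no cut-off is needed.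
\<close>

lemma distr_null_dissipative:
  fixes R Z :: "real \<Rightarrow> 'd::finite spacetime \<Rightarrow> real"
  assumes Z: "converges_distr \<Omega> ts Z \<Lambda>"
    and R: "\<forall>\<^sub>F e in at_right 0. continuous_on (cover ts) (R e) \<and> periodic \<Omega> ts (R e)"
    and le: "\<forall>\<^sub>F e in at_right 0. AE z in spacetime \<Omega> ts. (R e z)\<^sup>2 \<le> C * e * Z e z"
  shows "distr_null \<Omega> ts R"
  unfolding distr_null_def
proof (intro allI impI)
  let ?M = "spacetime \<Omega> ts :: 'd spacetime measure"
  fix \<psi> :: "'d spacetime \<Rightarrow> real" assume \<psi>: "test_function \<Omega> ts \<psi>"
  let ?A = "closure {z. \<psi> z \<noteq> 0} \<inter> cylinder \<Omega>"
  let ?\<psi>2 = "\<lambda>z. \<psi> z * \<psi> z"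
  note \<psi>2 = test_function_mult[OF \<psi> \<psi>]
  note A = compact_in_measurable[OF test_functionD(3)[OF \<psi>]]
  have intA: "integrable ?M (indicat_real ?A)"
    using A by (intro integrable_real_indicator)
  let ?bound = "\<lambda>e. sqrt e / 2 * (measure ?M ?A + C * (\<integral>z. Z e z * ?\<psi>2 z \<partial>?M))"
  have Zlim: "((\<lambda>e. \<integral>z. Z e z * ?\<psi>2 z \<partial>?M) \<longlongrightarrow> \<Lambda> ?\<psi>2) (at_right 0)"
    and Zint: "\<forall>\<^sub>F e in at_right 0. locally_integrable \<Omega> ts (Z e)"
    using Z \<psi>2 unfolding converges_distr_def by blast+
  have "((\<lambda>e. sqrt e) \<longlongrightarrow> sqrt 0) (at_right 0)"
    by (intro tendsto_real_sqrt tendsto_ident_at)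
  then have "((\<lambda>e. sqrt e / 2) \<longlongrightarrow> 0) (at_right 0)"
    using tendsto_divide[of sqrt 0 "at_right 0" "\<lambda>_. 2 :: real" 2] by simp
  from tendsto_mult[OF this tendsto_add[OF tendsto_const tendsto_mult_left[OF Zlim]]]
  have lim: "(?bound \<longlongrightarrow> 0) (at_right 0)" by simp
  show "((\<lambda>e. \<integral>z. R e z * \<psi> z \<partial>?M) \<longlongrightarrow> 0) (at_right 0)"
  proof (rule tendsto_0_le[OF lim, of _ 1])
    show "\<forall>\<^sub>F e in at_right 0. norm (\<integral>z. R e z * \<psi> z \<partial>?M) \<le> norm (?bound e) * 1"
      using R le Zint eventually_at_right_less[of 0]
    proof eventually_elim
      case (elim e)
      have intZ: "integrable ?M (\<lambda>z. Z e z * ?\<psi>2 z)"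
        by (rule integrable_test_function[OF elim(3) \<psi>2])
      have intR: "integrable ?M (\<lambda>z. R e z * \<psi> z)"
        using elim(1) by (intro integrable_test_function[OF _ \<psi>] locally_integrable_continuous) auto
      have "norm (\<integral>z. R e z * \<psi> z \<partial>?M) \<le> (\<integral>z. norm (R e z * \<psi> z) \<partial>?M)"
        by (rule integral_norm_bound)
      also have "\<dots> \<le> (\<integral>z. sqrt e / 2 * (indicat_real ?A z + C * (Z e z * ?\<psi>2 z)) \<partial>?M)"
      proof (rule integral_mono_AE)
        show "AE z in ?M. norm (R e z * \<psi> z) \<le> sqrt e / 2 * (indicat_real ?A z + C * (Z e z * ?\<psi>2 z))"
          using elim(2) AE_space
        proof eventually_elim
          case (elim z)
          show ?case
          proof (cases "z \<in> ?A")
            case False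
            then have "\<psi> z = 0"
              using elim(2) vanishes_off_support[of z \<psi>] by (auto simp: space_spacetime)
            then show ?thesis using False by simp
          next
            case True
            \<comment> \<open>With \<open>e = w * w\<close> one factor \<open>w\<close> cancels on
              both sides and the other remains in front: this is the factor \<open>sqrt e\<close>
              that tends to zero.\<close>
            define w where "w = sqrt e"
            have w: "0 < w" "e = w * w" using \<open>0 < e\<close> by (auto simp: w_def)
            have "(R e z * \<psi> z)\<^sup>2 \<le> C * e * Z e z * (\<psi> z)\<^sup>2"
              unfolding power_mult_distrib by (rule mult_right_mono[OF elim(1)]) simp
            moreover have "2 * w * \<bar>R e z * \<psi> z\<bar> \<le> w\<^sup>2 + (R e z * \<psi> z)\<^sup>2"
              using sum_squares_bound[of w "\<bar>R e z * \<psi> z\<bar>"] by simp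
            ultimately have "2 * w * \<bar>R e z * \<psi> z\<bar> \<le> w * w * (1 + C * (Z e z * ?\<psi>2 z))"
              unfolding w(2) by (simp add: power2_eq_square algebra_simps)
            then have "w * (2 * \<bar>R e z * \<psi> z\<bar>) \<le> w * (w * (1 + C * (Z e z * ?\<psi>2 z)))"
              by (simp add: mult_ac)
            then have "2 * \<bar>R e z * \<psi> z\<bar> \<le> w * (1 + C * (Z e z * ?\<psi>2 z))"
              using w(1) by (simp only: mult_le_cancel_left_pos)
            then show ?thesis using True by (simp add: w_def)
          qed
        qed
      qed (use intR intZ intA in auto)
      also have "\<dots> = ?bound e"
        using intA intZ A(1) sets.sets_into_space[OF A(1)]
        by (simp add: Int_absorb2)
      finally show ?case by simp
    qed
  qed
qed

section \<open>Weak forms of the balance laws and their limits\<close>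

abbreviation C1_periodic :: "space_domain \<Rightarrow> ereal \<Rightarrow> ('d::finite spacetime \<Rightarrow> real) \<Rightarrow> bool" where
  "C1_periodic \<Omega> ts f \<equiv> C_k_on 1 f (cover ts) \<and> periodic \<Omega> ts f"

lemma gradient_component: "gradient \<phi> z $ i = dx i \<phi> z"
  by (simp add: gradient_def space_deriv_def)

lemma locally_integrable_vec:
  fixes F :: "'d::finite spacetime \<Rightarrow> real^'d"
  assumes "\<And>i. locally_integrable \<Omega> ts (\<lambda>z. F z $ i)"
  shows "locally_integrable \<Omega> ts F"
  unfolding locally_integrable_def set_integrable_def
proof (intro allI impI)
  fix A :: "'d spacetime set" assume A: "compact_in \<Omega> ts A"
  have "indicator A z *\<^sub>R F z = (\<Sum>i\<in>UNIV. (indicator A z *\<^sub>R F z $ i) *\<^sub>R axis i 1)" for z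
    by (simp add: vec_eq_iff axis_def if_distrib cong: if_cong)
  moreover have "integrable (spacetime \<Omega> ts) (\<lambda>z. \<Sum>i\<in>UNIV. (indicator A z *\<^sub>R F z $ i) *\<^sub>R (axis i 1 :: real^'d))"
    using assms A unfolding locally_integrable_def set_integrable_def
    by (intro Bochner_Integration.integrable_sum integrable_scaleR_left) auto
  ultimately show "integrable (spacetime \<Omega> ts) (\<lambda>z. indicator A z *\<^sub>R F z)"
    by simp
qed

lemma integral_gradient:
  fixes F :: "'d::finite spacetime \<Rightarrow> real^'d"
  assumes "\<And>i. locally_integrable \<Omega> ts (\<lambda>z. F z $ i)" and \<phi>: "test_function \<Omega> ts \<phi>"
  shows "(\<integral>z. F z \<bullet> gradient \<phi> z \<partial>spacetime \<Omega> ts)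
    = (\<Sum>i\<in>UNIV. \<integral>z. F z $ i * dx i \<phi> z \<partial>spacetime \<Omega> ts)"
  unfolding inner_vec_def gradient_component inner_real_def
  by (intro Bochner_Integration.integral_sum integrable_test_function test_function_deriv assms)

lemma weak_form:
  fixes a G :: "'d::finite spacetime \<Rightarrow> real" and F :: "'d \<Rightarrow> 'd spacetime \<Rightarrow> real"
  assumes a: "C_k_on 1 a (cover ts)" "periodic \<Omega> ts a"
    and F: "\<And>i. C_k_on 1 (F i) (cover ts)" "\<And>i. periodic \<Omega> ts (F i)"
    and eq: "\<And>z. z \<in> cover ts \<Longrightarrow> dt a z + (\<Sum>i\<in>UNIV. dx i (F i) z) = G z"
    and \<phi>: "test_function \<Omega> ts \<phi>"
  shows "(\<integral>z. G z * \<phi> z \<partial>spacetime \<Omega> ts) = - (\<integral>z. a z * dt \<phi> z \<partial>spacetime \<Omega> ts)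
    - (\<Sum>i\<in>UNIV. \<integral>z. F i z * dx i \<phi> z \<partial>spacetime \<Omega> ts)"
proof -
  let ?M = "spacetime \<Omega> ts :: 'd spacetime measure"
  have int: "integrable ?M (\<lambda>z. D e f z * \<phi> z)"
    if "C_k_on 1 f (cover ts)" "periodic \<Omega> ts f" for f e
    by (intro integrable_test_function[OF _ \<phi>] locally_integrable_continuous
        C_1_on_continuous_deriv periodic_frechet_derivative that)
  have "(\<integral>z. G z * \<phi> z \<partial>?M) = (\<integral>z. dt a z * \<phi> z + (\<Sum>i\<in>UNIV. dx i (F i) z * \<phi> z) \<partial>?M)"
    using eq by (intro Bochner_Integration.integral_cong refl)
      (auto simp: space_spacetime distrib_right sum_distrib_right simp flip: eq)
  also have "\<dots> = (\<integral>z. dt a z * \<phi> z \<partial>?M) + (\<Sum>i\<in>UNIV. \<integral>z. dx i (F i) z * \<phi> z \<partial>?M)"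
    using int[OF a] int[OF F] by simp
  also have "(\<integral>z. dt a z * \<phi> z \<partial>?M) = - (\<integral>z. a z * dt \<phi> z \<partial>?M)"
    using integral_by_parts[OF _ a \<phi>, of "(0, 1)"] by simp
  also have "(\<Sum>i\<in>UNIV. \<integral>z. dx i (F i) z * \<phi> z \<partial>?M) = - (\<Sum>i\<in>UNIV. \<integral>z. F i z * dx i \<phi> z \<partial>?M)"
    using integral_by_parts[OF _ F \<phi>] by (simp add: sum_negf)
  finally show ?thesis by simp
qed

text \<open>No convergence of the source \<open>G\<close> is assumed. In weak form its integrals
  equal those of the density and the fluxes, which converge, and this is what later forces the
  pressure work to have a limit.\<close>

lemma limit_balance:
  fixes a G :: "real \<Rightarrow> 'd::finite spacetime \<Rightarrow> real" and F R :: "'d \<Rightarrow> real \<Rightarrow> 'd spacetime \<Rightarrow> real"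
    and F0 :: "'d spacetime \<Rightarrow> real^'d"
  assumes reg: "\<forall>\<^sub>F e in at_right 0. C1_periodic \<Omega> ts (a e) \<and>
      (\<forall>i. C1_periodic \<Omega> ts (F i e) \<and>
           C1_periodic \<Omega> ts (R i e)) \<and>
      (\<forall>z\<in>cover ts. dt (a e) z + (\<Sum>i\<in>UNIV. dx i (\<lambda>y. F i e y + R i e y) z) = G e z)"
    and a: "local_limit \<Omega> ts a a0" and F: "\<And>i. local_limit \<Omega> ts (F i) (\<lambda>z. F0 z $ i)"
    and R: "\<And>i. distr_null \<Omega> ts (R i)" and \<phi>: "test_function \<Omega> ts \<phi>"
  shows "((\<lambda>e. \<integral>z. G e z * \<phi> z \<partial>spacetime \<Omega> ts) \<longlongrightarrow>
      - (\<integral>z. a0 z * time_deriv \<phi> z \<partial>spacetime \<Omega> ts)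
      - (\<integral>z. F0 z \<bullet> gradient \<phi> z \<partial>spacetime \<Omega> ts)) (at_right 0)"
proof -
  let ?M = "spacetime \<Omega> ts :: 'd spacetime measure"
  have F': "((\<lambda>e. \<integral>z. F i e z * dx i \<phi> z \<partial>?M) \<longlongrightarrow> (\<integral>z. F0 z $ i * dx i \<phi> z \<partial>?M)) (at_right 0)" for i
    by (intro local_limit_test_function F test_function_deriv \<phi>)
  have R': "((\<lambda>e. \<integral>z. R i e z * dx i \<phi> z \<partial>?M) \<longlongrightarrow> 0) (at_right 0)" for i
    using R test_function_deriv[OF \<phi>] unfolding distr_null_def by blast
  have lim: "((\<lambda>e. - (\<integral>z. a e z * dt \<phi> z \<partial>?M)
      - (\<Sum>i\<in>UNIV. (\<integral>z. F i e z * dx i \<phi> z \<partial>?M) + (\<integral>z. R i e z * dx i \<phi> z \<partial>?M)))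
    \<longlongrightarrow> - (\<integral>z. a0 z * dt \<phi> z \<partial>?M) - (\<Sum>i\<in>UNIV. (\<integral>z. F0 z $ i * dx i \<phi> z \<partial>?M) + 0)) (at_right 0)"
    by (intro tendsto_diff tendsto_minus tendsto_sum tendsto_add F' R'
        local_limit_test_function[OF a] test_function_deriv \<phi>)
  have eq: "(\<integral>z. F0 z \<bullet> gradient \<phi> z \<partial>?M) = (\<Sum>i\<in>UNIV. \<integral>z. F0 z $ i * dx i \<phi> z \<partial>?M)"
    by (intro integral_gradient local_limit_locally_integrable[OF F] \<phi>)
  have "\<forall>\<^sub>F e in at_right 0. - (\<integral>z. a e z * dt \<phi> z \<partial>?M)
      - (\<Sum>i\<in>UNIV. (\<integral>z. F i e z * dx i \<phi> z \<partial>?M) + (\<integral>z. R i e z * dx i \<phi> z \<partial>?M))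
      = (\<integral>z. G e z * \<phi> z \<partial>?M)"
    using reg
  proof eventually_elim
    case (elim e)
    have C1: "C_k_on 1 (\<lambda>y. F i e y + R i e y) (cover ts)" for i
      by (intro C_k_on_add open_cover; use elim in blast)
    have per: "periodic \<Omega> ts (\<lambda>y. F i e y + R i e y)" for i
      using elim by (simp add: periodic_iff)
    have int: "integrable ?M (\<lambda>z. F i e z * dx i \<phi> z)" "integrable ?M (\<lambda>z. R i e z * dx i \<phi> z)" for i
      by (intro integrable_test_function locally_integrable_continuous
          test_function_deriv \<phi> C_k_on_continuous[where k = 1]; use elim in blast)+
    have "(\<integral>z. G e z * \<phi> z \<partial>?M) = - (\<integral>z. a e z * dt \<phi> z \<partial>?M)
        - (\<Sum>i\<in>UNIV. \<integral>z. (F i e z + R i e z) * dx i \<phi> z \<partial>?M)"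
      by (intro weak_form C1 per \<phi>; use elim in blast)
    then show ?case using int by (simp add: distrib_right)
  qed
  from Lim_transform_eventually[OF lim this] show ?thesis
    unfolding eq time_deriv_def by simp
qed

section \<open>Distributions of order one\<close>

lemma test_function_iterated_deriv:
  "test_function \<Omega> ts \<phi> \<Longrightarrow> test_function \<Omega> ts (iterated_deriv vs \<phi>)"
  by (induction vs arbitrary: \<phi>) (auto intro: test_function_deriv)

definition seminorm :: "nat \<Rightarrow> ('d::finite spacetime \<Rightarrow> real) \<Rightarrow> real" where
  "seminorm N \<phi> = (\<Sum>vs | set vs \<subseteq> Basis \<and> length vs \<le> N. SUP z. \<bar>iterated_deriv vs \<phi> z\<bar>)"

text \<open>A real supremum is informative only over a bounded set; iterated derivatives of test
  functions are again test functions, hence bounded.\<close>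

lemma SUP_iterated_deriv:
  fixes \<phi> :: "'d::finite spacetime \<Rightarrow> real"
  assumes "test_function \<Omega> ts \<phi>"
  shows "\<bar>iterated_deriv vs \<phi> z\<bar> \<le> (SUP z. \<bar>iterated_deriv vs \<phi> z\<bar>)"
    and "0 \<le> (SUP z. \<bar>iterated_deriv vs \<phi> z\<bar>)"
proof -
  obtain B where "\<And>z. \<bar>iterated_deriv vs \<phi> z\<bar> \<le> B"
    using test_function_bounded[OF test_function_iterated_deriv[OF assms]] by metis
  then have "bdd_above (range (\<lambda>z. \<bar>iterated_deriv vs \<phi> z\<bar>))"
    by (intro bdd_aboveI2)
  then show *: "\<bar>iterated_deriv vs \<phi> z\<bar> \<le> (SUP z. \<bar>iterated_deriv vs \<phi> z\<bar>)" for z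
    by (rule cSUP_upper[OF UNIV_I])
  show "0 \<le> (SUP z. \<bar>iterated_deriv vs \<phi> z\<bar>)"
    using *[of 0] abs_ge_zero order_trans by blast
qed

lemma finite_derivative_lists:
  "finite {vs :: 'd::finite spacetime list. set vs \<subseteq> Basis \<and> length vs \<le> N}"
  by (rule finite_lists_length_le) simp

lemma seminorm_mono:
  "test_function \<Omega> ts \<phi> \<Longrightarrow> m \<le> n \<Longrightarrow> seminorm m \<phi> \<le> seminorm n \<phi>"
  unfolding seminorm_def
  by (intro sum_mono2 finite_derivative_lists SUP_iterated_deriv(2)) auto

lemma seminorm_nonneg: "test_function \<Omega> ts \<phi> \<Longrightarrow> 0 \<le> seminorm n \<phi>"
  unfolding seminorm_def by (intro sum_nonneg SUP_iterated_deriv(2))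

lemma deriv_le_seminorm:
  assumes "test_function \<Omega> ts \<phi>" "e \<in> Basis"
  shows "\<bar>D e \<phi> z\<bar> \<le> seminorm 1 \<phi>"
proof -
  have "\<bar>iterated_deriv [e] \<phi> z\<bar> \<le> (SUP z. \<bar>iterated_deriv [e] \<phi> z\<bar>)"
    by (rule SUP_iterated_deriv(1)[OF assms(1)])
  also have "\<dots> \<le> seminorm 1 \<phi>"
    unfolding seminorm_def using assms(2)
    by (intro member_le_sum finite_derivative_lists SUP_iterated_deriv(2)[OF assms(1)]) auto
  finally show ?thesis by simp
qed

lemma distribution_bound_iff:
  "distribution \<Omega> ts \<Lambda> \<longleftrightarrow>
     (\<forall>\<phi> \<psi>. test_function \<Omega> ts \<phi> \<longrightarrow> test_function \<Omega> ts \<psi> \<longrightarrow>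
        \<Lambda> (\<lambda>z. \<phi> z + \<psi> z) = \<Lambda> \<phi> + \<Lambda> \<psi>) \<and>
     (\<forall>c \<phi>. test_function \<Omega> ts \<phi> \<longrightarrow> \<Lambda> (\<lambda>z. c * \<phi> z) = c * \<Lambda> \<phi>) \<and>
     (\<forall>A. compact_in \<Omega> ts A \<longrightarrow>
        (\<exists>C N. \<forall>\<phi>. test_function \<Omega> ts \<phi> \<and> {z. \<phi> z \<noteq> 0} \<subseteq> A \<longrightarrow> \<bar>\<Lambda> \<phi>\<bar> \<le> C * seminorm N \<phi>))"
  unfolding distribution_def seminorm_def ..

lemma distribution_add:
  assumes 1: "distribution \<Omega> ts \<Lambda>" and 2: "distribution \<Omega> ts \<Lambda>'"
  shows "distribution \<Omega> ts (\<lambda>\<phi>. \<Lambda> \<phi> + \<Lambda>' \<phi>)"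
  unfolding distribution_bound_iff
proof (intro conjI allI impI)
  fix A :: "'a spacetime set" assume A: "compact_in \<Omega> ts A"
  obtain C N where C: "\<And>\<phi>. test_function \<Omega> ts \<phi> \<Longrightarrow> {z. \<phi> z \<noteq> 0} \<subseteq> A \<Longrightarrow> \<bar>\<Lambda> \<phi>\<bar> \<le> C * seminorm N \<phi>"
    using 1 A unfolding distribution_bound_iff by blast
  obtain C' N' where C': "\<And>\<phi>. test_function \<Omega> ts \<phi> \<Longrightarrow> {z. \<phi> z \<noteq> 0} \<subseteq> A \<Longrightarrow> \<bar>\<Lambda>' \<phi>\<bar> \<le> C' * seminorm N' \<phi>"
    using 2 A unfolding distribution_bound_iff by blast
  \<comment> \<open>The two constants may be negative and the two orders differ, hence absolute
    values and the larger order.\<close>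
  have mono: "c * seminorm n \<phi> \<le> \<bar>c\<bar> * seminorm (max N N') \<phi>"
    if "test_function \<Omega> ts \<phi>" "n \<le> max N N'" for c n \<phi>
    using seminorm_mono[OF that] seminorm_nonneg[OF that(1), of n]
    by (meson abs_ge_self abs_ge_zero mult_left_mono mult_right_mono order_trans)
  have "\<bar>\<Lambda> \<phi> + \<Lambda>' \<phi>\<bar> \<le> (\<bar>C\<bar> + \<bar>C'\<bar>) * seminorm (max N N') \<phi>"
    if "test_function \<Omega> ts \<phi>" "{z. \<phi> z \<noteq> 0} \<subseteq> A" for \<phi>
    using C[OF that] C'[OF that] mono[OF that(1), of N C] mono[OF that(1), of N' C']
      abs_triangle_ineq[of "\<Lambda> \<phi>" "\<Lambda>' \<phi>"]
    unfolding distrib_right by linarith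
  then show "\<exists>C N. \<forall>\<phi>. test_function \<Omega> ts \<phi> \<and> {z. \<phi> z \<noteq> 0} \<subseteq> A \<longrightarrow> \<bar>\<Lambda> \<phi> + \<Lambda>' \<phi>\<bar> \<le> C * seminorm N \<phi>"
    by blast
qed (use 1 2 in \<open>auto simp: distribution_bound_iff algebra_simps\<close>)

lemma distribution_zero: "distribution \<Omega> ts (\<lambda>\<phi>. 0)"
  unfolding distribution_bound_iff by (auto intro!: exI[of _ 0])

lemma distribution_sum:
  assumes "\<And>i. i \<in> I \<Longrightarrow> distribution \<Omega> ts (\<Lambda> i)"
  shows "distribution \<Omega> ts (\<lambda>\<phi>. \<Sum>i\<in>I. \<Lambda> i \<phi>)"
proof (cases "finite I")
  case True
  then show ?thesis using assms
    by (induction I rule: finite_induct) (auto intro: distribution_zero distribution_add)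
qed (simp add: distribution_zero)

text \<open>One derivative falls on the test function, so the L1 norm of \<open>f\<close> on a fixed
  compact set times the first-order seminorm is a bound.\<close>

lemma distribution_weak_deriv:
  fixes f :: "'d::finite spacetime \<Rightarrow> real"
  assumes f: "locally_integrable \<Omega> ts f" and e: "e \<in> Basis"
  shows "distribution \<Omega> ts (\<lambda>\<phi>. \<integral>z. f z * D e \<phi> z \<partial>spacetime \<Omega> ts)"
  unfolding distribution_bound_iff
proof (intro conjI allI impI)
  let ?M = "spacetime \<Omega> ts :: 'd spacetime measure"
  have diff: "\<phi> differentiable at z" if "test_function \<Omega> ts \<phi>" for \<phi> and z :: "'d spacetime"
    using C_k_on_differentiable[OF test_function_C_k[OF that, of 1 UNIV]] by simp
  have int: "integrable ?M (\<lambda>z. f z * D e \<phi> z)" if "test_function \<Omega> ts \<phi>" for \<phi>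
    by (intro integrable_test_function f test_function_deriv that)
  show "(\<integral>z. f z * D e (\<lambda>z. \<phi> z + \<psi> z) z \<partial>?M)
      = (\<integral>z. f z * D e \<phi> z \<partial>?M) + (\<integral>z. f z * D e \<psi> z \<partial>?M)"
    if "test_function \<Omega> ts \<phi>" "test_function \<Omega> ts \<psi>" for \<phi> \<psi>
    using int that diff by (simp add: frechet_derivative_add distrib_left)
  show "(\<integral>z. f z * D e (\<lambda>z. c * \<phi> z) z \<partial>?M)
      = c * (\<integral>z. f z * D e \<phi> z \<partial>?M)"
    if "test_function \<Omega> ts \<phi>" for c \<phi>
  proof -
    have "D e (\<lambda>z. c * \<phi> z) z = c * D e \<phi> z" for z
      using frechet_derivative_mult[of "\<lambda>_. c" z \<phi> e] diff[OF that] by simp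
    then show ?thesis by (simp add: mult.left_commute)
  qed
  fix A :: "'d spacetime set" assume A: "compact_in \<Omega> ts A"
  \<comment> \<open>\<open>A\<close> is only known to contain the points where \<open>\<phi>\<close>
    is nonzero; \<open>closure O'\<close> is a compact set that also contains the closure of these
    points, off which the derivative vanishes.\<close>
  obtain O' where O': "compact_in \<Omega> ts (closure O')" "A \<subseteq> O'"
    using compact_in_neighbourhood[OF A] by metis
  let ?C = "\<integral>z. \<bar>indicator (closure O') z * f z\<bar> \<partial>?M"
  have intO: "integrable ?M (\<lambda>z. indicator (closure O') z * f z)"
    using f O'(1) unfolding locally_integrable_def set_integrable_def by simp
  have "\<bar>\<integral>z. f z * D e \<phi> z \<partial>?M\<bar> \<le> ?C * seminorm 1 \<phi>"
    if \<phi>: "test_function \<Omega> ts \<phi>" "{z. \<phi> z \<noteq> 0} \<subseteq> A" for \<phi>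
  proof -
    have "closure {z. \<phi> z \<noteq> 0} \<subseteq> closure O'"
      using \<phi>(2) O'(2) by (intro closure_mono) blast
    then have 0: "D e \<phi> z = 0" if "z \<notin> closure O'" for z
      by (intro frechet_derivative_off_support(1)) (use that in blast)
    have "\<bar>\<integral>z. f z * D e \<phi> z \<partial>?M\<bar> \<le> (\<integral>z. \<bar>f z * D e \<phi> z\<bar> \<partial>?M)"
      using integral_norm_bound[of ?M "\<lambda>z. f z * D e \<phi> z"] by simp
    also have "\<dots> \<le> (\<integral>z. \<bar>indicator (closure O') z * f z\<bar> * seminorm 1 \<phi> \<partial>?M)"
    proof (rule integral_mono)
      fix z
      have "\<bar>D e \<phi> z\<bar> \<le> seminorm 1 \<phi>"
        by (rule deriv_le_seminorm[OF \<phi>(1) e])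
      then show "\<bar>f z * D e \<phi> z\<bar> \<le> \<bar>indicator (closure O') z * f z\<bar> * seminorm 1 \<phi>"
        using 0[of z] by (cases "z \<in> closure O'") (auto simp: abs_mult mult_left_mono)
    qed (use int[OF \<phi>(1)] intO in auto)
    also have "\<dots> = ?C * seminorm 1 \<phi>"
      using intO by simp
    finally show ?thesis .
  qed
  then show "\<exists>C N. \<forall>\<phi>. test_function \<Omega> ts \<phi> \<and> {z. \<phi> z \<noteq> 0} \<subseteq> A \<longrightarrow>
      \<bar>\<integral>z. f z * D e \<phi> z \<partial>?M\<bar> \<le> C * seminorm N \<phi>"
    by blast
qed

section \<open>Essential ranges and composition with state functions\<close>

text \<open>Lebesgue measure is complete. This is used for state functions of the limit fields: they
  are controlled on \<open>K\<close>, where the limit states lie only almost everywhere.\<close>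

lemma spacetime_measurable_AE:
  fixes f g :: "'d::finite spacetime \<Rightarrow> real"
  assumes f: "f \<in> borel_measurable (spacetime \<Omega> ts)" and eq: "AE z in spacetime \<Omega> ts. f z = g z"
  shows "g \<in> borel_measurable (spacetime \<Omega> ts)"
proof -
  let ?S = "spacetime_cell \<Omega> ts :: 'd spacetime set"
  have iff: "h \<in> borel_measurable (spacetime \<Omega> ts)
      \<longleftrightarrow> (\<lambda>z. if z \<in> ?S then h z else 0) \<in> borel_measurable lebesgue" for h :: "'d spacetime \<Rightarrow> real"
    unfolding spacetime_def using borel_measurable_if[OF spacetime_cell_lebesgue] by blast
  have "AE z in lebesgue. z \<in> ?S \<longrightarrow> f z = g z"
    using eq unfolding spacetime_def
    by (subst (asm) AE_restrict_space_iff) (simp_all add: spacetime_cell_lebesgue)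
  then have "AE z in lebesgue. (if z \<in> ?S then f z else 0) = (if z \<in> ?S then g z else 0)"
    by eventually_elim auto
  with f show ?thesis
    unfolding iff by (rule borel_measurable_AE)
qed

text \<open>The complement of the essential range is the union of all open sets with null preimage,
  and the Lindeloef property reduces it to countably many of them.\<close>

lemma AE_essential_range:
  fixes f :: "'a \<Rightarrow> 'b::second_countable_topology"
  assumes f[measurable]: "f \<in> borel_measurable M"
  shows "AE z in M. f z \<in> essential_range M f"
proof -
  define \<V> where "\<V> = {V. open V \<and> emeasure M {z \<in> space M. f z \<in> V} = 0}"
  obtain \<V>' where V': "\<V>' \<subseteq> \<V>" "countable \<V>'" "\<Union>\<V>' = \<Union>\<V>"
    using Lindelof[of \<V>] unfolding \<V>_def by blast
  have "AE z in M. f z \<notin> V" if "V \<in> \<V>'" for V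
  proof (rule AE_I)
    have V: "open V" "emeasure M {z \<in> space M. f z \<in> V} = 0"
      using that V'(1) unfolding \<V>_def by auto
    from V(1) have [measurable]: "V \<in> sets borel" by simp
    show "{z \<in> space M. f z \<in> V} \<in> sets M" by measurable
  qed (use that V'(1) in \<open>auto simp: \<V>_def\<close>)
  then have "AE z in M. \<forall>V\<in>\<V>'. f z \<notin> V"
    by (intro AE_ball_countable' V'(2))
  then show ?thesis
  proof eventually_elim
    case (elim z)
    then have z: "f z \<notin> \<Union>\<V>" unfolding V'(3)[symmetric] by blast
    show ?case
      unfolding essential_range_def
    proof (intro CollectI allI impI)
      fix V assume "open V \<and> f z \<in> V"
      then have "emeasure M {z \<in> space M. f z \<in> V} \<noteq> 0" using z unfolding \<V>_def by blast
      then show "0 < emeasure M {z \<in> space M. f z \<in> V}" by (simp add: zero_less_iff_neq_zero)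
    qed
  qed
qed

lemma cylinder_representative:
  fixes z :: "'d::finite spacetime"
  obtains k where "k \<in> lattice \<Omega>" "z + (k, 0) \<in> cylinder \<Omega>"
proof (cases \<Omega>)
  case Whole_Space
  then show ?thesis
    by (intro that[of 0]) (simp_all add: zero_in_lattice cell_def mem_Times_iff)
next
  case Torus
  show ?thesis
  proof (rule that[of "\<chi> i. - of_int \<lfloor>fst z $ i\<rfloor>"])
    show "z + (\<chi> i. - of_int \<lfloor>fst z $ i\<rfloor>, 0) \<in> cylinder \<Omega>"
      unfolding Torus cell_def mem_Times_iff by simp linarith
  qed (simp add: Torus lattice_def)
qed

text \<open>The torus cell is half open. An open part whose closure contains the cell suffices to
  find open sets, hence positive measure, inside it.\<close>

lemma cell_interior:
  obtains C :: "(real^'d::finite) set" where "open C" "C \<subseteq> cell \<Omega>" "cell \<Omega> \<subseteq> closure C"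
proof (cases \<Omega>)
  case Whole_Space
  then show ?thesis using that[of UNIV] by (simp add: cell_def)
next
  case Torus
  let ?C = "box 0 (\<chi> i. 1) :: (real^'d) set"
  have "((\<chi> i. 1 / 2) :: real^'d) \<in> ?C" by (simp add: mem_box_cart)
  then have "closure ?C = cbox 0 (\<chi> i. 1)" by (intro closure_box) blast
  moreover have "?C \<subseteq> cell \<Omega>" "cell \<Omega> \<subseteq> cbox 0 (\<chi> i. 1)"
    by (auto simp: Torus cell_def mem_box_cart less_imp_le)
  ultimately show ?thesis
    by (intro that[of ?C]) (simp_all add: open_box)
qed

text \<open>After a lattice shift the preimage of an open neighbourhood of the value contains a
  nonempty open part of the cell, which is not negligible. So every value is essential, and range
  hypotheses become pointwise.\<close>

lemma continuous_in_essential_range: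
  fixes f :: "'d::finite spacetime \<Rightarrow> 'b::euclidean_space"
  assumes f: "continuous_on (cover ts) f" "periodic \<Omega> ts f" and z: "z \<in> cover ts"
  shows "f z \<in> essential_range (spacetime \<Omega> ts) f"
  unfolding essential_range_def
proof (intro CollectI allI impI)
  let ?M = "spacetime \<Omega> ts :: 'd spacetime measure"
  fix V assume V: "open V \<and> f z \<in> V"
  obtain k where k: "k \<in> lattice \<Omega>" "z + (k, 0) \<in> cylinder \<Omega>"
    by (rule cylinder_representative)
  obtain C :: "(real^'d) set" where C: "open C" "C \<subseteq> cell \<Omega>" "cell \<Omega> \<subseteq> closure C"
    by (rule cell_interior)
  obtain O' where O': "open O'" "O' \<inter> cover ts = f -` V \<inter> cover ts"
    using f(1) V unfolding continuous_on_open_invariant by blast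
  have "z + (k, 0) \<in> O' \<inter> cover ts"
    using periodicD[OF f(2) k(1) z] V z O'(2) by (auto simp: shift_in_cover)
  \<comment> \<open>The shifted point may lie on the boundary of the cell; being in the closure of
    the open part is enough for its open neighbourhood to meet that part.\<close>
  moreover have "z + (k, 0) \<in> closure (C \<times> UNIV)"
    using k(2) C(3) by (auto simp: closure_Times mem_Times_iff)
  ultimately have ne: "(O' \<inter> cover ts) \<inter> (C \<times> UNIV) \<noteq> {}"
    using O'(1) open_cover open_Int_closure_eq_empty[of "O' \<inter> cover ts" "C \<times> UNIV"] by blast
  have op: "open ((O' \<inter> cover ts) \<inter> (C \<times> UNIV))"
    using O'(1) C(1) open_cover by (intro open_Int open_Times) auto
  have meas: "{w \<in> space ?M. f w \<in> V} \<in> sets ?M"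
    using measurable_sets[OF continuous_measurable_spacetime[OF f(1)], of V \<Omega>] V
    by (simp add: vimage_def Int_def conj_commute)
  have sub: "(O' \<inter> cover ts) \<inter> (C \<times> UNIV) \<subseteq> {w \<in> space ?M. f w \<in> V}"
    using O'(2) C(2) by (auto simp: space_spacetime)
  show "0 < emeasure ?M {w \<in> space ?M. f w \<in> V}"
  proof (rule ccontr)
    assume "\<not> ?thesis"
    then have "emeasure ?M {w \<in> space ?M. f w \<in> V} = 0" by (simp add: zero_less_iff_neq_zero)
    then have "{w \<in> space ?M. f w \<in> V} \<in> null_sets (lebesgue_on (spacetime_cell \<Omega> ts))"
      using meas unfolding null_sets_def spacetime_def by auto
    then have "{w \<in> space ?M. f w \<in> V} \<in> null_sets lebesgue"
      using null_sets_restrict_space[OF spacetime_cell_lebesgue] by blast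
    then have "negligible {w \<in> space ?M. f w \<in> V}"
      by (simp add: negligible_iff_null_sets)
    then show False
      using negligible_subset[OF _ sub] open_not_negligible[OF op ne] by blast
  qed
qed

lemma continuous_bounded_on_compact:
  fixes h :: "real \<times> real \<Rightarrow> real"
  assumes "continuous_on U h" "compact K" "K \<subseteq> U"
  obtains B where "0 \<le> B" "\<And>w. w \<in> K \<Longrightarrow> \<bar>h w\<bar> \<le> B"
proof -
  have "bounded (h ` K)"
    using assms compact_continuous_image continuous_on_subset compact_imp_bounded by metis
  then obtain B where B: "\<And>w. w \<in> K \<Longrightarrow> \<bar>h w\<bar> \<le> B" unfolding bounded_iff by auto
  show ?thesis
    by (rule that[of "max 0 B"]) (use B in \<open>auto intro: max.coboundedI2\<close>)
qed

text \<open>\<open>K\<close> is not assumed convex, so the mean value theorem is applied along one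
  segment inside \<open>K\<close>, where compactness bounds both partial derivatives.\<close>

lemma C1_lipschitz_on_segments:
  fixes h :: "real \<times> real \<Rightarrow> real"
  assumes h: "C_k_on 1 h U" and K: "compact K" "K \<subseteq> U"
  obtains L where "0 \<le> L"
    "\<And>a b. closed_segment a b \<subseteq> K \<Longrightarrow> \<bar>h b - h a\<bar> \<le> L * (\<bar>fst b - fst a\<bar> + \<bar>snd b - snd a\<bar>)"
proof -
  obtain B1 where B1: "0 \<le> B1" "\<And>w. w \<in> K \<Longrightarrow> \<bar>D (1, 0) h w\<bar> \<le> B1"
    using continuous_bounded_on_compact[OF C_1_on_continuous_deriv[OF h] K] by metis
  obtain B2 where B2: "0 \<le> B2" "\<And>w. w \<in> K \<Longrightarrow> \<bar>D (0, 1) h w\<bar> \<le> B2"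
    using continuous_bounded_on_compact[OF C_1_on_continuous_deriv[OF h] K] by metis
  show ?thesis
  proof (rule that[of "B1 + B2"])
    fix a b assume seg: "closed_segment a b \<subseteq> K"
    have in_seg: "a + s *\<^sub>R (b - a) \<in> K" if "0 \<le> s" "s \<le> 1" for s
      using seg that unfolding closed_segment_def
      by (force simp: scaleR_diff_right scaleR_diff_left intro!: subsetD[OF seg[unfolded closed_segment_def]])
    have diff: "h differentiable at w" if "w \<in> K" for w
      using C_k_on_differentiable[OF h _ subsetD[OF K(2) that]] by simp
    have "\<exists>s. 0 < s \<and> s < 1 \<and> h (a + 1 *\<^sub>R (b - a)) - h (a + 0 *\<^sub>R (b - a))
        = (1 - 0) * D (b - a) h (a + s *\<^sub>R (b - a))"
      by (rule MVT2) (auto intro!: directional_derivative_line diff in_seg)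
    then obtain s where s: "0 < s" "s < 1"
      "h b - h a = D (b - a) h (a + s *\<^sub>R (b - a))" by auto
    define w where "w = a + s *\<^sub>R (b - a)"
    have w: "w \<in> K" unfolding w_def using s by (intro in_seg) auto
    note lin = linear_frechet_derivative[OF diff[OF w]]
    have "b - a = (fst b - fst a) *\<^sub>R (1, 0) + (snd b - snd a) *\<^sub>R (0, 1)"
      by (simp add: prod_eq_iff)
    then have "D (b - a) h w
        = (fst b - fst a) * D (1, 0) h w + (snd b - snd a) * D (0, 1) h w"
      by (simp only: linear_add[OF lin] linear_scale[OF lin] real_scaleR_def)
    then have "\<bar>h b - h a\<bar> \<le> \<bar>fst b - fst a\<bar> * \<bar>D (1, 0) h w\<bar>
        + \<bar>snd b - snd a\<bar> * \<bar>D (0, 1) h w\<bar>"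
      unfolding s(3) w_def[symmetric] by (metis abs_mult abs_triangle_ineq)
    also have "\<dots> \<le> \<bar>fst b - fst a\<bar> * (B1 + B2) + \<bar>snd b - snd a\<bar> * (B1 + B2)"
      using B1(1) B2(1) B1(2)[OF w] B2(2)[OF w] by (intro add_mono mult_left_mono) auto
    finally show "\<bar>h b - h a\<bar> \<le> (B1 + B2) * (\<bar>fst b - fst a\<bar> + \<bar>snd b - snd a\<bar>)"
      by (simp add: algebra_simps)
  qed (use B1 B2 in simp)
qed

section \<open>Vanishing fluxes\<close>

text \<open>The second clause makes \<open>R e\<close> integrable against test functions for small
  \<open>e\<close>. Bochner integrals are then additive, so that sums of null fluxes are null
  fluxes.\<close>

definition null_flux ::
    "space_domain \<Rightarrow> ereal \<Rightarrow> (real \<Rightarrow> 'd::finite spacetime \<Rightarrow> real) \<Rightarrow> bool" where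
  "null_flux \<Omega> ts R \<longleftrightarrow> distr_null \<Omega> ts R \<and>
     (\<forall>\<^sub>F e in at_right 0. C1_periodic \<Omega> ts (R e))"

lemma null_flux_zero: "null_flux \<Omega> ts (\<lambda>e z. 0)"
  unfolding null_flux_def distr_null_def using C_k_on_const by (auto simp: periodic_iff)

lemma null_flux_add:
  assumes "null_flux \<Omega> ts R" "null_flux \<Omega> ts R'"
  shows "null_flux \<Omega> ts (\<lambda>e z. R e z + R' e z)"
  unfolding null_flux_def distr_null_def
proof (intro conjI allI impI)
  let ?M = "spacetime \<Omega> ts"
  have ev: "\<forall>\<^sub>F e in at_right 0. (C1_periodic \<Omega> ts (R e)) \<and>
      C1_periodic \<Omega> ts (R' e)"
    by (rule eventually_conj; use assms in \<open>simp only: null_flux_def\<close>)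
  show "\<forall>\<^sub>F e in at_right 0. C1_periodic \<Omega> ts (\<lambda>z. R e z + R' e z)"
    using ev
  proof eventually_elim
    case (elim e)
    then show ?case using C_k_on_add[OF open_cover, of 1 "R e" ts "R' e"] by (simp add: periodic_iff del: C_k_on.simps One_nat_def)
  qed
  fix \<psi> :: "'a spacetime \<Rightarrow> real" assume \<psi>: "test_function \<Omega> ts \<psi>"
  have "((\<lambda>e. (\<integral>z. R e z * \<psi> z \<partial>?M) + (\<integral>z. R' e z * \<psi> z \<partial>?M)) \<longlongrightarrow> 0) (at_right 0)"
    using assms \<psi> tendsto_add[of "\<lambda>e. \<integral>z. R e z * \<psi> z \<partial>?M" 0 "at_right 0" "\<lambda>e. \<integral>z. R' e z * \<psi> z \<partial>?M" 0]
    unfolding null_flux_def distr_null_def by simp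
  moreover have "\<forall>\<^sub>F e in at_right 0. (\<integral>z. R e z * \<psi> z \<partial>?M) + (\<integral>z. R' e z * \<psi> z \<partial>?M)
      = (\<integral>z. (R e z + R' e z) * \<psi> z \<partial>?M)"
    using ev
  proof eventually_elim
    case (elim e)
    have "integrable ?M (\<lambda>z. R e z * \<psi> z)" "integrable ?M (\<lambda>z. R' e z * \<psi> z)"
      by (intro integrable_test_function[OF _ \<psi>] locally_integrable_continuous
          C_k_on_continuous[where k = 1]; use elim in blast)+
    then show ?case by (simp add: distrib_right)
  qed
  ultimately show "((\<lambda>e. \<integral>z. (R e z + R' e z) * \<psi> z \<partial>?M) \<longlongrightarrow> 0) (at_right 0)"
    by (rule Lim_transform_eventually)
qed

lemma null_flux_minus:
  assumes "null_flux \<Omega> ts R"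
  shows "null_flux \<Omega> ts (\<lambda>e z. - R e z)"
  unfolding null_flux_def distr_null_def
proof (intro conjI allI impI)
  show "\<forall>\<^sub>F e in at_right 0. C1_periodic \<Omega> ts (\<lambda>z. - R e z)"
    using conjunct2[OF assms[unfolded null_flux_def]]
  proof eventually_elim
    case (elim e)
    then show ?case
      using C_k_on_cmult[OF open_cover, of 1 "R e" ts "-1"] by (simp add: periodic_iff del: C_k_on.simps One_nat_def)
  qed
  fix \<psi> :: "'a spacetime \<Rightarrow> real" assume "test_function \<Omega> ts \<psi>"
  then have "((\<lambda>e. \<integral>z. R e z * \<psi> z \<partial>spacetime \<Omega> ts) \<longlongrightarrow> 0) (at_right 0)"
    using assms unfolding null_flux_def distr_null_def by blast
  from tendsto_minus[OF this] show "((\<lambda>e. \<integral>z. - R e z * \<psi> z \<partial>spacetime \<Omega> ts) \<longlongrightarrow> 0) (at_right 0)"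
    by simp
qed

lemma null_flux_sum:
  assumes "\<And>i. i \<in> I \<Longrightarrow> null_flux \<Omega> ts (R i)"
  shows "null_flux \<Omega> ts (\<lambda>e z. \<Sum>i\<in>I. R i e z)"
proof (cases "finite I")
  case True
  then show ?thesis using assms
    by (induction I rule: finite_induct) (auto intro: null_flux_zero null_flux_add)
qed (simp add: null_flux_zero)

lemma null_flux_dissipative:
  fixes R Z :: "real \<Rightarrow> 'd::finite spacetime \<Rightarrow> real"
  assumes Z: "converges_distr \<Omega> ts Z \<Lambda>"
    and R: "\<forall>\<^sub>F e in at_right 0. C1_periodic \<Omega> ts (R e)"
    and le: "\<forall>\<^sub>F e in at_right 0. AE z in spacetime \<Omega> ts. (R e z)\<^sup>2 \<le> C * e * Z e z"
  shows "null_flux \<Omega> ts R"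
proof -
  have "\<forall>\<^sub>F e in at_right 0. continuous_on (cover ts) (R e) \<and> periodic \<Omega> ts (R e)"
    using R by eventually_elim (blast intro: C_k_on_continuous)
  then show ?thesis
    unfolding null_flux_def using distr_null_dissipative[OF Z _ le] R by blast
qed

text \<open>The first part identifies the limit of a source about which nothing is known; the second
  turns a known limit of the source into a weak balance, by uniqueness of limits.\<close>

lemma weak_balance_limit:
  fixes a G :: "real \<Rightarrow> 'd::finite spacetime \<Rightarrow> real" and F R :: "'d \<Rightarrow> real \<Rightarrow> 'd spacetime \<Rightarrow> real"
    and F0 :: "'d spacetime \<Rightarrow> real^'d"
  assumes reg: "\<forall>\<^sub>F e in at_right 0. C1_periodic \<Omega> ts (a e) \<and>
      (\<forall>i. C1_periodic \<Omega> ts (F i e))"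
    and eq: "\<forall>\<^sub>F e in at_right 0.
      \<forall>z\<in>cover ts. dt (a e) z + (\<Sum>i\<in>UNIV. dx i (\<lambda>y. F i e y + R i e y) z) = G e z"
    and a: "local_limit \<Omega> ts a a0" and F: "\<And>i. local_limit \<Omega> ts (F i) (\<lambda>z. F0 z $ i)"
    and R: "\<And>i. null_flux \<Omega> ts (R i)"
  shows "test_function \<Omega> ts \<phi> \<Longrightarrow>
      ((\<lambda>e. \<integral>z. G e z * \<phi> z \<partial>spacetime \<Omega> ts) \<longlongrightarrow>
        - (\<integral>z. a0 z * time_deriv \<phi> z \<partial>spacetime \<Omega> ts)
        - (\<integral>z. F0 z \<bullet> gradient \<phi> z \<partial>spacetime \<Omega> ts)) (at_right 0)"
    and "(\<And>\<phi>. test_function \<Omega> ts \<phi> \<Longrightarrow>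
        ((\<lambda>e. \<integral>z. G e z * \<phi> z \<partial>spacetime \<Omega> ts) \<longlongrightarrow> \<Lambda> \<phi>) (at_right 0)) \<Longrightarrow>
      weak_balance \<Omega> ts a0 F0 \<Lambda>"
proof -
  have "\<forall>\<^sub>F e in at_right 0. \<forall>i. C1_periodic \<Omega> ts (R i e)"
    using R unfolding null_flux_def by (intro eventually_all_finite) blast
  with reg eq have "\<forall>\<^sub>F e in at_right 0. C1_periodic \<Omega> ts (a e) \<and>
      (\<forall>i. C1_periodic \<Omega> ts (F i e) \<and>
           C1_periodic \<Omega> ts (R i e)) \<and>
      (\<forall>z\<in>cover ts. dt (a e) z + (\<Sum>i\<in>UNIV. dx i (\<lambda>y. F i e y + R i e y) z) = G e z)"
    by eventually_elim blast
  note lim = limit_balance[OF this a F]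
  have R': "distr_null \<Omega> ts (R i)" for i using R unfolding null_flux_def by blast
  show lim': "((\<lambda>e. \<integral>z. G e z * \<phi> z \<partial>spacetime \<Omega> ts) \<longlongrightarrow>
        - (\<integral>z. a0 z * time_deriv \<phi> z \<partial>spacetime \<Omega> ts)
        - (\<integral>z. F0 z \<bullet> gradient \<phi> z \<partial>spacetime \<Omega> ts)) (at_right 0)"
    if "test_function \<Omega> ts \<phi>" for \<phi>
    by (rule lim[OF R' that])
  assume \<Lambda>: "\<And>\<phi>. test_function \<Omega> ts \<phi> \<Longrightarrow>
        ((\<lambda>e. \<integral>z. G e z * \<phi> z \<partial>spacetime \<Omega> ts) \<longlongrightarrow> \<Lambda> \<phi>) (at_right 0)"
  show "weak_balance \<Omega> ts a0 F0 \<Lambda>"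
    unfolding weak_balance_def
  proof (intro conjI allI impI)
    show "locally_integrable \<Omega> ts a0" by (rule local_limit_locally_integrable[OF a])
    show "locally_integrable \<Omega> ts F0"
      by (intro locally_integrable_vec local_limit_locally_integrable[OF F])
    show "- (\<integral>z. a0 z * time_deriv \<phi> z \<partial>spacetime \<Omega> ts) - (\<integral>z. F0 z \<bullet> gradient \<phi> z \<partial>spacetime \<Omega> ts) = \<Lambda> \<phi>"
      if "test_function \<Omega> ts \<phi>" for \<phi>
      using tendsto_unique[OF _ lim'[OF that] \<Lambda>[OF that]] by simp
  qed
qed

section \<open>Quadratic bounds on the viscous and heat fluxes\<close>

context navier_stokes_flow
begin

lemma coefficients_pos:
  assumes "z \<in> cover ts"
  shows "0 < \<eta> z" "0 < \<zeta> z" "0 < \<kappa> z"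
  using thermo states[OF assms] UW unfolding thermodynamic_def \<eta>_def \<zeta>_def \<kappa>_def by blast+

lemma dissipation_nonneg:
  assumes "0 \<le> \<epsilon>" "z \<in> cover ts"
  shows "0 \<le> dissipation th \<epsilon> u r v z"
  using coefficients_pos[OF assms(2)] assms(1)
  unfolding dissipation_def \<eta>_def \<zeta>_def by (intro add_nonneg_nonneg mult_nonneg_nonneg) auto

text \<open>All summands of \<open>(Th z)\<^sup>2\<close> times the entropy production are
  nonnegative, so it dominates the conduction term of a single direction.\<close>

lemma entropy_production_ge:
  assumes "0 \<le> \<epsilon>" "z \<in> cover ts"
  shows "\<epsilon> * \<kappa> z * (dx i Th z)\<^sup>2 \<le> (Th z)\<^sup>2 * entropy_production th \<epsilon> u r v z"
proof -
  note pos = temperature_pos[OF assms(2)] coefficients_pos[OF assms(2)]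
  have "\<epsilon> * \<kappa> z * (dx i Th z)\<^sup>2 \<le> (\<Sum>j\<in>UNIV. \<epsilon> * \<kappa> z * (dx j Th z)\<^sup>2)"
    using assms(1) pos by (intro member_le_sum) auto
  also have "\<dots> = (\<Sum>j\<in>UNIV. heat j z * dx j Th z)"
    by (simp add: heat_def power2_eq_square mult.assoc)
  also have "\<dots> \<le> Th z * dissipation th \<epsilon> u r v z + (\<Sum>j\<in>UNIV. heat j z * dx j Th z)"
    using pos dissipation_nonneg[OF assms] by simp
  also have "\<dots> = (Th z)\<^sup>2 * entropy_production th \<epsilon> u r v z"
    unfolding entropy_production_eq[OF assms(2)] using pos by (simp add: field_simps power2_eq_square)
  finally show ?thesis .
qed

lemma entropy_production_nonneg:
  assumes "0 \<le> \<epsilon>" "z \<in> cover ts"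
  shows "0 \<le> entropy_production th \<epsilon> u r v z"
proof -
  \<comment> \<open>Any direction serves, and \<open>undefined\<close> names one.\<close>
  have "0 \<le> \<epsilon> * \<kappa> z * (dx undefined Th z)\<^sup>2"
    using assms(1) coefficients_pos[OF assms(2)] by simp
  also note entropy_production_ge[OF assms]
  finally show ?thesis
    using temperature_pos[OF assms(2)] by (simp add: zero_le_mult_iff)
qed

text \<open>The stress is minus the sum of a shear part \<open>X\<close> and a bulk part
  \<open>Y\<close>, so its square is at most \<open>2 * X\<^sup>2 + 2 * Y\<^sup>2\<close>. In each
  square one coefficient is estimated by \<open>H\<close> and the other belongs to the dissipation.
  The shear coefficient carries an extra factor two, which yields 4.\<close>

lemma stress_square_le:
  assumes \<epsilon>: "0 \<le> \<epsilon>" and z: "z \<in> cover ts" and H: "\<eta> z \<le> H" "\<zeta> z \<le> H"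
  shows "(stress i j z)\<^sup>2 \<le> 4 * H * \<epsilon> * dissipation th \<epsilon> u r v z"
proof -
  note pos = coefficients_pos[OF z]
  define q1 where "q1 = 2 * (\<epsilon> * \<eta> z) * (norm (strain v z))\<^sup>2"
  define q2 where "q2 = \<epsilon> * \<zeta> z * (divergence v z)\<^sup>2"
  define X where "X = 2 * (\<epsilon> * \<eta> z) * strn i j z"
  define Y where "Y = (if i = j then \<epsilon> * \<zeta> z * divergence v z else 0)"
  have q: "0 \<le> q1" "0 \<le> q2" using \<epsilon> pos by (simp_all add: q1_def q2_def)
  have "\<bar>strn i j z\<bar> \<le> norm (strain v z)"
    unfolding strn_def by (rule order_trans[OF component_le_norm_cart Finite_Cartesian_Product.norm_nth_le])
  then have "(strn i j z)\<^sup>2 \<le> (norm (strain v z))\<^sup>2"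
    by (metis abs_ge_zero power2_abs power_mono)
  then have "2 * (\<epsilon> * \<eta> z) * (strn i j z)\<^sup>2 \<le> q1"
    unfolding q1_def using \<epsilon> pos by (intro mult_left_mono) auto
  then have "2 * \<epsilon> * \<eta> z * (2 * (\<epsilon> * \<eta> z) * (strn i j z)\<^sup>2) \<le> 2 * \<epsilon> * H * q1"
    using \<epsilon> pos H by (intro mult_mono) (auto intro: mult_left_mono)
  then have X: "X\<^sup>2 \<le> 2 * (\<epsilon> * H * q1)"
    unfolding X_def by (simp add: power2_eq_square mult_ac)
  have "\<epsilon> * \<zeta> z * q2 \<le> \<epsilon> * H * q2"
    using \<epsilon> H q by (intro mult_right_mono mult_left_mono) auto
  moreover have "Y\<^sup>2 \<le> \<epsilon> * \<zeta> z * q2"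
  proof (cases "i = j")
    case True
    then show ?thesis by (simp add: Y_def q2_def power2_eq_square mult_ac)
  next
    case False
    then show ?thesis using \<epsilon> pos q(2) by (simp add: Y_def)
  qed
  ultimately have Y: "Y\<^sup>2 \<le> \<epsilon> * H * q2" by simp
  have "(stress i j z)\<^sup>2 = (X + Y)\<^sup>2"
    unfolding stress_eq X_def[symmetric] Y_def[symmetric] by (simp add: power2_eq_square algebra_simps X_def)
  also have "\<dots> \<le> 2 * X\<^sup>2 + 2 * Y\<^sup>2"
    using sum_squares_bound[of X Y] by (simp add: power2_sum)
  also have "\<dots> \<le> 4 * (\<epsilon> * H * q1) + 4 * (\<epsilon> * H * q2)"
  proof -
    have "0 \<le> \<epsilon> * H * q2" using \<epsilon> H pos q by simp
    then show ?thesis using X Y by linarith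
  qed
  also have "\<dots> = 4 * H * \<epsilon> * dissipation th \<epsilon> u r v z"
    by (simp add: dissipation_def q1_def q2_def \<eta>_def \<zeta>_def algebra_simps)
  finally show ?thesis .
qed

text \<open>Of the two factors \<open>\<epsilon> * \<kappa> z\<close> in the square, one stays and
  supplies the smallness, the other is absorbed by the entropy production.\<close>

lemma heat_square_le:
  assumes \<epsilon>: "0 \<le> \<epsilon>" and z: "z \<in> cover ts"
  shows "(heat i z)\<^sup>2 \<le> \<epsilon> * \<kappa> z * ((Th z)\<^sup>2 * entropy_production th \<epsilon> u r v z)"
proof -
  have "(heat i z)\<^sup>2 = \<epsilon> * \<kappa> z * (\<epsilon> * \<kappa> z * (dx i Th z)\<^sup>2)"
    by (simp add: heat_def power2_eq_square mult_ac)
  also have "\<dots> \<le> \<epsilon> * \<kappa> z * ((Th z)\<^sup>2 * entropy_production th \<epsilon> u r v z)"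
    using \<epsilon> coefficients_pos[OF z] by (intro mult_left_mono entropy_production_ge \<epsilon> z) auto
  finally show ?thesis .
qed

lemma periodic_fields:
  assumes u: "periodic \<Omega> ts u" and r: "periodic \<Omega> ts r" and v: "periodic \<Omega> ts v"
  shows "periodic \<Omega> ts (\<lambda>z. v z $ i)" "periodic \<Omega> ts (\<lambda>z. h (u z, r z))"
    "periodic \<Omega> ts Th" "periodic \<Omega> ts (divergence v)"
    "periodic \<Omega> ts (stress i j)" "periodic \<Omega> ts (heat i)"
proof -
  show vi: "periodic \<Omega> ts (\<lambda>z. v z $ i)" for i using v by (simp add: periodic_iff)
  show h: "periodic \<Omega> ts (\<lambda>z. h (u z, r z))" for h :: "real \<times> real \<Rightarrow> 'z"
    using u r by (simp add: periodic_iff)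
  show Th: "periodic \<Omega> ts Th" using h[of "temperature th"] by (simp add: Th_def[abs_def])
  note d = vi[THEN periodic_frechet_derivative] Th[THEN periodic_frechet_derivative]
  show div: "periodic \<Omega> ts (divergence v)"
    unfolding divergence_eq[abs_def] using d(1) by (simp add: periodic_iff)
  have "periodic \<Omega> ts (strn i j)" for i j
    using d(1) div by (simp add: periodic_iff strn_eq)
  then show "periodic \<Omega> ts (stress i j)"
    using div u r by (simp add: periodic_iff stress_eq \<eta>_def \<zeta>_def)
  show "periodic \<Omega> ts (heat i)"
    using d(2) u r by (simp add: periodic_iff heat_def \<kappa>_def)
qed

end

section \<open>The inviscid limit\<close>

locale inviscid_limit =
  fixes \<Omega> :: space_domain and ts :: ereal and th :: fluid
    and W K U :: "(real \<times> real) set" and M :: nat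
    and e0 q :: real
    and ue re :: "real \<Rightarrow> 'd::finite spacetime \<Rightarrow> real"
    and ve :: "real \<Rightarrow> 'd spacetime \<Rightarrow> real^'d"
    and u \<rho> :: "'d spacetime \<Rightarrow> real" and v :: "'d spacetime \<Rightarrow> real^'d"
    and Q \<Sigma> :: "('d spacetime \<Rightarrow> real) \<Rightarrow> real"
  assumes e0: "0 < e0"
    and thermo: "thermodynamic W th"
    and periodic_e: "\<And>e. 0 < e \<Longrightarrow> e < e0 \<Longrightarrow>
      periodic \<Omega> ts (ue e) \<and> periodic \<Omega> ts (re e) \<and> periodic \<Omega> ts (ve e)"
    and smooth_e: "\<And>e. 0 < e \<Longrightarrow> e < e0 \<Longrightarrow>
      smooth_on (ue e) (cover ts) \<and> smooth_on (re e) (cover ts) \<and> smooth_on (ve e) (cover ts)"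
    and solution_e: "\<And>e. 0 < e \<Longrightarrow> e < e0 \<Longrightarrow>
      navier_stokes th e ts (ue e) (re e) (ve e)"
    and bounded_e: "\<exists>B. \<forall>e. 0 < e \<longrightarrow> e < e0 \<longrightarrow> (AE z in spacetime \<Omega> ts.
      \<bar>ue e z\<bar> \<le> B \<and> \<bar>re e z\<bar> \<le> B \<and> norm (ve e z) \<le> B)"
    and measurable_lim: "u \<in> borel_measurable (spacetime \<Omega> ts)"
      "\<rho> \<in> borel_measurable (spacetime \<Omega> ts)" "v \<in> borel_measurable (spacetime \<Omega> ts)"
    and q: "1 \<le> q"
    and strong: "converges_Lq_loc \<Omega> ts q ue u" "converges_Lq_loc \<Omega> ts q re \<rho>"
      "converges_Lq_loc \<Omega> ts q ve v"
    and K: "compact K" and U: "open U" "K \<subseteq> U" "U \<subseteq> W"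
    and ranges: "\<And>e. 0 < e \<Longrightarrow> e < e0 \<Longrightarrow>
      closure (convex hull
        (essential_range (spacetime \<Omega> ts) (\<lambda>z. (ue e z, re e z)) \<union>
         essential_range (spacetime \<Omega> ts) (\<lambda>z. (u z, \<rho> z)))) \<subseteq> K"
    and M: "2 \<le> M"
    and regular: "\<And>h. h \<in> {pressure th, temperature th, chem_potential th, entropy th,
        shear_viscosity th, bulk_viscosity th, conductivity th} \<Longrightarrow> C_k_on M h U"
    and Q: "converges_distr \<Omega> ts (\<lambda>e. dissipation th e (ue e) (re e) (ve e)) Q"
    and \<Sigma>: "converges_distr \<Omega> ts (\<lambda>e. entropy_production th e (ue e) (re e) (ve e)) \<Sigma>"

begin

abbreviation "pe e z \<equiv> pressure th (ue e z, re e z)"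
abbreviation "se e z \<equiv> entropy th (ue e z, re e z)"
abbreviation "Te e z \<equiv> temperature th (ue e z, re e z)"
abbreviation "kin e z \<equiv> 1/2 * re e z * (norm (ve e z))\<^sup>2"
abbreviation "Ee e \<equiv> energy (ue e) (re e) (ve e)"
abbreviation "stress_of i j e \<equiv> navier_stokes_flow.stress th e (ue e) (re e) (ve e) i j"
abbreviation "heat_of i e \<equiv> navier_stokes_flow.heat th e (ue e) (re e) i"
abbreviation "dissip e \<equiv> dissipation th e (ue e) (re e) (ve e)"
abbreviation "entropy_prod e \<equiv> entropy_production th e (ue e) (re e) (ve e)"
abbreviation "compression e z \<equiv> pe e z * divergence (ve e) z"

lemma eventually_small: "\<forall>\<^sub>F e in at_right 0. 0 < e \<and> e < e0"
  using eventually_at_right_real[OF e0] by simp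

lemma eventually_smallI: "(\<And>e. 0 < e \<Longrightarrow> e < e0 \<Longrightarrow> P e) \<Longrightarrow> \<forall>\<^sub>F e in at_right 0. P e"
  using eventually_small by (rule eventually_mono) blast

section \<open>Thermodynamic states and convergence of state functions\<close>

lemma range_subset_K:
  assumes "0 < e" "e < e0"
  shows "convex hull (essential_range (spacetime \<Omega> ts) (\<lambda>z. (ue e z, re e z)) \<union>
    essential_range (spacetime \<Omega> ts) (\<lambda>z. (u z, \<rho> z))) \<subseteq> K"
  using ranges[OF assms] closure_subset by (meson order_trans)

lemma smooth_fields:
  assumes "0 < e" "e < e0"
  shows "C_k_on k (ue e) (cover ts)" "C_k_on k (re e) (cover ts)" "C_k_on k (ve e) (cover ts)"
  using smooth_e[OF assms] unfolding smooth_on_def by blast+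

text \<open>Continuity upgrades membership almost everywhere to every point of
  \<open>cover ts\<close>, as the pointwise balance laws require.\<close>

lemma state_in_essential_range:
  assumes e: "0 < e" "e < e0" and z: "z \<in> cover ts"
  shows "(ue e z, re e z) \<in> essential_range (spacetime \<Omega> ts) (\<lambda>z. (ue e z, re e z))"
proof (rule continuous_in_essential_range[OF _ _ z])
  show "continuous_on (cover ts) (\<lambda>z. (ue e z, re e z))"
    by (intro continuous_on_Pair C_k_on_continuous[OF smooth_fields(1)[OF e, of 1]]
        C_k_on_continuous[OF smooth_fields(2)[OF e, of 1]])
  show "periodic \<Omega> ts (\<lambda>z. (ue e z, re e z))"
    using periodic_e[OF e] by (simp add: periodic_iff)
qed

lemma state_in_K:
  assumes "0 < e" "e < e0" "z \<in> cover ts"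
  shows "(ue e z, re e z) \<in> K"
  using state_in_essential_range[OF assms] range_subset_K[OF assms(1,2)]
    hull_subset[of _ convex] by blast

lemma limit_state_in_essential_range:
  "AE z in spacetime \<Omega> ts. (u z, \<rho> z) \<in> essential_range (spacetime \<Omega> ts) (\<lambda>z. (u z, \<rho> z))"
  using measurable_lim by (intro AE_essential_range) simp

lemma limit_state_in_K: "AE z in spacetime \<Omega> ts. (u z, \<rho> z) \<in> K"
proof -
  have "essential_range (spacetime \<Omega> ts) (\<lambda>z. (u z, \<rho> z)) \<subseteq> K"
    \<comment> \<open>The range of the limit does not depend on the parameter; \<open>e0 / 2\<close>
      is one admissible choice.\<close>
    by (rule order_trans[OF order_trans[OF Un_upper2 hull_subset] range_subset_K[of "e0 / 2"]])
      (use e0 in simp_all)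
  then show ?thesis
    using limit_state_in_essential_range by (auto elim!: eventually_mono)
qed

text \<open>Both end points lie in the union of the two essential ranges, whose convex hull is
  contained in \<open>K\<close>. This supplies the segments for
  \<open>C1_lipschitz_on_segments\<close>.\<close>

lemma segment_in_K:
  assumes "0 < e" "e < e0"
  shows "AE z in spacetime \<Omega> ts. closed_segment (u z, \<rho> z) (ue e z, re e z) \<subseteq> K"
  using limit_state_in_essential_range AE_space
proof eventually_elim
  case (elim z)
  let ?H = "convex hull (essential_range (spacetime \<Omega> ts) (\<lambda>z. (ue e z, re e z)) \<union>
    essential_range (spacetime \<Omega> ts) (\<lambda>z. (u z, \<rho> z)))"
  have "(u z, \<rho> z) \<in> ?H" "(ue e z, re e z) \<in> ?H"
    using elim state_in_essential_range[OF assms] by (auto intro!: hull_inc simp: space_spacetime)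
  then have "closed_segment (u z, \<rho> z) (ue e z, re e z) \<subseteq> ?H"
    by (intro closed_segment_subset convex_convex_hull)
  then show ?case using range_subset_K[OF assms] by blast
qed

lemma regular_C2:
  "h \<in> {pressure th, temperature th, chem_potential th, entropy th,
        shear_viscosity th, bulk_viscosity th, conductivity th} \<Longrightarrow> C_k_on 2 h U"
  using C_k_on_mono[OF regular M] .

lemma flow:
  assumes "0 < e" "e < e0"
  shows "navier_stokes_flow th W U e ts (ue e) (re e) (ve e)"
proof
  show "(ue e z, re e z) \<in> U" if "z \<in> cover ts" for z
    using state_in_K[OF assms that] U(2) by blast
qed (fact thermo U(3) regular_C2 smooth_fields[OF assms] solution_e[OF assms])+

lemma coefficient_bound:
  obtains H where "0 \<le> H"
    "\<And>e z. \<lbrakk>0 < e; e < e0; z \<in> cover ts\<rbrakk> \<Longrightarrow> shear_viscosity th (ue e z, re e z) \<le> H"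
    "\<And>e z. \<lbrakk>0 < e; e < e0; z \<in> cover ts\<rbrakk> \<Longrightarrow> bulk_viscosity th (ue e z, re e z) \<le> H"
    "\<And>e z. \<lbrakk>0 < e; e < e0; z \<in> cover ts\<rbrakk> \<Longrightarrow> conductivity th (ue e z, re e z) \<le> H"
    "\<And>e z. \<lbrakk>0 < e; e < e0; z \<in> cover ts\<rbrakk> \<Longrightarrow> Te e z \<le> H"
proof -
  have bound: "\<exists>B. \<forall>w\<in>K. h w \<le> B"
    if "h \<in> {pressure th, temperature th, chem_potential th, entropy th,
        shear_viscosity th, bulk_viscosity th, conductivity th}" for h
    using continuous_bounded_on_compact[OF C_k_on_continuous[OF regular_C2[OF that]] K U(2)]
    by (metis abs_le_D1)
  obtain B1 where B1: "\<And>w. w \<in> K \<Longrightarrow> shear_viscosity th w \<le> B1" using bound[of "shear_viscosity th"] by auto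
  obtain B2 where B2: "\<And>w. w \<in> K \<Longrightarrow> bulk_viscosity th w \<le> B2" using bound[of "bulk_viscosity th"] by auto
  obtain B3 where B3: "\<And>w. w \<in> K \<Longrightarrow> conductivity th w \<le> B3" using bound[of "conductivity th"] by auto
  obtain B4 where B4: "\<And>w. w \<in> K \<Longrightarrow> temperature th w \<le> B4" using bound[of "temperature th"] by auto
  show ?thesis
    by (rule that[of "max 0 (max (max B1 B2) (max B3 B4))"])
      (use B1 B2 B3 B4 state_in_K in \<open>auto simp: le_max_iff_disj\<close>)
qed

lemma limits_of_fields:
  "local_limit \<Omega> ts ue u" "local_limit \<Omega> ts re \<rho>"
  "local_limit \<Omega> ts (\<lambda>e z. ve e z $ i) (\<lambda>z. v z $ i)"
proof -
  obtain B where B: "\<And>e. 0 < e \<Longrightarrow> e < e0 \<Longrightarrow> AE z in spacetime \<Omega> ts.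
      \<bar>ue e z\<bar> \<le> B \<and> \<bar>re e z\<bar> \<le> B \<and> norm (ve e z) \<le> B"
    using bounded_e by blast
  have cont: "continuous_on (cover ts) (ue e)" "continuous_on (cover ts) (re e)"
    "continuous_on (cover ts) (\<lambda>z. ve e z $ i)" if "0 < e" "e < e0" for e
    using smooth_fields[OF that, THEN C_k_on_continuous] by (auto intro!: continuous_intros)
  show "local_limit \<Omega> ts ue u"
  proof (rule converges_Lq_loc_local_limit[OF q strong(1) measurable_lim(1) eventually_smallI])
    fix e assume e: "0 < e" "e < e0"
    show "ue e \<in> borel_measurable (spacetime \<Omega> ts) \<and> (AE z in spacetime \<Omega> ts. \<bar>ue e z\<bar> \<le> B)"
      using B[OF e] continuous_measurable_spacetime[OF cont(1)[OF e]] by auto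
  qed
  show "local_limit \<Omega> ts re \<rho>"
  proof (rule converges_Lq_loc_local_limit[OF q strong(2) measurable_lim(2) eventually_smallI])
    fix e assume e: "0 < e" "e < e0"
    show "re e \<in> borel_measurable (spacetime \<Omega> ts) \<and> (AE z in spacetime \<Omega> ts. \<bar>re e z\<bar> \<le> B)"
      using B[OF e] continuous_measurable_spacetime[OF cont(2)[OF e]] by auto
  qed
  have Lq: "converges_Lq_loc \<Omega> ts q (\<lambda>e z. ve e z $ i) (\<lambda>z. v z $ i)"
    by (rule converges_Lq_loc_norm_le[OF strong(3) q])
      (metis component_le_norm_cart real_norm_def vector_minus_component)
  have meas: "(\<lambda>z. v z $ i) \<in> borel_measurable (spacetime \<Omega> ts)"
    using measurable_lim(3) by (rule measurable_compose[OF _ borel_measurable_nth])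
  show "local_limit \<Omega> ts (\<lambda>e z. ve e z $ i) (\<lambda>z. v z $ i)"
  proof (rule converges_Lq_loc_local_limit[OF q Lq meas eventually_smallI])
    fix e assume e: "0 < e" "e < e0"
    have "AE z in spacetime \<Omega> ts. \<bar>ve e z $ i\<bar> \<le> B"
      using B[OF e] by eventually_elim (meson component_le_norm_cart order_trans)
    then show "(\<lambda>z. ve e z $ i) \<in> borel_measurable (spacetime \<Omega> ts) \<and> (AE z in spacetime \<Omega> ts. \<bar>ve e z $ i\<bar> \<le> B)"
      using continuous_measurable_spacetime[OF cont(3)[OF e]] by blast
  qed
qed

text \<open>The Lipschitz estimate along segments bounds the difference of the values by the
  differences of the states, which converge to zero in mean; compactness of \<open>K\<close> gives
  the common bound.\<close>

lemma limit_of_state_function: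
  assumes h: "C_k_on 2 h U"
  shows "local_limit \<Omega> ts (\<lambda>e z. h (ue e z, re e z)) (\<lambda>z. h (u z, \<rho> z))"
  unfolding local_limit_def
proof (intro allI impI)
  fix A :: "'d spacetime set" assume A: "compact_in \<Omega> ts A"
  let ?M = "spacetime \<Omega> ts :: 'd spacetime measure" and ?N = "local_measure \<Omega> ts A"
  interpret N: finite_measure ?N by (rule finite_local_measure[OF A])
  obtain B where B: "\<And>w. w \<in> K \<Longrightarrow> \<bar>h w\<bar> \<le> B"
    using continuous_bounded_on_compact[OF C_k_on_continuous[OF h] K U(2)] by metis
  obtain L where L: "0 \<le> L" "\<And>a b. closed_segment a b \<subseteq> K \<Longrightarrow>
      \<bar>h b - h a\<bar> \<le> L * (\<bar>fst b - fst a\<bar> + \<bar>snd b - snd a\<bar>)"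
    using C1_lipschitz_on_segments[OF C_2_on_imp_C_1[OF h] K U(2)] by metis
  have "continuous_on K h"
    using C_k_on_continuous[OF h] U(2) continuous_on_subset by blast
  \<comment> \<open>\<open>h\<close> is continuous on \<open>U\<close> only, so a Borel function is
    obtained by cutting off at \<open>K\<close>; along the limit states it agrees with
    \<open>h\<close> almost everywhere.\<close>
  then have "(\<lambda>w. indicator K w *\<^sub>R h w) \<in> borel_measurable borel"
    using K by (intro borel_measurable_continuous_on_indicator) (auto intro: borel_compact)
  moreover have "(\<lambda>z. (u z, \<rho> z)) \<in> borel_measurable ?M"
    using measurable_lim by simp
  ultimately have "(\<lambda>z. indicator K (u z, \<rho> z) *\<^sub>R h (u z, \<rho> z)) \<in> borel_measurable ?M"
    by (rule measurable_compose[rotated])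
  moreover have "AE z in ?M. indicator K (u z, \<rho> z) *\<^sub>R h (u z, \<rho> z) = h (u z, \<rho> z)"
    using limit_state_in_K by eventually_elim simp
  ultimately have meas: "(\<lambda>z. h (u z, \<rho> z)) \<in> borel_measurable ?M"
    by (rule spacetime_measurable_AE)
  note bl = limits_of_fields(1,2)[unfolded local_limit_def, rule_format, OF A]
  note i = N.bounded_L1_limit_integrable(3)[OF bl(1)] N.bounded_L1_limit_integrable(3)[OF bl(2)]
  show "bounded_L1_limit ?N (\<lambda>e z. h (ue e z, re e z)) (\<lambda>z. h (u z, \<rho> z))"
  proof (rule N.bounded_L1_limit_dominated)
    show "(\<lambda>z. h (u z, \<rho> z)) \<in> borel_measurable ?N" by (rule measurable_restrict_space1[OF meas])
    have "AE z in ?M. \<bar>h (u z, \<rho> z)\<bar> \<le> B" using limit_state_in_K by eventually_elim (rule B)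
    then show "AE z in ?N. \<bar>h (u z, \<rho> z)\<bar> \<le> B" by (rule AE_local_measure[OF A])
    show "\<forall>\<^sub>F e in at_right 0. (\<lambda>z. h (ue e z, re e z)) \<in> borel_measurable ?N \<and>
        (AE z in ?N. \<bar>h (ue e z, re e z)\<bar> \<le> B)"
    proof (rule eventually_smallI, intro conjI)
      fix e assume e: "0 < e" "e < e0"
      have "C_k_on 2 (\<lambda>z. h (ue e z, re e z)) (cover ts)"
        by (rule C_k_on_compose_pair[OF open_cover _ h smooth_fields(1,2)[OF e]])
          (use state_in_K[OF e] U(2) in blast)
      then show "(\<lambda>z. h (ue e z, re e z)) \<in> borel_measurable ?N"
        by (intro measurable_restrict_space1 continuous_measurable_spacetime C_k_on_continuous)
      show "AE z in ?N. \<bar>h (ue e z, re e z)\<bar> \<le> B"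
        using B state_in_K[OF e] by (intro AE_local_measure[OF A] AE_I2) (simp add: space_spacetime)
    qed
    show "\<forall>\<^sub>F e in at_right 0. integrable ?N (\<lambda>z. L * (\<bar>ue e z - u z\<bar> + \<bar>re e z - \<rho> z\<bar>))"
      using i by eventually_elim auto
    have "((\<lambda>e. L * ((\<integral>z. \<bar>ue e z - u z\<bar> \<partial>?N) + (\<integral>z. \<bar>re e z - \<rho> z\<bar> \<partial>?N))) \<longlongrightarrow> L * (0 + 0)) (at_right 0)"
      using bl unfolding bounded_L1_limit_def by (intro tendsto_mult_left tendsto_add) blast+
    then have "((\<lambda>e. L * ((\<integral>z. \<bar>ue e z - u z\<bar> \<partial>?N) + (\<integral>z. \<bar>re e z - \<rho> z\<bar> \<partial>?N))) \<longlongrightarrow> 0) (at_right 0)"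
      by simp
    then show "((\<lambda>e. \<integral>z. L * (\<bar>ue e z - u z\<bar> + \<bar>re e z - \<rho> z\<bar>) \<partial>?N) \<longlongrightarrow> 0) (at_right 0)"
      by (rule Lim_transform_eventually) (use i in \<open>eventually_elim, simp\<close>)
    show "\<forall>\<^sub>F e in at_right 0. AE z in ?N. \<bar>h (ue e z, re e z) - h (u z, \<rho> z)\<bar>
        \<le> L * (\<bar>ue e z - u z\<bar> + \<bar>re e z - \<rho> z\<bar>)"
    proof (rule eventually_smallI, rule AE_local_measure[OF A])
      fix e assume e: "0 < e" "e < e0"
      show "AE z in ?M. \<bar>h (ue e z, re e z) - h (u z, \<rho> z)\<bar>
          \<le> L * (\<bar>ue e z - u z\<bar> + \<bar>re e z - \<rho> z\<bar>)"
        using segment_in_K[OF e] by eventually_elim (use L(2) in fastforce)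
    qed
  qed
qed


section \<open>Vanishing of the heat fluxes\<close>

lemma null_heat: "null_flux \<Omega> ts (heat_of i)"
proof -
  obtain H where H: "0 \<le> H"
    "\<And>e z. \<lbrakk>0 < e; e < e0; z \<in> cover ts\<rbrakk> \<Longrightarrow> conductivity th (ue e z, re e z) \<le> H"
    "\<And>e z. \<lbrakk>0 < e; e < e0; z \<in> cover ts\<rbrakk> \<Longrightarrow> Te e z \<le> H"
    using coefficient_bound by metis
  show ?thesis
  proof (rule null_flux_dissipative[OF \<Sigma>]; rule eventually_smallI)
    fix e assume e: "0 < e" "e < e0"
    interpret f: navier_stokes_flow th W U e ts "ue e" "re e" "ve e" by (rule flow[OF e])
    let ?S = "entropy_prod e"
    show "C1_periodic \<Omega> ts (f.heat i)"
      using f.C1_heat f.periodic_fields(6) periodic_e[OF e] by blast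
    show "AE z in spacetime \<Omega> ts. (f.heat i z)\<^sup>2 \<le> (H * H\<^sup>2) * e * ?S z"
    proof (rule AE_I2)
      fix z :: "'d spacetime" assume "z \<in> space (spacetime \<Omega> ts)"
      then have z: "z \<in> cover ts" by (simp add: space_spacetime)
      have S: "0 \<le> ?S z" using f.entropy_production_nonneg[OF _ z] e by simp
      have "(f.heat i z)\<^sup>2 \<le> e * f.\<kappa> z * ((f.Th z)\<^sup>2 * ?S z)"
        using e(1) z by (intro f.heat_square_le) auto
      \<comment> \<open>\<open>H\<close> bounds both conductivity and temperature, whence the
        constant \<open>H * H\<^sup>2\<close>.\<close>
      also have "\<dots> \<le> e * H * (H\<^sup>2 * ?S z)"
        using e(1) H(1) H(2,3)[OF e z] S f.temperature_pos[OF z] f.coefficients_pos[OF z]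
        by (intro mult_mono mult_nonneg_nonneg mult_left_mono power_mono) (auto simp: f.\<kappa>_def f.Th_def)
      finally show "(f.heat i z)\<^sup>2 \<le> (H * H\<^sup>2) * e * ?S z" by (simp add: mult_ac)
    qed
  qed
qed

text \<open>The factor \<open>(Th z)\<^sup>2\<close> in \<open>heat_square_le\<close> cancels
  against the squared inverse temperature, so the constant involves only the conductivity.\<close>

lemma null_entropy_flux:
  "null_flux \<Omega> ts (\<lambda>e z. - (heat_of i e z * inverse (Te e z)))"
proof (rule null_flux_minus)
  obtain H where H: "0 \<le> H"
    "\<And>e z. \<lbrakk>0 < e; e < e0; z \<in> cover ts\<rbrakk> \<Longrightarrow> conductivity th (ue e z, re e z) \<le> H"
    using coefficient_bound by metis
  show "null_flux \<Omega> ts (\<lambda>e z. heat_of i e z * inverse (Te e z))"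
  proof (rule null_flux_dissipative[OF \<Sigma>]; rule eventually_smallI)
    fix e assume e: "0 < e" "e < e0"
    interpret f: navier_stokes_flow th W U e ts "ue e" "re e" "ve e" by (rule flow[OF e])
    let ?S = "entropy_prod e"
    have "C_k_on 1 (\<lambda>z. inverse (f.Th z)) (cover ts)"
      by (rule C_k_on_inverse[OF open_cover _ f.C1_fields(2)]) (use f.temperature_pos in force)
    then have "C_k_on 1 (\<lambda>z. f.heat i z * inverse (f.Th z)) (cover ts)"
      by (intro C_k_on_mult open_cover f.C1_heat)
    moreover have "periodic \<Omega> ts (f.heat i)" "periodic \<Omega> ts f.Th"
      using f.periodic_fields periodic_e[OF e] by blast+
    then have "periodic \<Omega> ts (\<lambda>z. f.heat i z * inverse (f.Th z))"
      by (simp add: periodic_iff)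
    ultimately show "C1_periodic \<Omega> ts (\<lambda>z. f.heat i z * inverse (Te e z))"
      unfolding f.Th_def by blast
    show "AE z in spacetime \<Omega> ts. (f.heat i z * inverse (Te e z))\<^sup>2 \<le> H * e * ?S z"
    proof (rule AE_I2)
      fix z :: "'d spacetime" assume "z \<in> space (spacetime \<Omega> ts)"
      then have z: "z \<in> cover ts" by (simp add: space_spacetime)
      have S: "0 \<le> ?S z" using f.entropy_production_nonneg[OF _ z] e by simp
      have T: "0 < f.Th z" by (rule f.temperature_pos[OF z])
      have "(f.heat i z * inverse (f.Th z))\<^sup>2 = (f.heat i z)\<^sup>2 * (inverse (f.Th z))\<^sup>2"
        by (rule power_mult_distrib)
      also have "\<dots> \<le> e * f.\<kappa> z * ((f.Th z)\<^sup>2 * ?S z) * (inverse (f.Th z))\<^sup>2"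
        using e(1) z by (intro mult_right_mono f.heat_square_le) auto
      also have "\<dots> = e * f.\<kappa> z * ?S z"
        using T by (simp add: field_simps power2_eq_square)
      also have "\<dots> \<le> e * H * ?S z"
        using e(1) S H(2)[OF e z] by (intro mult_right_mono mult_left_mono) (auto simp: f.\<kappa>_def)
      finally show "(f.heat i z * inverse (Te e z))\<^sup>2 \<le> H * e * ?S z"
        by (simp add: f.Th_def mult_ac)
    qed
  qed
qed

section \<open>Limits and regularity of the energies and fields\<close>

lemma norm_square_sum: "(norm x)\<^sup>2 = (\<Sum>i\<in>UNIV. x $ i * x $ i)" for x :: "real^'d"
  unfolding norm_vector_square by (simp add: power2_eq_square)

lemmas basic_limits = limits_of_fields
  limit_of_state_function[OF regular_C2[of "pressure th"], simplified]
  limit_of_state_function[OF regular_C2[of "entropy th"], simplified]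

text \<open>With the squared norm written as a sum of products, the closure rules for local limits
  apply.\<close>

lemma limit_of_energy:
  "local_limit \<Omega> ts (\<lambda>e z. kin e z) (\<lambda>z. 1/2 * \<rho> z * (norm (v z))\<^sup>2)"
  "local_limit \<Omega> ts (\<lambda>e. Ee e) (energy u \<rho> v)"
  unfolding energy_def[abs_def] norm_square_sum
  by (intro local_limit_add local_limit_mult local_limit_sum local_limit_const basic_limits)+

lemma regular_fields:
  assumes e: "0 < e" "e < e0"
  shows "C1_periodic \<Omega> ts (ue e)"
    "C1_periodic \<Omega> ts (re e)"
    "C1_periodic \<Omega> ts (\<lambda>z. ve e z $ i)"
    "C1_periodic \<Omega> ts (\<lambda>z. pe e z)"
    "C1_periodic \<Omega> ts (\<lambda>z. se e z)"
    "C1_periodic \<Omega> ts (divergence (ve e))"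
proof -
  interpret f: navier_stokes_flow th W U e ts "ue e" "re e" "ve e" by (rule flow[OF e])
  note C1 = f.C1_fields[unfolded f.p_def[abs_def] f.s_def[abs_def]] f.C1_divergence
    and per = periodic_e[OF e] f.periodic_fields(1,2,4)
  show "C1_periodic \<Omega> ts (ue e)" "C1_periodic \<Omega> ts (re e)" "C1_periodic \<Omega> ts (\<lambda>z. ve e z $ i)"
    "C1_periodic \<Omega> ts (pe e)" "C1_periodic \<Omega> ts (se e)" "C1_periodic \<Omega> ts (divergence (ve e))"
    using C1 per by blast+
qed

lemma regular_const: "C1_periodic \<Omega> ts (\<lambda>z. c)"
  using C_k_on_const by (blast intro: periodic_iff[THEN iffD2])

lemma regular_add:
  fixes f g :: "'d spacetime \<Rightarrow> real"
  assumes "C1_periodic \<Omega> ts f" "C1_periodic \<Omega> ts g"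
  shows "C1_periodic \<Omega> ts (\<lambda>z. f z + g z)"
  using assms C_k_on_add[OF open_cover, of 1 f ts g] by (auto simp: periodic_iff simp del: C_k_on.simps One_nat_def)

lemma regular_mult:
  fixes f g :: "'d spacetime \<Rightarrow> real"
  assumes "C1_periodic \<Omega> ts f" "C1_periodic \<Omega> ts g"
  shows "C1_periodic \<Omega> ts (\<lambda>z. f z * g z)"
  using assms C_k_on_mult[OF open_cover, of 1 f ts g] by (auto simp: periodic_iff simp del: C_k_on.simps One_nat_def)

lemma regular_sum:
  fixes f :: "'i \<Rightarrow> 'd spacetime \<Rightarrow> real"
  assumes "\<And>i. i \<in> I \<Longrightarrow> C1_periodic \<Omega> ts (f i)"
  shows "C1_periodic \<Omega> ts (\<lambda>z. \<Sum>i\<in>I. f i z)"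
  using assms C_k_on_sum[OF open_cover, of I 1 f ts] by (auto simp: periodic_iff simp del: C_k_on.simps One_nat_def)

lemma regular_energy:
  assumes e: "0 < e" "e < e0"
  shows "C1_periodic \<Omega> ts (\<lambda>z. kin e z)"
    "C1_periodic \<Omega> ts (Ee e)"
  unfolding energy_def[abs_def] norm_square_sum
  by (intro regular_add regular_mult regular_sum regular_const regular_fields[OF e])+

text \<open>The bounded factor \<open>w\<close> covers both occurrences of the stress: alone in the
  momentum flux, with \<open>w\<close> equal to one, and multiplied by a velocity component in the
  energy flux.\<close>

lemma null_stress_mult:
  assumes w: "\<And>e. 0 < e \<Longrightarrow> e < e0 \<Longrightarrow> C1_periodic \<Omega> ts (w e) \<and> (AE z in spacetime \<Omega> ts. \<bar>w e z\<bar> \<le> B)"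
  shows "null_flux \<Omega> ts (\<lambda>e z. stress_of i j e z * w e z)"
proof -
  obtain H where H: "0 \<le> H"
    "\<And>e z. \<lbrakk>0 < e; e < e0; z \<in> cover ts\<rbrakk> \<Longrightarrow> shear_viscosity th (ue e z, re e z) \<le> H"
    "\<And>e z. \<lbrakk>0 < e; e < e0; z \<in> cover ts\<rbrakk> \<Longrightarrow> bulk_viscosity th (ue e z, re e z) \<le> H"
    using coefficient_bound by metis
  show ?thesis
  proof (rule null_flux_dissipative[OF Q]; rule eventually_smallI)
    fix e assume e: "0 < e" "e < e0"
    interpret f: navier_stokes_flow th W U e ts "ue e" "re e" "ve e" by (rule flow[OF e])
    have "periodic \<Omega> ts (f.stress i j)" using f.periodic_fields(5) periodic_e[OF e] by blast
    then show "C1_periodic \<Omega> ts (\<lambda>z. f.stress i j z * w e z)"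
      using w[OF e] by (intro conjI C_k_on_mult open_cover f.C1_stress) (simp_all add: periodic_iff del: One_nat_def)
    have "AE z in spacetime \<Omega> ts. \<bar>w e z\<bar> \<le> B" using w[OF e] by blast
    then show "AE z in spacetime \<Omega> ts. (f.stress i j z * w e z)\<^sup>2 \<le> (4 * H * B\<^sup>2) * e * dissip e z"
      using AE_space
    proof eventually_elim
      case (elim z)
      then have z: "z \<in> cover ts" by (simp add: space_spacetime)
      have "(w e z)\<^sup>2 \<le> B\<^sup>2" using elim(1) by (simp add: abs_le_square_iff[symmetric])
      moreover have "(f.stress i j z)\<^sup>2 \<le> 4 * H * e * dissip e z"
        using H(2,3)[OF e z] e(1) z by (intro f.stress_square_le) (auto simp: f.\<eta>_def f.\<zeta>_def)
      ultimately have "(f.stress i j z)\<^sup>2 * (w e z)\<^sup>2 \<le> (4 * H * e * dissip e z) * B\<^sup>2"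
        using H(1) e(1) f.dissipation_nonneg[OF _ z] by (intro mult_mono) auto
      then show ?case by (simp add: power_mult_distrib mult_ac)
    qed
  qed
qed

lemma null_stress: "null_flux \<Omega> ts (stress_of i j)"
proof -
  have "null_flux \<Omega> ts (\<lambda>e z. stress_of i j e z * 1)"
    by (rule null_stress_mult[where B = 1], rule conjI[OF regular_const]) simp
  then show ?thesis by simp
qed

lemma null_stress_velocity: "null_flux \<Omega> ts (\<lambda>e z. stress_of i j e z * ve e z $ k)"
proof -
  obtain B where B: "\<And>e. 0 < e \<Longrightarrow> e < e0 \<Longrightarrow> AE z in spacetime \<Omega> ts.
      \<bar>ue e z\<bar> \<le> B \<and> \<bar>re e z\<bar> \<le> B \<and> norm (ve e z) \<le> B"
    using bounded_e by blast
  show ?thesis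
  proof (rule null_stress_mult, rule conjI)
    fix e assume e: "0 < e" "e < e0"
    show "C1_periodic \<Omega> ts (\<lambda>z. ve e z $ k)" by (rule regular_fields(3)[OF e])
    show "AE z in spacetime \<Omega> ts. \<bar>ve e z $ k\<bar> \<le> B"
      using B[OF e] by eventually_elim (meson component_le_norm_cart order_trans)
  qed
qed

section \<open>The Euler equations and the entropy balance\<close>

lemma euler_mass: "weak_balance \<Omega> ts \<rho> (\<lambda>z. \<rho> z *\<^sub>R v z) (\<lambda>\<phi>. 0)"
proof (rule weak_balance_limit(2)[where a = re and F = "\<lambda>i e z. re e z * ve e z $ i"
      and R = "\<lambda>i e z. 0" and G = "\<lambda>e z. 0"], goal_cases reg eq a F)
  case reg
  show ?case by (intro eventually_smallI conjI[OF _ allI] regular_mult regular_fields)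
next
  case eq
  show ?case
    using navier_stokes_flow.mass_balance[OF flow] by (intro eventually_smallI ballI) simp
next
  case (F i)
  show ?case
    unfolding vector_scaleR_component real_scaleR_def by (intro local_limit_mult basic_limits)
qed (simp_all add: basic_limits null_flux_zero)

lemma euler_momentum:
  "weak_balance \<Omega> ts (\<lambda>z. \<rho> z * v z $ i)
    (\<lambda>z. (\<rho> z *\<^sub>R outer (v z) (v z) + mat (pressure th (u z, \<rho> z))) $ i) (\<lambda>\<phi>. 0)"
proof (rule weak_balance_limit(2)[where a = "\<lambda>e z. re e z * ve e z $ i"
      and F = "\<lambda>j e z. re e z * (ve e z $ i * ve e z $ j) + (if i = j then pe e z else 0)"
      and R = "stress_of i" and G = "\<lambda>e z. 0"], goal_cases reg eq a F)
  case reg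
  have "C1_periodic \<Omega> ts (\<lambda>z. if i = j then pe e z else 0)" if "0 < e" "e < e0" for e j
    using regular_fields(4)[OF that] regular_const[of 0]
    by (cases "i = j") (simp_all del: C_k_on.simps One_nat_def)
  then show ?case
    by (intro eventually_smallI conjI[OF _ allI] regular_add regular_mult regular_fields)
next
  case eq
  show ?case
  proof (intro eventually_smallI ballI, goal_cases)
    case (1 e z)
    interpret f: navier_stokes_flow th W U e ts "ue e" "re e" "ve e" by (rule flow[OF 1(1,2)])
    show ?case using f.momentum_balance[OF 1(3), of i] unfolding f.p_def .
  qed
next
  case a
  show ?case by (intro local_limit_mult basic_limits)
next
  case (F j)
  have "local_limit \<Omega> ts (\<lambda>e z. if i = j then pe e z else 0)
      (\<lambda>z. if i = j then pressure th (u z, \<rho> z) else 0)"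
    using basic_limits(4) local_limit_const[of _ _ 0] by (cases "i = j") simp_all
  then show ?case
    unfolding vector_add_component vector_scaleR_component outer_def mat_def vec_lambda_beta real_scaleR_def
    by (intro local_limit_add local_limit_mult basic_limits)
qed (simp_all add: null_stress)

text \<open>The flux to be discarded is the stress applied to the velocity minus the heat flux; it
  is null because velocities are uniformly bounded.\<close>

lemma euler_energy:
  "weak_balance \<Omega> ts (energy u \<rho> v) (\<lambda>z. (pressure th (u z, \<rho> z) + energy u \<rho> v z) *\<^sub>R v z) (\<lambda>\<phi>. 0)"
proof (rule weak_balance_limit(2)[where a = Ee and F = "\<lambda>i e z. (pe e z + Ee e z) * ve e z $ i"
      and R = "\<lambda>i e z. (\<Sum>j\<in>UNIV. stress_of i j e z * ve e z $ j) + - heat_of i e z"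
      and G = "\<lambda>e z. 0"], goal_cases reg eq a F R)
  case reg
  show ?case
    by (intro eventually_smallI conjI[OF _ allI] regular_add regular_mult regular_fields regular_energy)
next
  case eq
  show ?case
  proof (intro eventually_smallI ballI, goal_cases)
    case (1 e z)
    interpret f: navier_stokes_flow th W U e ts "ue e" "re e" "ve e" by (rule flow[OF 1(1,2)])
    show ?case using f.energy_balance[OF 1(3)] unfolding f.p_def add_uminus_conv_diff .
  qed
next
  case (F i)
  show ?case
    unfolding vector_scaleR_component real_scaleR_def
    by (intro local_limit_add local_limit_mult basic_limits limit_of_energy)
next
  case (R i)
  show ?case
    by (intro null_flux_add null_flux_sum null_flux_minus null_stress_velocity null_heat)
qed (simp_all add: limit_of_energy)

text \<open>The source is the entropy production, whose limit \<open>\<Sigma>\<close> is given; the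
  advected entropy converges as a state function times a velocity component.\<close>

lemma entropy_limit:
  "weak_balance \<Omega> ts (\<lambda>z. entropy th (u z, \<rho> z)) (\<lambda>z. entropy th (u z, \<rho> z) *\<^sub>R v z) \<Sigma>"
proof (rule weak_balance_limit(2)[where a = se and F = "\<lambda>i e z. se e z * ve e z $ i"
      and R = "\<lambda>i e z. - (heat_of i e z * inverse (Te e z))" and G = entropy_prod],
    goal_cases reg eq a F R G)
  case reg
  show ?case by (intro eventually_smallI conjI[OF _ allI] regular_mult regular_fields)
next
  case eq
  show ?case
  proof (intro eventually_smallI ballI, goal_cases)
    case (1 e z)
    interpret f: navier_stokes_flow th W U e ts "ue e" "re e" "ve e" by (rule flow[OF 1(1,2)])
    show ?case using f.entropy_balance[OF 1(3)] unfolding f.s_def[abs_def] f.Th_def .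
  qed
next
  case (F i)
  show ?case
    unfolding vector_scaleR_component real_scaleR_def by (intro local_limit_mult basic_limits)
next
  case (G \<phi>)
  then show ?case using \<Sigma> unfolding converges_distr_def by blast
qed (simp_all add: basic_limits null_entropy_flux)

text \<open>The defect \<open>p * \<Theta>\<close>, read off from the internal energy balance.\<close>

definition p\<Theta> :: "('d spacetime \<Rightarrow> real) \<Rightarrow> real" where
  "p\<Theta> \<phi> = Q \<phi> + ((\<integral>z. u z * dt \<phi> z \<partial>spacetime \<Omega> ts)
     + (\<Sum>i\<in>UNIV. \<integral>z. (u z * v z $ i) * dx i \<phi> z \<partial>spacetime \<Omega> ts))"

section \<open>Pressure work, internal and kinetic energy in the limit\<close>

lemma Q_limit: "test_function \<Omega> ts \<phi> \<Longrightarrow>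
    ((\<lambda>e. \<integral>z. dissip e z * \<phi> z \<partial>spacetime \<Omega> ts) \<longlongrightarrow> Q \<phi>) (at_right 0)"
  using Q unfolding converges_distr_def by blast

text \<open>Premises of \<open>weak_balance_limit\<close> for the internal energy, used twice: to
  identify the limit of the compression and, once it is known, to obtain the weak balance.\<close>

lemma internal_limit_setup:
  shows "\<forall>\<^sub>F e in at_right 0. C1_periodic \<Omega> ts (ue e) \<and>
      (\<forall>i. C1_periodic \<Omega> ts (\<lambda>z. ue e z * ve e z $ i))"
    and "\<forall>\<^sub>F e in at_right 0. \<forall>z\<in>cover ts. dt (ue e) z
      + (\<Sum>i\<in>UNIV. dx i (\<lambda>y. ue e y * ve e y $ i + - heat_of i e y) z) = dissip e z - compression e z"
    and "local_limit \<Omega> ts (\<lambda>e z. ue e z * ve e z $ i) (\<lambda>z. (u z *\<^sub>R v z) $ i)"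
proof (goal_cases reg eq F)
  case reg
  show ?case by (intro eventually_smallI conjI[OF _ allI] regular_mult regular_fields)
next
  case eq
  show ?case
  proof (intro eventually_smallI ballI, goal_cases)
    case (1 e z)
    interpret f: navier_stokes_flow th W U e ts "ue e" "re e" "ve e" by (rule flow[OF 1(1,2)])
    show ?case using f.internal_balance[OF 1(3)] unfolding f.p_def .
  qed
next
  case F
  show ?case
    unfolding vector_scaleR_component real_scaleR_def by (intro local_limit_mult basic_limits)
qed

text \<open>Integrability allows the integral of a difference of sources to be split. The
  dissipation has it by the hypothesis of convergence, the compression by continuity and
  periodicity.\<close>

lemma integrable_sources:
  assumes \<phi>: "test_function \<Omega> ts \<phi>"
  shows "\<forall>\<^sub>F e in at_right 0. integrable (spacetime \<Omega> ts) (\<lambda>z. dissip e z * \<phi> z) \<and>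
    locally_integrable \<Omega> ts (compression e) \<and> integrable (spacetime \<Omega> ts) (\<lambda>z. compression e z * \<phi> z)"
  using Q[unfolded converges_distr_def, THEN conjunct1] eventually_small
proof eventually_elim
  case (elim e)
  have "C1_periodic \<Omega> ts (compression e)"
    using elim by (intro regular_mult regular_fields) auto
  then have "locally_integrable \<Omega> ts (compression e)"
    by (intro locally_integrable_continuous C_k_on_continuous[where k = 1]) blast+
  then show ?case using integrable_test_function[OF _ \<phi>] elim(1) by blast
qed

text \<open>Serves to instantiate \<open>integrable_sources\<close> when only its clause on local
  integrability is wanted.\<close>

lemma zero_test_function: "test_function \<Omega> ts (\<lambda>z. 0)"
  unfolding test_function_def smooth_on_def using C_k_on_const by (auto simp: periodic_iff compact_in_empty)

text \<open>The internal energy balance gives a limit for dissipation minus compression, and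
  \<open>p\<Theta>\<close> is defined so that this limit is
  \<open>Q \<phi> - p\<Theta> \<phi>\<close>. Subtracting it from the limit \<open>Q \<phi>\<close>
  of the dissipation isolates the compression.\<close>

lemma compression_limit:
  assumes \<phi>: "test_function \<Omega> ts \<phi>"
  shows "((\<lambda>e. \<integral>z. compression e z * \<phi> z \<partial>spacetime \<Omega> ts) \<longlongrightarrow> p\<Theta> \<phi>) (at_right 0)"
proof -
  let ?M = "spacetime \<Omega> ts :: 'd spacetime measure"
  have "((\<lambda>e. \<integral>z. (dissip e z - compression e z) * \<phi> z \<partial>?M) \<longlongrightarrow>
      - (\<integral>z. u z * time_deriv \<phi> z \<partial>?M) - (\<integral>z. (u z *\<^sub>R v z) \<bullet> gradient \<phi> z \<partial>?M)) (at_right 0)"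
    by (rule weak_balance_limit(1)[OF internal_limit_setup(1,2) basic_limits(1) internal_limit_setup(3)
          null_flux_minus[OF null_heat] \<phi>])
  also have "(\<integral>z. (u z *\<^sub>R v z) \<bullet> gradient \<phi> z \<partial>?M) = (\<Sum>i\<in>UNIV. \<integral>z. (u z * v z $ i) * dx i \<phi> z \<partial>?M)"
    using integral_gradient[OF local_limit_locally_integrable[OF internal_limit_setup(3)] \<phi>] by simp
  finally have lim: "((\<lambda>e. \<integral>z. (dissip e z - compression e z) * \<phi> z \<partial>?M) \<longlongrightarrow> Q \<phi> - p\<Theta> \<phi>) (at_right 0)"
    by (simp add: p\<Theta>_def time_deriv_def[abs_def])
  have "((\<lambda>e. (\<integral>z. dissip e z * \<phi> z \<partial>?M) - (\<integral>z. (dissip e z - compression e z) * \<phi> z \<partial>?M))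
      \<longlongrightarrow> p\<Theta> \<phi>) (at_right 0)"
    using tendsto_diff[OF Q_limit[OF \<phi>] lim] by simp
  moreover have "\<forall>\<^sub>F e in at_right 0. (\<integral>z. dissip e z * \<phi> z \<partial>?M)
      - (\<integral>z. (dissip e z - compression e z) * \<phi> z \<partial>?M) = (\<integral>z. compression e z * \<phi> z \<partial>?M)"
    using integrable_sources[OF \<phi>] by eventually_elim (simp add: left_diff_distrib)
  ultimately show ?thesis by (rule Lim_transform_eventually)
qed

lemma source_limit:
  assumes \<phi>: "test_function \<Omega> ts \<phi>"
  shows "((\<lambda>e. \<integral>z. (dissip e z - compression e z) * \<phi> z \<partial>spacetime \<Omega> ts) \<longlongrightarrow> Q \<phi> - p\<Theta> \<phi>) (at_right 0)"
    and "((\<lambda>e. \<integral>z. (compression e z - dissip e z) * \<phi> z \<partial>spacetime \<Omega> ts) \<longlongrightarrow> p\<Theta> \<phi> - Q \<phi>) (at_right 0)"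
proof -
  note lim = tendsto_diff[OF Q_limit[OF \<phi>] compression_limit[OF \<phi>]]
    tendsto_diff[OF compression_limit[OF \<phi>] Q_limit[OF \<phi>]]
  show "((\<lambda>e. \<integral>z. (dissip e z - compression e z) * \<phi> z \<partial>spacetime \<Omega> ts) \<longlongrightarrow> Q \<phi> - p\<Theta> \<phi>) (at_right 0)"
    by (rule Lim_transform_eventually[OF lim(1)])
      (use integrable_sources[OF \<phi>] in \<open>eventually_elim, simp add: left_diff_distrib\<close>)
  show "((\<lambda>e. \<integral>z. (compression e z - dissip e z) * \<phi> z \<partial>spacetime \<Omega> ts) \<longlongrightarrow> p\<Theta> \<phi> - Q \<phi>) (at_right 0)"
    by (rule Lim_transform_eventually[OF lim(2)])
      (use integrable_sources[OF \<phi>] in \<open>eventually_elim, simp add: left_diff_distrib\<close>)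
qed

text \<open>\<open>Q\<close> is a distribution by hypothesis, and the other terms are weak first
  derivatives of locally integrable limits in the coordinate directions.\<close>

lemma distribution_p\<Theta>: "distribution \<Omega> ts p\<Theta>"
  unfolding p\<Theta>_def[abs_def]
proof (intro distribution_add distribution_sum distribution_weak_deriv)
  show "distribution \<Omega> ts Q" using Q unfolding converges_distr_def by blast
  show "locally_integrable \<Omega> ts u" "locally_integrable \<Omega> ts (\<lambda>z. u z * v z $ i)" for i
    by (rule local_limit_locally_integrable[OF basic_limits(1)],
        rule local_limit_locally_integrable[OF local_limit_mult[OF basic_limits(1) basic_limits(3)]])
qed (auto simp: Basis_prod_def axis_in_Basis_iff)

lemma converges_p\<Theta>: "converges_distr \<Omega> ts compression p\<Theta>"
  unfolding converges_distr_def
proof (intro conjI allI impI distribution_p\<Theta> compression_limit)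
  show "\<forall>\<^sub>F e in at_right 0. locally_integrable \<Omega> ts (compression e)"
    using integrable_sources[OF zero_test_function] by eventually_elim (elim conjE)
qed

lemma internal_limit: "weak_balance \<Omega> ts u (\<lambda>z. u z *\<^sub>R v z) (\<lambda>\<phi>. Q \<phi> - p\<Theta> \<phi>)"
  by (rule weak_balance_limit(2)[OF internal_limit_setup(1,2) basic_limits(1) internal_limit_setup(3)
        null_flux_minus[OF null_heat] source_limit(1)])

lemma kinetic_limit:
  "weak_balance \<Omega> ts (\<lambda>z. 1/2 * \<rho> z * (norm (v z))\<^sup>2)
    (\<lambda>z. (pressure th (u z, \<rho> z) + 1/2 * \<rho> z * (norm (v z))\<^sup>2) *\<^sub>R v z) (\<lambda>\<phi>. p\<Theta> \<phi> - Q \<phi>)"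
proof (rule weak_balance_limit(2)[where a = kin and F = "\<lambda>j e z. (pe e z + kin e z) * ve e z $ j"
      and R = "\<lambda>j e z. \<Sum>i\<in>UNIV. stress_of j i e z * ve e z $ i"
      and G = "\<lambda>e z. compression e z - dissip e z"], goal_cases reg eq a F R G)
  case reg
  show ?case
    by (intro eventually_smallI conjI[OF _ allI] regular_energy
        regular_mult[OF regular_add[OF regular_fields(4) regular_energy(1)] regular_fields(3)])
next
  case eq
  show ?case
  proof (intro eventually_smallI ballI, goal_cases)
    case (1 e z)
    interpret f: navier_stokes_flow th W U e ts "ue e" "re e" "ve e" by (rule flow[OF 1(1,2)])
    show ?case using f.kinetic_balance[OF 1(3)] unfolding f.p_def .
  qed
next
  case a
  show ?case by (rule limit_of_energy(1))
next
  case (F j)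
  show ?case
    unfolding vector_scaleR_component real_scaleR_def
    by (rule local_limit_mult[OF local_limit_add[OF basic_limits(4) limit_of_energy(1)] basic_limits(3)])
next
  case (R j)
  show ?case by (intro null_flux_sum null_stress_velocity)
next
  case (G \<phi>)
  then show ?case by (rule source_limit(2))
qed

text \<open>Dissipation and entropy production are pointwise nonnegative, so their integrals against
  nonnegative test functions are too, and limits preserve the sign.\<close>

lemma nonneg_limits: "nonneg_distribution \<Omega> ts Q" "nonneg_distribution \<Omega> ts \<Sigma>"
proof -
  have nonneg: "nonneg_distribution \<Omega> ts \<Lambda>"
    if conv: "converges_distr \<Omega> ts Z \<Lambda>"
      and Z: "\<And>e z. 0 < e \<Longrightarrow> e < e0 \<Longrightarrow> z \<in> cover ts \<Longrightarrow> 0 \<le> Z e z"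
    for Z :: "real \<Rightarrow> 'd spacetime \<Rightarrow> real" and \<Lambda>
    unfolding nonneg_distribution_def
  proof (intro conjI allI impI)
    show "distribution \<Omega> ts \<Lambda>" using conv unfolding converges_distr_def by blast
    fix \<phi> :: "'d spacetime \<Rightarrow> real" assume \<phi>: "test_function \<Omega> ts \<phi>" "\<forall>z. 0 \<le> \<phi> z"
    have lim: "((\<lambda>e. \<integral>z. Z e z * \<phi> z \<partial>spacetime \<Omega> ts) \<longlongrightarrow> \<Lambda> \<phi>) (at_right 0)"
      using conv \<phi>(1) unfolding converges_distr_def by blast
    have "\<forall>\<^sub>F e in at_right 0. 0 \<le> (\<integral>z. Z e z * \<phi> z \<partial>spacetime \<Omega> ts)"
      using Z \<phi>(2) by (intro eventually_smallI Bochner_Integration.integral_nonneg_AE AE_I2)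
        (auto simp: space_spacetime simp del: split_paired_All)
    from tendsto_lowerbound[OF lim this] show "0 \<le> \<Lambda> \<phi>" by simp
  qed
  show "nonneg_distribution \<Omega> ts Q"
    by (rule nonneg[OF Q]) (rule navier_stokes_flow.dissipation_nonneg[OF flow], auto)
  show "nonneg_distribution \<Omega> ts \<Sigma>"
    by (rule nonneg[OF \<Sigma>]) (rule navier_stokes_flow.entropy_production_nonneg[OF flow], auto)
qed

end

theorem theorem2:
  fixes \<Omega> :: space_domain and ts :: ereal and th :: fluid
    and W K U :: "(real \<times> real) set" and M :: nat
    and \<epsilon>0 \<rho>0 q :: real
    and u\<epsilon> \<rho>\<epsilon> :: "real \<Rightarrow> 'd::finite spacetime \<Rightarrow> real"
    and v\<epsilon> :: "real \<Rightarrow> 'd spacetime \<Rightarrow> real^'d"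
    and u \<rho> :: "'d spacetime \<Rightarrow> real" and v :: "'d spacetime \<Rightarrow> real^'d"
    and Q \<Sigma> :: "('d spacetime \<Rightarrow> real) \<Rightarrow> real"
  assumes ts: "0 < ts" and \<epsilon>0: "0 < \<epsilon>0"
    and thermo: "thermodynamic W th"
    \<comment> \<open>smooth Navier--Stokes solutions, their bounds and their strong limits\<close>
    and periodic_\<epsilon>: "\<And>\<epsilon>. 0 < \<epsilon> \<Longrightarrow> \<epsilon> < \<epsilon>0 \<Longrightarrow>
      periodic \<Omega> ts (u\<epsilon> \<epsilon>) \<and> periodic \<Omega> ts (\<rho>\<epsilon> \<epsilon>) \<and> periodic \<Omega> ts (v\<epsilon> \<epsilon>)"
    and smooth_\<epsilon>: "\<And>\<epsilon>. 0 < \<epsilon> \<Longrightarrow> \<epsilon> < \<epsilon>0 \<Longrightarrow>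
      smooth_on (u\<epsilon> \<epsilon>) (cover ts) \<and> smooth_on (\<rho>\<epsilon> \<epsilon>) (cover ts) \<and> smooth_on (v\<epsilon> \<epsilon>) (cover ts)"
    and solution_\<epsilon>: "\<And>\<epsilon>. 0 < \<epsilon> \<Longrightarrow> \<epsilon> < \<epsilon>0 \<Longrightarrow>
      navier_stokes th \<epsilon> ts (u\<epsilon> \<epsilon>) (\<rho>\<epsilon> \<epsilon>) (v\<epsilon> \<epsilon>)"
    and bounded_\<epsilon>: "\<exists>B. \<forall>\<epsilon>. 0 < \<epsilon> \<longrightarrow> \<epsilon> < \<epsilon>0 \<longrightarrow> (AE z in spacetime \<Omega> ts.
      \<bar>u\<epsilon> \<epsilon> z\<bar> \<le> B \<and> \<bar>\<rho>\<epsilon> \<epsilon> z\<bar> \<le> B \<and> norm (v\<epsilon> \<epsilon> z) \<le> B)"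
    and periodic_lim: "periodic \<Omega> ts u" "periodic \<Omega> ts \<rho>" "periodic \<Omega> ts v"
    and measurable_lim: "u \<in> borel_measurable (spacetime \<Omega> ts)"
      "\<rho> \<in> borel_measurable (spacetime \<Omega> ts)" "v \<in> borel_measurable (spacetime \<Omega> ts)"
    and q: "1 \<le> q"
    and strong: "converges_Lq_loc \<Omega> ts q u\<epsilon> u" "converges_Lq_loc \<Omega> ts q \<rho>\<epsilon> \<rho>"
      "converges_Lq_loc \<Omega> ts q v\<epsilon> v"
    and \<rho>0: "0 < \<rho>0"
    and no_vacuum: "\<And>\<epsilon> z. 0 < \<epsilon> \<Longrightarrow> \<epsilon> < \<epsilon>0 \<Longrightarrow> z \<in> cover ts \<Longrightarrow> \<rho>0 \<le> \<rho>\<epsilon> \<epsilon> z"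
    \<comment> \<open>range of states and regularity of the thermodynamic functions\<close>
    and K: "compact K" and U: "open U" "K \<subseteq> U" "U \<subseteq> W"
    and ranges: "\<And>\<epsilon>. 0 < \<epsilon> \<Longrightarrow> \<epsilon> < \<epsilon>0 \<Longrightarrow>
      closure (convex hull
        (essential_range (spacetime \<Omega> ts) (\<lambda>z. (u\<epsilon> \<epsilon> z, \<rho>\<epsilon> \<epsilon> z)) \<union>
         essential_range (spacetime \<Omega> ts) (\<lambda>z. (u z, \<rho> z)))) \<subseteq> K"
    and M: "2 \<le> M"
    and regular: "\<And>h. h \<in> {pressure th, temperature th, chem_potential th, entropy th,
        shear_viscosity th, bulk_viscosity th, conductivity th} \<Longrightarrow> C_k_on M h U"
    \<comment> \<open>limits of the dissipation and of the entropy production\<close>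
    and Q: "converges_distr \<Omega> ts (\<lambda>\<epsilon>. dissipation th \<epsilon> (u\<epsilon> \<epsilon>) (\<rho>\<epsilon> \<epsilon>) (v\<epsilon> \<epsilon>)) Q"
    and \<Sigma>: "converges_distr \<Omega> ts (\<lambda>\<epsilon>. entropy_production th \<epsilon> (u\<epsilon> \<epsilon>) (\<rho>\<epsilon> \<epsilon>) (v\<epsilon> \<epsilon>)) \<Sigma>"
  shows "weak_euler th \<Omega> ts u \<rho> v \<and>
    (\<exists>P. converges_distr \<Omega> ts
           (\<lambda>\<epsilon> z. pressure th (u\<epsilon> \<epsilon> z, \<rho>\<epsilon> \<epsilon> z) * divergence (v\<epsilon> \<epsilon>) z) P \<and>
         weak_balance \<Omega> ts (\<lambda>z. 1/2 * \<rho> z * (norm (v z))\<^sup>2)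
           (\<lambda>z. (pressure th (u z, \<rho> z) + 1/2 * \<rho> z * (norm (v z))\<^sup>2) *\<^sub>R v z)
           (\<lambda>\<phi>. P \<phi> - Q \<phi>) \<and>
         weak_balance \<Omega> ts u (\<lambda>z. u z *\<^sub>R v z) (\<lambda>\<phi>. Q \<phi> - P \<phi>)) \<and>
    weak_balance \<Omega> ts (\<lambda>z. entropy th (u z, \<rho> z)) (\<lambda>z. entropy th (u z, \<rho> z) *\<^sub>R v z) \<Sigma> \<and>
    nonneg_distribution \<Omega> ts Q \<and> nonneg_distribution \<Omega> ts \<Sigma>"
proof -
  interpret inviscid_limit \<Omega> ts th W K U M \<epsilon>0 q u\<epsilon> \<rho>\<epsilon> v\<epsilon> u \<rho> v Q \<Sigma>
    by (rule inviscid_limit.intro; fact assms)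
  show ?thesis
    unfolding weak_euler_def
    by (intro conjI allI exI[of _ p\<Theta>] euler_mass euler_momentum euler_energy converges_p\<Theta>
        kinetic_limit internal_limit entropy_limit nonneg_limits)
qed

end
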